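(* Let $\beta\in[0,1]$ and let $(H_N)_N$ be a Curie-Weiss($\beta$) ensemble. Then $(H_N)_N$ is an ensemble of Curie-Weiss type. Consequently the local law holds for it: for every fixed $\tau\in(0,1)$, with $G(z)=(H_N-z)^{-1}$, $s(z)=\frac1N\operatorname{tr}G(z)$, $m$ the Stieltjes transform of the semicircle distribution, $\Lambda(z)=\max_{i,j}|G_{ij}(z)-m(z)\delta_{ij}|$, $\eta=\operatorname{Im}z$, $E=\operatorname{Re}z$, $\kappa=\big||E|-2\big|$, $$\max\big(\Lambda(z),|s(z)-m(z)|\big)\prec\frac{\frac{1}{\sqrt{N\eta}}}{\sqrt{\kappa+\eta+\frac{1}{\sqrt{N\eta}}}}\quad\text{uniformly in } z\in\left[-\tfrac1\tau,\tfrac1\tau\right]+i\left[\tfrac{1}{N^{1-\tau}},\tfrac1\tau\right],$$ and $$\max\big(\Lambda(z),|s(z)-m(z)|\big)\prec\frac{1}{\sqrt{N\eta}}\quad\text{uniformly in } z\in\left[-2+\tau,2-\tau\right]+i\left[\tfrac{1}{N^{1-\tau}},\tfrac1\tau\right].$$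
   Context: Curie-Weiss distribution: for $\beta\ge0$, $M\in\mathbb{N}$, random variables $Y_1,\dots,Y_M$ are Curie-Weiss($\beta,M$)-distributed if $\mathbb{P}(Y_1=y_1,\dots,Y_M=y_M)=\frac{1}{Z_{\beta,M}}e^{\frac{\beta}{2M}(\sum_i y_i)^2}$ for all $y_1,\dots,y_M\in\{-1,1\}$, with $Z_{\beta,M}$ a normalization constant. Curie-Weiss($\beta$) ensemble: for each $N$ let $(\tilde X_N(i,j))_{1\le i,j\le N}$ be Curie-Weiss($\beta,N^2$)-distributed, and set $H_N(i,j)=\frac{1}{\sqrt N}\tilde X_N(i,j)$ if $i\le j$ and $H_N(i,j)=\frac{1}{\sqrt N}\tilde X_N(j,i)$ if $i>j$. De-Finetti type: for a finite index set $I$, a family $Y_I=(Y_i)_{i\in I}$ of real random variables on a probability space $(\Omega,\mathcal{A},\mathbb{P})$ is of de-Finetti type with respect to the mixing space $(T,\mathcal{T},\mu,P)$ if $(T,\mathcal{T},\mu)$ is a probability space, $P:T\to\mathcal{M}_1(\mathbb{R})$, $t\mapsto P_t$, is measurable ($\mathcal{M}_1(\mathbb{R})$ = Borel probability measures on $\mathbb{R}$ with the Borel $\sigma$-algebra of the weak topology), and $\mathbb{P}(Y_I\in B)=\int_T P_t^{\otimes I}(B)\,d\mu(t)$ for all measurable $B\subseteq\mathbb{R}^I$. Curie-Weiss type: a sequence $(H_N)_N$ of real symmetric random $N\times N$ matrices is of Curie-Weiss type if (a) for all $N$, $(H_N(i,j))_{1\le i\le j\le N}=(\frac{1}{\sqrt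 N}X_N(i,j))_{1\le i\le j\le N}$, where $(X_N(i,j))_{1\le i\le j\le N}$ is of de-Finetti type with respect to some mixing space $(T_N,\mathcal{T}_N,\mu_N,P^{(N)})$; and (b) with $m_N^{(\ell)}(t)=\int_{\mathbb{R}}x^\ell\,dP^{(N)}_t(x)$, for every even $p\in\mathbb{N}$ there is $K_p\ge 0$ such that for all $N\in\mathbb{N}$: $\int_{T_N}|m_N^{(1)}(t)|^p\,d\mu_N(t)\le K_pN^{-p/2}$; $\int_{T_N}|1-m_N^{(2)}(t)|^p\,d\mu_N(t)\le K_pN^{-p/2}$; $\sup_{t\in T_N}\int_{\mathbb{R}}|y-m_N^{(1)}(t)|^p\,dP_t^{(N)}(y)\le K_p$; $\sup_{t\in T_N}\int_{\mathbb{R}}|y^2-m_N^{(2)}(t)|^p\,dP_t^{(N)}(y)\le K_p$. Stochastic domination: for complex random variables $X^{(N)}(u)$ and non-negative random variables $Y^{(N)}(u)$, $u\in U^{(N)}$, we write $X\prec Y$ uniformly in $u\in U^{(N)}$ if for all $\epsilon,D>0$ there is $C_{\epsilon,D}\ge0$ with $\sup_{u\in U^{(N)}}\mathbb{P}(|X^{(N)}(u)|>N^\epsilon Y^{(N)}(u))\le C_{\epsilon,D}N^{-D}$ for all $N\in\mathbb{N}$. The semicircle distribution has Lebesgue density $x\mapsto\frac{1}{2\pi}\sqrt{(4-x^2)_+}$; the Stieltjes transform of a probability measure $\nu$ on $\mathbb{R}$ is $z\mapsto\int\frac{1}{x-z}\,d\nu(x)$ for $\operatorname{Im}z>0$. 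*)

theory Defs
  imports
    "HOL-Probability.Probability"
    "Jordan_Normal_Form.Gauss_Jordan_Elimination"
begin

text \<open>
  Sequences are indexed by \<open>N :: nat\<close> with \<open>N \<ge> 1\<close>, and matrix rows and columns
  by \<open>0, \<dots>, N - 1\<close>. The \<open>N\<close>-th random object of a sequence lives on its own probability
  space \<open>M N\<close>; a common probability space is the special case of constant \<open>M\<close>.
\<close>

definition curie_weiss_weight :: "real \<Rightarrow> 'i set \<Rightarrow> ('i \<Rightarrow> real) \<Rightarrow> real" where
  "curie_weiss_weight \<beta> J y = exp (\<beta> / (2 * real (card J)) * (\<Sum>i\<in>J. y i)\<^sup>2)"

definition curie_weiss_distributed ::
    "real \<Rightarrow> 'i set \<Rightarrow> 'a measure \<Rightarrow> ('i \<Rightarrow> 'a \<Rightarrow> real) \<Rightarrow> bool" where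
  "curie_weiss_distributed \<beta> J \<Omega> Y \<longleftrightarrow>
     prob_space \<Omega> \<and> (\<forall>i\<in>J. Y i \<in> borel_measurable \<Omega>) \<and>
     (\<forall>y \<in> J \<rightarrow>\<^sub>E {-1, 1}.
        measure \<Omega> {\<omega> \<in> space \<Omega>. \<forall>i\<in>J. Y i \<omega> = y i} =
          1 / (\<Sum>y' \<in> J \<rightarrow>\<^sub>E {-1, 1}. curie_weiss_weight \<beta> J y') * curie_weiss_weight \<beta> J y)"

definition curie_weiss_ensemble ::
    "real \<Rightarrow> (nat \<Rightarrow> 'a measure) \<Rightarrow> (nat \<Rightarrow> 'a \<Rightarrow> real mat) \<Rightarrow> bool" where
  "curie_weiss_ensemble \<beta> M H \<longleftrightarrow>
     (\<forall>N\<ge>1. \<exists>X :: nat \<times> nat \<Rightarrow> 'a \<Rightarrow> real.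
        curie_weiss_distributed \<beta> ({..<N} \<times> {..<N}) (M N) X \<and>
        (\<forall>\<omega>\<in>space (M N). H N \<omega> =
           Matrix.mat N N (\<lambda>(i, j). 1 / sqrt (real N) * (if i \<le> j then X (i, j) \<omega> else X (j, i) \<omega>))))"

text \<open>
  The topology of weak convergence on the Borel probability measures on the real line, as the
  initial topology of the maps \<open>\<nu> \<mapsto> \<integral>f d\<nu>\<close> for bounded continuous \<open>f\<close>.
\<close>

definition weak_topology :: "real measure topology" where
  "weak_topology = topology_generated_by
     {{\<nu>. prob_space \<nu> \<and> sets \<nu> = sets borel \<and> (\<integral>x. f x \<partial>\<nu>) \<in> U} | (f :: real \<Rightarrow> real) (U :: real set).
        continuous_on UNIV f \<and> bounded (range f) \<and> open U}"

lemma topspace_weak_topology: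
  "topspace weak_topology = {\<nu>. prob_space \<nu> \<and> sets \<nu> = sets borel}"
proof -
  have "{\<nu>. prob_space \<nu> \<and> sets \<nu> = sets borel \<and> (\<integral>x. (0::real) \<partial>\<nu>) \<in> (UNIV :: real set)} \<in>
     {{\<nu>. prob_space \<nu> \<and> sets \<nu> = sets borel \<and> (\<integral>x. f x \<partial>\<nu>) \<in> U} | (f :: real \<Rightarrow> real) (U :: real set).
        continuous_on UNIV f \<and> bounded (range f) \<and> open U}"
    by (rule CollectI, rule exI[of _ "\<lambda>_. 0"], rule exI[of _ UNIV]) auto
  then show ?thesis
    unfolding weak_topology_def topology_generated_by_topspace by blast
qed

definition weak_borel :: "real measure measure" where
  "weak_borel = sigma (topspace weak_topology) {U. openin weak_topology U}"

text \<open>A mixing space is given by a measure space \<open>T\<close> (carrying its sigma-algebra and \<open>\<mu>\<close>) and \<open>P\<close>.\<close>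

definition mixing_space :: "'t measure \<Rightarrow> ('t \<Rightarrow> real measure) \<Rightarrow> bool" where
  "mixing_space T P \<longleftrightarrow> prob_space T \<and> P \<in> T \<rightarrow>\<^sub>M weak_borel"

definition de_finetti_type ::
    "'i set \<Rightarrow> 'a measure \<Rightarrow> ('i \<Rightarrow> 'a \<Rightarrow> real) \<Rightarrow> 't measure \<Rightarrow> ('t \<Rightarrow> real measure) \<Rightarrow> bool" where
  "de_finetti_type I \<Omega> Y T P \<longleftrightarrow>
     finite I \<and> prob_space \<Omega> \<and> (\<forall>i\<in>I. Y i \<in> borel_measurable \<Omega>) \<and> mixing_space T P \<and>
     (\<forall>B \<in> sets (\<Pi>\<^sub>M i\<in>I. (borel :: real measure)).
        emeasure \<Omega> {\<omega> \<in> space \<Omega>. (\<lambda>i\<in>I. Y i \<omega>) \<in> B} =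
          (\<integral>\<^sup>+t. emeasure (\<Pi>\<^sub>M i\<in>I. P t) B \<partial>T))"

definition mixing_moment :: "('t \<Rightarrow> real measure) \<Rightarrow> nat \<Rightarrow> 't \<Rightarrow> real" where
  "mixing_moment P l t = (\<integral>x. x ^ l \<partial>(P t))"

text \<open>
  The integrals below are extended non-negative ones, so each bound includes finiteness.
  For \<open>p = 2\<close> the last two bounds force \<open>x\<close> and \<open>x\<^sup>2\<close> to be integrable under every \<open>P N t\<close>,
  so that \<^const>\<open>mixing_moment\<close> never takes the default value of a divergent integral.

  HOL cannot quantify existentially over the type underlying the mixing spaces, so it is a
  parameter. The instance \<open>TYPE(real)\<close> is the general case: a mixing space can be replaced by its
  image under \<open>P\<close> in the space of probability measures satisfying the two pointwise bounds, and
  this space is standard Borel, i.e. isomorphic to a Borel subset of the reals.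
\<close>

definition curie_weiss_type ::
    "'t itself \<Rightarrow> (nat \<Rightarrow> 'a measure) \<Rightarrow> (nat \<Rightarrow> 'a \<Rightarrow> real mat) \<Rightarrow> bool" where
  "curie_weiss_type TYPE('t) M H \<longleftrightarrow>
     (\<exists>(X :: nat \<Rightarrow> nat \<times> nat \<Rightarrow> 'a \<Rightarrow> real) (T :: nat \<Rightarrow> 't measure) (P :: nat \<Rightarrow> 't \<Rightarrow> real measure).
        (\<forall>N\<ge>1.
           (\<forall>\<omega>\<in>space (M N). H N \<omega> \<in> carrier_mat N N \<and> transpose_mat (H N \<omega>) = H N \<omega> \<and>
              (\<forall>i j. i \<le> j \<longrightarrow> j < N \<longrightarrow> H N \<omega> $$ (i, j) = 1 / sqrt (real N) * X N (i, j) \<omega>)) \<and>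
           de_finetti_type {(i, j). i \<le> j \<and> j < N} (M N) (X N) (T N) (P N)) \<and>
        (\<forall>p>0. even p \<longrightarrow> (\<exists>K\<ge>0. \<forall>N\<ge>1.
           (\<integral>\<^sup>+t. ennreal (\<bar>mixing_moment (P N) 1 t\<bar> ^ p) \<partial>(T N))
             \<le> ennreal (K * real N powr (- (real p / 2))) \<and>
           (\<integral>\<^sup>+t. ennreal (\<bar>1 - mixing_moment (P N) 2 t\<bar> ^ p) \<partial>(T N))
             \<le> ennreal (K * real N powr (- (real p / 2))) \<and>
           (SUP t\<in>space (T N). \<integral>\<^sup>+y. ennreal (\<bar>y - mixing_moment (P N) 1 t\<bar> ^ p) \<partial>(P N t))
             \<le> ennreal K \<and>
           (SUP t\<in>space (T N). \<integral>\<^sup>+y. ennreal (\<bar>y\<^sup>2 - mixing_moment (P N) 2 t\<bar> ^ p) \<partial>(P N t))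
             \<le> ennreal K)))"

definition stoch_dominated ::
    "(nat \<Rightarrow> 'a measure) \<Rightarrow> (nat \<Rightarrow> 'u set) \<Rightarrow> (nat \<Rightarrow> 'u \<Rightarrow> 'a \<Rightarrow> complex) \<Rightarrow>
     (nat \<Rightarrow> 'u \<Rightarrow> 'a \<Rightarrow> real) \<Rightarrow> bool" where
  "stoch_dominated M U X Y \<longleftrightarrow>
     (\<forall>N\<ge>1. \<forall>u\<in>U N. X N u \<in> borel_measurable (M N) \<and> Y N u \<in> borel_measurable (M N) \<and>
        (\<forall>\<omega>\<in>space (M N). 0 \<le> Y N u \<omega>)) \<and>
     (\<forall>\<epsilon>>0. \<forall>D>0. \<exists>C\<ge>0. \<forall>N\<ge>1.
        (SUP u\<in>U N. emeasure (M N) {\<omega> \<in> space (M N). cmod (X N u \<omega>) > real N powr \<epsilon> * Y N u \<omega>})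
          \<le> ennreal (C * real N powr (- D)))"

definition semicircle :: "real measure" where
  "semicircle = density lborel (\<lambda>x. ennreal (1 / (2 * pi) * sqrt (max 0 (4 - x\<^sup>2))))"

definition stieltjes :: "real measure \<Rightarrow> complex \<Rightarrow> complex" where
  "stieltjes \<nu> z = (\<integral>x. 1 / (complex_of_real x - z) \<partial>\<nu>)"

text \<open>
  For symmetric \<open>A\<close> and \<open>Im z > 0\<close>, \<open>A - z\<close> is invertible, so \<^const>\<open>mat_inverse\<close> is not \<open>None\<close>.
\<close>

definition resolvent :: "real mat \<Rightarrow> complex \<Rightarrow> complex mat" where
  "resolvent A z = the (mat_inverse (map_mat complex_of_real A - z \<cdot>\<^sub>m 1\<^sub>m (dim_row A)))"

definition resolvent_trace :: "real mat \<Rightarrow> complex \<Rightarrow> complex" where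
  "resolvent_trace A z = (\<Sum>i<dim_row A. resolvent A z $$ (i, i)) / of_nat (dim_row A)"

definition resolvent_error :: "real mat \<Rightarrow> complex \<Rightarrow> real" where
  "resolvent_error A z =
     (MAX (i, j) \<in> {..<dim_row A} \<times> {..<dim_row A}.
        cmod (resolvent A z $$ (i, j) - (if i = j then stieltjes semicircle z else 0)))"

definition local_law_error :: "real mat \<Rightarrow> complex \<Rightarrow> real" where
  "local_law_error A z =
     max (resolvent_error A z) (cmod (resolvent_trace A z - stieltjes semicircle z))"

definition spectral_domain :: "real \<Rightarrow> real \<Rightarrow> nat \<Rightarrow> complex set" where
  "spectral_domain b \<tau> N =
     {z. Re z \<in> {- b .. b} \<and> Im z \<in> {1 / real N powr (1 - \<tau>) .. 1 / \<tau>}}"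

end

theory Submission
  imports Defs "Jordan_Normal_Form.Determinant"
begin

text \<open>
  Curie-Weiss spins are independent once a real field is fixed. For a standard Gaussian
  \<open>g\<close> one has \<open>exp (s\<^sup>2 / 2) = E exp (s g)\<close>, so the weight \<open>exp (\<beta> S\<^sup>2 / (2 n))\<close> of a
  configuration with sum \<open>S\<close> is a Gaussian average of product weights. After normalisation the
  spins are independent with mean \<open>u = tanh (sqrt (\<beta> / n) t)\<close>, where \<open>t\<close> has a density
  proportional to \<open>w t = exp (- t\<^sup>2 / 2) * cosh (sqrt (\<beta> / n) t) ^ n\<close>
  (\<open>curie_weiss_mixture\<close>). For \<open>\<beta> \<le> 1\<close> one has \<open>w \<le> exp (- n u\<^sup>4 / 12)\<close>, and the mass of \<open>sqrt w\<close>
  is at most twice that of \<open>w\<close>; together these bound all moments of \<open>n powr (1/4) * u\<close>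
  (\<open>tilt_moment\<close>). With \<open>n = N\<^sup>2\<close> spins, \<open>u\<close> is of order \<open>N powr (- 1/2)\<close>, which is the
  moment condition in the definition of Curie-Weiss type.

  For the local law fix \<open>u\<close> with \<open>\<bar>u\<bar> * sqrt N \<le> \<phi>\<close>, where \<open>\<phi>\<close> is a small power of \<open>N\<close>. Write
  \<open>G\<close> for the resolvent, \<open>s\<close> for its normalised trace, \<open>m\<close> for the Stieltjes transform of the
  semicircle law and \<open>\<Psi> = 1 / sqrt (N \<eta>)\<close>. Isolating the \<open>i\<close>-th row and column gives
  \<open>1 / G i i = - z - s + e\<close>. The error \<open>e\<close> contains a quadratic form in the signs of row \<open>i\<close> whose
  coefficients do not depend on that row. An exponential supermartingale
  (\<open>exponential_supermartingale\<close>) bounds it by the Frobenius norm of the coefficients, with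
  overwhelming probability. The bias is harmless: for \<open>N\<close> signs of mean \<open>u\<close> it shifts a linear form
  with coefficient vector \<open>b\<close> by at most \<open>\<bar>u\<bar> * sqrt N * \<parallel>b\<parallel> \<le> \<phi> * \<parallel>b\<parallel>\<close>. The Ward identity expresses the
  Frobenius norm through \<open>Im s\<close>, and so \<open>e = O(\<phi>\<^sup>2 \<Psi>)\<close>. This identity, like every other resolvent
  bound below, follows from the fact that the quadratic form of a symmetric matrix is real
  (\<open>Im_energy\<close>).

  Averaging over \<open>i\<close> shows that \<open>(s - m) * (s - 1 / m)\<close> is of order \<open>\<phi>\<^sup>2 \<Psi>\<close>, because \<open>m\<close> and \<open>1 / m\<close> are the
  two solutions of \<open>x\<^sup>2 + z x + 1 = 0\<close>. Hence \<open>s\<close> is close to one of them. If their distance is at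
  most a multiple of the square root of the error, it does not matter which (\<open>quadratic_stability\<close>).
  Otherwise the right one is found by descending along a vertical line on a grid of mesh
  \<open>N powr (- 3)\<close>, starting where \<open>\<eta> \<ge> 16\<close> (\<open>bootstrap\<close>). The gap decreases and the error increases on
  the way down, so the regime in which the roots are well separated is never entered again once left.

  The exceptional events add up to a probability of order \<open>N^5 * exp (- 2 * \<phi>)\<close>, and averaging over \<open>u\<close> adds
  the probability that \<open>\<bar>u\<bar> * sqrt N > \<phi>\<close>, which the moment bound makes smaller than any power of
  \<open>N\<close> (\<open>annealed_local_law\<close>, \<open>local_law_tail\<close>).
\<close>

section \<open>The Stieltjes transform of the semicircle law\<close>

text \<open>The two roots have product \<open>1\<close> and sum \<open>- z\<close>. If both were on the unit circle, they would be
  complex conjugates, and \<open>z\<close> would be real.\<close>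

lemma semicircle_root_exists:
  assumes "Im z > 0"
  shows "\<exists>m. m\<^sup>2 + z * m + 1 = 0 \<and> cmod m < 1"
proof -
  define r where "r = (- z + csqrt (z\<^sup>2 - 4)) / 2"
  define q where "q = (- z - csqrt (z\<^sup>2 - 4)) / 2"
  have rq: "r * q = 1"
  proof -
    have "r * q = (z\<^sup>2 - (csqrt (z\<^sup>2 - 4))\<^sup>2) / 4"
      by (simp add: r_def q_def field_simps power2_eq_square)
    then show ?thesis by simp
  qed
  have sum: "r + q = - z" by (simp add: r_def q_def field_simps)
  have z: "z = - r - q" using sum by (metis add.commute add_diff_cancel_left' add_uminus_conv_diff minus_add_distrib minus_minus)
  have eqr: "r\<^sup>2 + z * r + 1 = 0" and eqq: "q\<^sup>2 + z * q + 1 = 0"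
    unfolding z power2_eq_square using rq by (simp_all add: algebra_simps)
  have n: "cmod r * cmod q = 1" using rq by (metis norm_mult norm_one)
  have "cmod r \<noteq> 1"
  proof
    assume "cmod r = 1"
    then have "r * cnj r = 1" by (simp add: complex_norm_square [symmetric])
    then have "q = cnj r" using rq by (metis mult_cancel_left mult_eq_0_iff zero_neq_one)
    then have "Im z = 0" using z by simp
    then show False using assms by simp
  qed
  then have "cmod r < 1 \<or> cmod q < 1"
    using n mult_mono[of 1 "cmod r" 1 "cmod q"] mult_less_cancel_left_pos[of "cmod r" 1 "cmod q"]
    by (smt (verit) mult_le_cancel_left1 mult_less_cancel_left2)
  then show ?thesis using eqr eqq by blast
qed

text \<open>With \<open>x = 2 * cos \<theta>\<close> and \<open>z = - (m + 1 / m)\<close>, the integrand becomes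
  \<open>4 * (sin \<theta>)\<^sup>2 / (2 * cos \<theta> - z)\<close>. Its denominator factors as
  \<open>(1 + m * e) * (1 + m / e) / m\<close> with \<open>e = exp (\<i> * \<theta>)\<close>, and \<open>\<bar>m\<bar> < 1\<close> keeps both factors in the
  right half plane. Partial fractions therefore give the explicit antiderivative \<open>A\<close> below,
  in terms of the principal logarithm.\<close>

lemma semicircle_integral:
  assumes m: "m\<^sup>2 + z * m + 1 = 0" and lt: "cmod m < 1" and im: "Im z > 0"
  shows "((\<lambda>x. complex_of_real (sqrt (4 - x\<^sup>2)) / (complex_of_real x - z)) has_integral 2 * of_real pi * m) {-2..2}"
proof -
  define c where "c = (4 - z\<^sup>2) * (m / (1 - m\<^sup>2))"
  define A where "A = (\<lambda>w. c * (w + \<i> * Ln (1 + m * exp (\<i> * w)) - \<i> * Ln (1 + m * exp (- \<i> * w))) - z * w - 2 * sin w)"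
  have m0: "m \<noteq> 0" using m by auto
  have m2: "1 - m\<^sup>2 \<noteq> 0"
  proof
    assume "1 - m\<^sup>2 = 0"
    then have "cmod (m\<^sup>2) = 1" by simp
    then have "cmod m ^ 2 = 1" by (simp add: norm_power)
    then have "cmod m = 1" by (metis abs_norm_cancel norm_power power_one abs_1 power2_eq_iff_nonneg norm_ge_zero zero_le_one)
    then show False using lt by simp
  qed
  have npos: "1 + m * e \<notin> \<real>\<^sub>\<le>\<^sub>0" "1 + m * e \<noteq> 0" if "cmod e = 1" for e
  proof -
    have "\<bar>Re (m * e)\<bar> \<le> cmod m" using abs_Re_le_cmod[of "m * e"] that by (simp add: norm_mult)
    then have "Re (1 + m * e) > 0" using lt by (simp del: times_complex.sel)
    then show "1 + m * e \<notin> \<real>\<^sub>\<le>\<^sub>0" "1 + m * e \<noteq> 0" by (force simp: complex_nonpos_Reals_iff complex_eq_iff)+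
  qed
  have dA: "(A has_field_derivative (4 * (sin (of_real t))\<^sup>2 / (2 * cos (of_real t) - z))) (at (of_real t))" for t :: real
  proof -
    define w where "w = complex_of_real t"
    define e where "e = exp (\<i> * w)"
    define e' where "e' = exp (- \<i> * w)"
    have ne: "cmod e = 1" "cmod e' = 1" by (simp_all add: e_def e'_def w_def)
    have ee: "e * e' = 1" by (simp add: e_def e'_def exp_minus)
    have cosw: "2 * cos w = e + e'" by (simp add: cos_exp_eq e_def e'_def)
    have prod: "(1 + m * e) * (1 + m * e') = m * (2 * cos w - z)"
    proof -
      have "(1 + m * e) * (1 + m * e') = 1 + m\<^sup>2 * (e * e') + m * (e + e')"
        by (simp add: power2_eq_square algebra_simps)
      also have "\<dots> = (m\<^sup>2 + z * m + 1) - z * m + m * (2 * cos w)" by (simp add: ee cosw)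
      finally show ?thesis using m by (simp add: algebra_simps)
    qed
    have den: "2 * cos w - z \<noteq> 0" using prod npos(2)[OF ne(1)] npos(2)[OF ne(2)] by auto
    have fr: "1 - m * e / (1 + m * e) - m * e' / (1 + m * e') = (1 - m\<^sup>2) / (m * (2 * cos w - z))"
    proof -
      have "1 - m * e / (1 + m * e) - m * e' / (1 + m * e') = (1 - m\<^sup>2 * (e * e')) / ((1 + m * e) * (1 + m * e'))"
        using npos(2)[OF ne(1)] npos(2)[OF ne(2)] by (simp add: field_simps power2_eq_square)
      then show ?thesis by (simp add: ee prod)
    qed
    have l1: "((\<lambda>w. Ln (1 + m * exp (\<i> * w))) has_field_derivative inverse (1 + m * e) * (m * (e * \<i>))) (at w)"
      unfolding e_def
      by (rule DERIV_chain2[OF has_field_derivative_Ln]) (use npos(1)[OF ne(1)] in \<open>auto simp: e_def intro!: derivative_eq_intros\<close>)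
    have l2: "((\<lambda>w. Ln (1 + m * exp (- \<i> * w))) has_field_derivative inverse (1 + m * e') * (m * (e' * (- \<i>)))) (at w)"
      unfolding e'_def
      by (rule DERIV_chain2[OF has_field_derivative_Ln]) (use npos(1)[OF ne(2)] in \<open>auto simp: e'_def intro!: derivative_eq_intros\<close>)
    have d1: "(A has_field_derivative (c * (1 + \<i> * (m * (e * \<i>) / (1 + m * e)) - \<i> * (m * (e' * (- \<i>)) / (1 + m * e'))) - z - 2 * cos w)) (at w)"
      unfolding A_def
      by (rule derivative_eq_intros l1 l2 refl)+ (simp add: divide_inverse mult_ac)
    have "c * (1 + \<i> * (m * (e * \<i>) / (1 + m * e)) - \<i> * (m * (e' * (- \<i>)) / (1 + m * e')))
        = c * (1 - m * e / (1 + m * e) - m * e' / (1 + m * e'))"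
      by (simp add: algebra_simps) 
    also have "\<dots> = (4 - z\<^sup>2) / (2 * cos w - z)"
      unfolding fr c_def using m0 m2 den by (simp add: divide_simps)
    finally have "c * (1 + \<i> * (m * (e * \<i>) / (1 + m * e)) - \<i> * (m * (e' * (- \<i>)) / (1 + m * e'))) - z - 2 * cos w
        = (4 - z\<^sup>2) / (2 * cos w - z) - z - 2 * cos w" by simp
    also have "\<dots> = ((4 - z\<^sup>2) - (z + 2 * cos w) * (2 * cos w - z)) / (2 * cos w - z)"
      using den by (simp add: field_simps)
    also have "(4 - z\<^sup>2) - (z + 2 * cos w) * (2 * cos w - z) = 4 * (1 - (cos w)\<^sup>2)"
      by (simp add: power2_eq_square algebra_simps)
    also have "1 - (cos w)\<^sup>2 = (sin w)\<^sup>2" by (simp add: sin_squared_eq)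
    finally show ?thesis using d1 by (simp add: w_def)
  qed
  define B where "B = (\<lambda>t::real. A (of_real t))"
  have dB: "(B has_vector_derivative (4 * (sin (of_real t))\<^sup>2 / (2 * cos (of_real t) - z))) (at t)" for t
    unfolding B_def by (rule has_vector_derivative_real_field[OF dA])
  have contB: "continuous_on UNIV B"
    by (meson dB has_vector_derivative_continuous continuous_at_imp_continuous_on)
  have "((\<lambda>x. complex_of_real (sqrt (4 - x\<^sup>2)) / (complex_of_real x - z)) has_integral
      (- B (arccos (2/2))) - (- B (arccos ((-2)/2)))) {-2..2}"
  proof (rule fundamental_theorem_of_calculus_interior)
    show "(-2::real) \<le> 2" by simp
    show "continuous_on {-2..2} (\<lambda>x::real. - B (arccos (x/2)))"
      by (intro continuous_intros continuous_on_compose2[OF contB]) auto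
    fix x :: real assume x: "x \<in> {-2<..<2}"
    define s where "s = sqrt (1 - (x/2)\<^sup>2)"
    have x1: "(x/2)\<^sup>2 < 1" using x by (simp add: abs_square_less_1 abs_less_iff; linarith)
    have s0: "s > 0" using x1 by (simp add: s_def)
    have s4: "sqrt (4 - x\<^sup>2) = 2 * s"
    proof -
      have "4 - x\<^sup>2 = 4 * (1 - (x/2)\<^sup>2)" by (simp add: power2_eq_square)
      then have "sqrt (4 - x\<^sup>2) = sqrt 4 * sqrt (1 - (x/2)\<^sup>2)" by (metis real_sqrt_mult)
      then show ?thesis by (simp only: s_def real_sqrt_four)
    qed
    have da: "((\<lambda>x. arccos (x/2)) has_real_derivative (inverse (- s) * (1/2))) (at x)"
      unfolding s_def using x by (auto intro!: derivative_eq_intros)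
    have dav: "((\<lambda>x. arccos (x/2)) has_vector_derivative (inverse (- s) * (1/2))) (at x)"
      using da by (simp add: has_real_derivative_iff_has_vector_derivative)
    have cs: "cos (arccos (x/2)) = x/2" "sin (arccos (x/2)) = s"
      using x by (simp_all add: sin_arccos s_def)
    have "((B \<circ> (\<lambda>x. arccos (x/2))) has_vector_derivative (inverse (- s) * (1/2)) *\<^sub>R (4 * (sin (of_real (arccos (x/2))))\<^sup>2 / (2 * cos (of_real (arccos (x/2))) - z))) (at x)"
      by (rule vector_diff_chain_at[OF dav dB])
    then have "((\<lambda>x. - (B \<circ> (\<lambda>x. arccos (x/2))) x) has_vector_derivative - ((inverse (- s) * (1/2)) *\<^sub>R (4 * (sin (of_real (arccos (x/2))))\<^sup>2 / (2 * cos (of_real (arccos (x/2))) - z)))) (at x)"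
      by (rule has_vector_derivative_minus)
    moreover have "- ((inverse (- s) * (1/2)) *\<^sub>R (4 * (sin (complex_of_real (arccos (x/2))))\<^sup>2 / (2 * cos (of_real (arccos (x/2))) - z)))
       = complex_of_real (sqrt (4 - x\<^sup>2)) / (complex_of_real x - z)"
      unfolding sin_of_real cos_of_real cs s4 using s0
      by (simp add: scaleR_conv_of_real power2_eq_square field_simps)
    ultimately show "((\<lambda>x. - B (arccos (x/2))) has_vector_derivative complex_of_real (sqrt (4 - x\<^sup>2)) / (complex_of_real x - z)) (at x)"
      by (simp add: comp_def)
  qed
  moreover have "B 0 = 0" by (simp add: B_def A_def)
  moreover have "B pi = 2 * of_real pi * m"
  proof -
    have e: "exp (\<i> * of_real pi) = -1" "exp (- (\<i> * of_real pi)) = -1" by (simp_all add: exp_minus)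
    have "B pi = of_real pi * (c - z)"
      by (simp add: B_def A_def e sin_of_real algebra_simps)
    moreover have "c - z = 2 * m"
    proof -
      have z: "z = - (1 + m\<^sup>2) / m" using m m0 by (simp add: field_simps) (metis add.commute add.left_commute eq_neg_iff_add_eq_0)
      have "4 - z\<^sup>2 = - (1 - m\<^sup>2)\<^sup>2 / m\<^sup>2"
        unfolding z using m0 by (simp add: field_simps power2_eq_square)
      then have "c = - (1 - m\<^sup>2) / m" unfolding c_def using m0 m2
        by (simp add: field_simps power2_eq_square)
      then show ?thesis unfolding z using m0 by (simp add: field_simps power2_eq_square)
    qed
    ultimately show ?thesis by simp
  qed
  ultimately show ?thesis by simp
qed

lemma stieltjes_semicircle:
  assumes m: "m\<^sup>2 + z * m + 1 = 0" and lt: "cmod m < 1" and im: "Im z > 0"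
  shows "stieltjes semicircle z = m"
proof -
  let ?f = "\<lambda>x. complex_of_real (sqrt (4 - x\<^sup>2)) / (complex_of_real x - z)"
  have nz: "complex_of_real x - z \<noteq> 0" for x
    using im by (metis Im_complex_of_real eq_iff_diff_eq_0 less_irrefl)
  have [measurable]: "(\<lambda>x. 1 / (complex_of_real x - z)) \<in> borel_measurable lborel"
    by (simp add: borel_measurable_continuous_onI continuous_intros nz)
  have cont: "continuous_on {-2..2} ?f"
    by (intro continuous_intros) (use nz in auto)
  have int: "set_integrable lborel {-2..2} ?f"
    by (rule borel_integrable_compact[OF _ cont, unfolded set_integrable_def[symmetric]]) auto
  have "stieltjes semicircle z = (\<integral>x. (1 / (2 * pi) * sqrt (max 0 (4 - x\<^sup>2))) *\<^sub>R (1 / (complex_of_real x - z)) \<partial>lborel)"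
    unfolding stieltjes_def semicircle_def by (subst integral_density) auto
  also have "\<dots> = (\<integral>x. (1 / (2 * pi)) *\<^sub>R (indicator {-2..2} x *\<^sub>R ?f x) \<partial>lborel)"
  proof (intro Bochner_Integration.integral_cong refl)
    fix x :: real
    show "(1 / (2 * pi) * sqrt (max 0 (4 - x\<^sup>2))) *\<^sub>R (1 / (complex_of_real x - z)) = (1 / (2 * pi)) *\<^sub>R (indicator {-2..2} x *\<^sub>R ?f x)"
    proof (cases "x \<in> {-2..2}")
      case True
      then have "x\<^sup>2 \<le> 4" using abs_le_square_iff[of x 2] by auto
      then show ?thesis using True by (simp add: max_absorb2 scaleR_conv_of_real)
    next
      case False
      then have "x\<^sup>2 \<ge> 4" using abs_le_square_iff[of 2 x] by auto
      then show ?thesis using False by (simp add: max_absorb1)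
    qed
  qed
  also have "\<dots> = (1 / (2 * pi)) *\<^sub>R (LINT x:{-2..2}|lborel. ?f x)"
    by (simp only: set_lebesgue_integral_def integral_scaleR_right)
  also have "(LINT x:{-2..2}|lborel. ?f x) = integral {-2..2} ?f"
    by (rule set_borel_integral_eq_integral(2)[OF int])
  also have "\<dots> = 2 * of_real pi * m"
    by (rule integral_unique[OF semicircle_integral[OF m lt im]])
  finally show ?thesis by (simp add: scaleR_conv_of_real)
qed

text \<open>All of this is algebra from the quadratic equation and \<open>\<bar>m\<bar> < 1\<close>: writing
  \<open>- z = m + cnj m / \<bar>m\<bar>\<^sup>2\<close> and taking imaginary parts gives
  \<open>Im z * \<bar>m\<bar>\<^sup>2 = Im m * (1 - \<bar>m\<bar>\<^sup>2)\<close>.\<close>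

lemma semicircle_transform:
  assumes "Im z > 0"
  defines "m \<equiv> stieltjes semicircle z"
  shows "m * (- z - m) = 1" "cmod m < 1" "Im m > 0" "cmod m \<le> 1 / Im z" "1 - (cmod m)\<^sup>2 \<ge> Im z * cmod m" "m \<noteq> 0"
proof -
  obtain r where r: "r\<^sup>2 + z * r + 1 = 0" "cmod r < 1" using semicircle_root_exists[OF assms(1)] by blast
  have mr: "m = r" unfolding m_def by (rule stieltjes_semicircle[OF r assms(1)])
  have root: "m\<^sup>2 + z * m + 1 = 0" using r mr by simp
  show lt: "cmod m < 1" using r mr by simp
  have "m * (- z - m) = 1 - (m\<^sup>2 + z * m + 1)" by (simp add: power2_eq_square algebra_simps)
  then show eq: "m * (- z - m) = 1" using root by simp
  show m0: "m \<noteq> 0" using eq by auto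
  have zz: "- z - m = cnj m / of_real ((cmod m)\<^sup>2)"
    using eq m0 complex_norm_square[of m] by (simp add: field_simps)
  have "Im (- z - m) = - Im m / (cmod m)\<^sup>2" unfolding zz by (simp only: Im_divide_of_real cnj.simps(2))
  then have im: "Im z * (cmod m)\<^sup>2 = Im m * (1 - (cmod m)\<^sup>2)" using m0 by (simp add: field_simps)
  have sq: "(cmod m)\<^sup>2 < 1" using lt by (simp add: power_less_one_iff abs_square_less_1)
  have "Im z * (cmod m)\<^sup>2 > 0" using assms(1) m0 by simp
  then show pos: "Im m > 0" using sq unfolding im by (simp add: zero_less_mult_iff)
  have "Im z * (cmod m)\<^sup>2 \<le> cmod m * (1 - (cmod m)\<^sup>2)"
    unfolding im using sq abs_Im_le_cmod[of m] by (intro mult_right_mono) auto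
  then have "cmod m * (Im z * cmod m) \<le> cmod m * (1 - (cmod m)\<^sup>2)" by (simp add: power2_eq_square mult_ac)
  then show "1 - (cmod m)\<^sup>2 \<ge> Im z * cmod m" using m0 by simp
  have "Im z \<le> cmod (- z - m)" using abs_Im_le_cmod[of "- z - m"] pos assms(1) by simp
  then have "cmod m * Im z \<le> cmod m * cmod (- z - m)" by (simp add: mult_left_mono)
  also have "\<dots> = 1" using eq by (metis norm_mult norm_one)
  finally show "cmod m \<le> 1 / Im z" using assms(1) by (simp add: field_simps)
qed

text \<open>Subtracting the quadratic equations gives \<open>(m - n) * (1 - m * n) = m * n * (z - w)\<close>, and the
  lower bound on \<open>1 - \<bar>m\<bar>\<^sup>2\<close> controls \<open>1 - m * n\<close> from below even near the edges \<open>\<plusminus>2\<close>.\<close>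

lemma semicircle_Lipschitz:
  assumes "e > 0" "Im z \<ge> e" "Im w \<ge> e"
  shows "cmod (stieltjes semicircle z - stieltjes semicircle w) \<le> cmod (z - w) / e"
proof -
  define m where "m = stieltjes semicircle z"
  define n where "n = stieltjes semicircle w"
  have z: "Im z > 0" "Im w > 0" using assms by auto
  note M = semicircle_transform[OF z(1), folded m_def] and W = semicircle_transform[OF z(2), folded n_def]
  have "(m - n) * (1 - m * n) = m * n * (z - w) + m * (n * (- w - n)) * (-1) + m + n * (m * (- z - m)) - n"
    by (simp add: algebra_simps)
  then have eq: "(m - n) * (1 - m * n) = m * n * (z - w)" using M(1) W(1) by simp
  have ab: "cmod m * cmod n \<le> (cmod m + cmod n) / 2"
  proof -
    have "cmod m * cmod n \<le> cmod m" "cmod m * cmod n \<le> cmod n"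
      using M(2) W(2) by (simp_all add: mult_left_le mult_left_le_one_le)
    then show ?thesis by simp
  qed
  have "e * (cmod m * cmod n) \<le> e * ((cmod m + cmod n) / 2)" using ab assms(1) by simp
  also have "\<dots> \<le> (Im z * cmod m + Im w * cmod n) / 2"
    using mult_right_mono[OF assms(2), of "cmod m"] mult_right_mono[OF assms(3), of "cmod n"] by (simp add: algebra_simps)
  also have "\<dots> \<le> 1 - ((cmod m)\<^sup>2 + (cmod n)\<^sup>2) / 2" 
  proof -
    have "(x + y) / 2 \<le> 1 - (a + b) / 2" if "1 - a \<ge> x" "1 - b \<ge> y" for x y a b :: real
      using that by argo
    then show ?thesis using M(5) W(5) .
  qed
  also have "\<dots> \<le> 1 - cmod m * cmod n" using sum_squares_bound[of "cmod m" "cmod n"] by simp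
  also have "\<dots> \<le> cmod (1 - m * n)" using norm_triangle_ineq2[of 1 "m * n"] by (simp add: norm_mult)
  finally have low: "e * (cmod m * cmod n) \<le> cmod (1 - m * n)" .
  have "cmod (m - n) * (e * (cmod m * cmod n)) \<le> cmod (m - n) * cmod (1 - m * n)"
    by (intro mult_left_mono low) auto
  also have "\<dots> = (cmod m * cmod n) * cmod (z - w)" using eq by (metis norm_mult)
  finally have "(cmod m * cmod n) * (cmod (m - n) * e) \<le> (cmod m * cmod n) * cmod (z - w)" by (simp add: mult_ac)
  moreover have "cmod m * cmod n > 0" using M(6) W(6) by simp
  ultimately have "cmod (m - n) * e \<le> cmod (z - w)" by (metis mult_le_cancel_left_pos)
  then show ?thesis unfolding m_def n_def using assms(1) by (simp add: pos_le_divide_eq)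
qed

text \<open>The quantity \<open>\<kappa> + \<eta>\<close> of the local law.\<close>

abbreviation edge_dist :: "complex \<Rightarrow> real" where
  "edge_dist z \<equiv> \<bar>\<bar>Re z\<bar> - 2\<bar> + Im z"

text \<open>The distance of the two solutions of \<open>x\<^sup>2 + z * x + 1 = 0\<close>; the discriminant makes its
  monotonicity in \<open>Im z\<close> visible.\<close>

definition root_gap :: "complex \<Rightarrow> real" where
  "root_gap z = sqrt (cmod (z\<^sup>2 - 4))"

lemma root_gap_eq:
  assumes "Im z > 0"
  defines "m \<equiv> stieltjes semicircle z"
  shows "cmod (m - 1 / m) = root_gap z"
proof -
  have m0: "m \<noteq> 0" and eq: "m * (- z - m) = 1" using semicircle_transform[OF assms(1)] unfolding m_def by auto
  have "1 / m = - z - m" using m0 eq by (simp add: field_simps)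
  then have z: "z = - (m + 1 / m)" by simp
  have "z\<^sup>2 - 4 = (m - 1 / m)\<^sup>2" unfolding z using m0 by (simp add: field_simps power2_eq_square)
  then show ?thesis unfolding root_gap_def by (simp add: norm_power)
qed

text \<open>In \<open>z\<^sup>2 - 4 = (z - 2) * (z + 2)\<close> the factor of the nearer edge has modulus at least \<open>(\<kappa> + \<eta>) / 2\<close> and
  the other one at least \<open>2\<close>.\<close>

lemma root_gap_ge:
  assumes "Im z > 0"
  shows "edge_dist z \<le> (root_gap z)\<^sup>2"
proof -
  have *: "\<bar>a - 2\<bar> + b \<le> cmod (Complex a b - 2) * cmod (Complex a b + 2)" if "a \<ge> 0" "b \<ge> 0" for a b
  proof -
    have 1: "\<bar>a - 2\<bar> \<le> cmod (Complex a b - 2)" using abs_Re_le_cmod[of "Complex a b - 2"] by simp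
    have 2: "b \<le> cmod (Complex a b - 2)" using abs_Im_le_cmod[of "Complex a b - 2"] that by simp
    have 3: "2 \<le> cmod (Complex a b + 2)" using abs_Re_le_cmod[of "Complex a b + 2"] that by simp
    have "\<bar>a - 2\<bar> + b \<le> cmod (Complex a b - 2) * 2" using 1 2 by simp
    also have "\<dots> \<le> cmod (Complex a b - 2) * cmod (Complex a b + 2)" using 3 by (intro mult_left_mono) auto
    finally show ?thesis .
  qed
  have "(root_gap z)\<^sup>2 = cmod (z\<^sup>2 - 4)" unfolding root_gap_def by simp
  also have "z\<^sup>2 - 4 = (z - 2) * (z + 2)" by (simp add: power2_eq_square algebra_simps)
  finally have rg: "(root_gap z)\<^sup>2 = cmod (z - 2) * cmod (z + 2)" by (simp add: norm_mult)
  show ?thesis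
  proof (cases "Re z \<ge> 0")
    case True
    then show ?thesis using *[of "Re z" "Im z"] assms rg by simp
  next
    case False
    have c: "cmod (Complex (- Re z) (Im z) - 2) = cmod (z + 2)" "cmod (Complex (- Re z) (Im z) + 2) = cmod (z - 2)"
      by (simp_all add: cmod_def power2_eq_square algebra_simps)
    show ?thesis using *[of "- Re z" "Im z"] False assms rg unfolding c by (simp add: mult.commute)
  qed
qed

lemma root_gap_mono:
  assumes "Re z = Re w" "0 \<le> Im z" "Im z \<le> Im w"
  shows "root_gap z \<le> root_gap w"
proof -
  have f: "u\<^sup>2 - 4 = (u - 2) * (u + 2)" for u :: complex by (simp add: power2_eq_square algebra_simps)
  have "cmod (z - c) \<le> cmod (w - c)" if "Im c = 0" for c
    unfolding cmod_def using assms that by (intro real_sqrt_le_mono add_mono) (auto intro: power_mono)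
  from this[of 2] this[of "-2"] have "cmod (z - 2) * cmod (z + 2) \<le> cmod (w - 2) * cmod (w + 2)"
    by (intro mult_mono) auto
  then show ?thesis unfolding root_gap_def f norm_mult by simp
qed

text \<open>An approximate root \<open>s\<close> of a quadratic polynomial with roots \<open>m\<close> and \<open>n\<close> at distance \<open>d\<close> is within
  \<open>sqrt r\<close> of one of them. If \<open>d\<close> is at most a multiple of \<open>sqrt r\<close>, it is then also near \<open>m\<close>. If \<open>d\<close>
  is larger, the a priori bound excludes \<open>n\<close>, and dividing by \<open>\<bar>s - n\<bar> \<ge> d / 2\<close> improves it
  to \<open>2 * r / d\<close>.\<close>

lemma quadratic_stability:
  fixes s m :: complex and r d :: real
  assumes "r > 0" "cmod ((s - m) * (s - n)) \<le> r" "d = cmod (m - n)"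
    and apriori: "d\<^sup>2 > 16 * r \<Longrightarrow> cmod (s - m) \<le> d / 2"
  shows "cmod (s - m) \<le> 5 * sqrt r" "d\<^sup>2 > 16 * r \<Longrightarrow> cmod (s - m) \<le> 2 * r / d"
proof -
  have prod: "cmod (s - m) * cmod (s - n) \<le> r" using assms(2) by (simp add: norm_mult)
  have d0: "d \<ge> 0" using assms(3) by simp
  have tri: "d \<le> cmod (s - m) + cmod (s - n)"
    unfolding assms(3) using norm_triangle_ineq4[of "s - n" "s - m"] by simp
  have tri2: "cmod (s - m) \<le> cmod (s - n) + d"
    unfolding assms(3) using norm_triangle_ineq[of "s - n" "n - m"] by (simp add: norm_minus_commute)
  show big: "cmod (s - m) \<le> 2 * r / d" if "d\<^sup>2 > 16 * r"
  proof -
    have d: "d > 0" using that assms(1) d0 by (cases "d = 0") auto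
    have "d / 2 \<le> cmod (s - n)" using apriori[OF that] tri by simp
    then have "cmod (s - m) * (d / 2) \<le> cmod (s - m) * cmod (s - n)" by (intro mult_left_mono) auto
    then show ?thesis using prod d by (simp add: field_simps)
  qed
  show "cmod (s - m) \<le> 5 * sqrt r"
  proof (cases "d\<^sup>2 > 16 * r")
    case True
    have d: "d > 0" using True assms(1) d0 by (cases "d = 0") auto
    have "sqrt (16 * r) \<le> d" using True d0 by (simp add: real_le_lsqrt less_imp_le)
    then have d4: "4 * sqrt r \<le> d" by (simp add: real_sqrt_mult)
    have "2 * r = 2 * sqrt r * sqrt r" using assms(1) by simp
    also have "\<dots> \<le> 5 * sqrt r * d" using d4 assms(1) d0 by (intro mult_mono) auto
    finally have "2 * r / d \<le> 5 * sqrt r" using d by (simp add: pos_divide_le_eq)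
    then show ?thesis using big[OF True] by simp
  next
    case False
    have "d \<le> sqrt (16 * r)" using False by (simp add: real_le_rsqrt)
    then have d4: "d \<le> 4 * sqrt r" by (simp add: real_sqrt_mult)
    show ?thesis
    proof (rule ccontr)
      assume "\<not> ?thesis"
      then have u: "cmod (s - m) > 5 * sqrt r" by simp
      then have v: "cmod (s - n) > sqrt r" using tri2 d4 by simp
      have "r = sqrt r * sqrt r" using assms(1) by simp
      also have "\<dots> < cmod (s - m) * cmod (s - n)"
        using u v real_sqrt_gt_zero[OF assms(1)] by (intro mult_strict_mono) linarith+
      finally show False using prod by simp
    qed
  qed
qed

section \<open>Resolvents of real symmetric matrices\<close>

text \<open>The vector \<open>(A - z) v\<close>, for vectors indexed by the numbers below \<open>N\<close>.\<close>

definition shift_apply :: "nat \<Rightarrow> (nat \<Rightarrow> nat \<Rightarrow> real) \<Rightarrow> complex \<Rightarrow> (nat \<Rightarrow> complex) \<Rightarrow> nat \<Rightarrow> complex" where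
  "shift_apply N A z v i = (\<Sum>k<N. of_real (A i k) * v k) - z * v i"

definition sym_on :: "nat \<Rightarrow> (nat \<Rightarrow> nat \<Rightarrow> real) \<Rightarrow> bool" where
  "sym_on N A \<longleftrightarrow> (\<forall>i<N. \<forall>k<N. A i k = A k i)"

text \<open>Matrices are functions of two indices here, so that sums over rows and columns carry no dimension
  conditions.\<close>

definition green :: "nat \<Rightarrow> (nat \<Rightarrow> nat \<Rightarrow> real) \<Rightarrow> complex \<Rightarrow> nat \<Rightarrow> nat \<Rightarrow> complex" where
  "green N A z i j = resolvent (Matrix.mat N N (\<lambda>(i, j). A i j)) z $$ (i, j)"

lemma sum_mult_delta:
  fixes f :: "nat \<Rightarrow> complex"
  assumes "j < N"
  shows "(\<Sum>k<N. f k * (if k = j then 1 else 0)) = f j" "(\<Sum>k<N. f k * (if j = k then 1 else 0)) = f j"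
proof -
  have "(\<Sum>k<N. f k * (if k = j then 1 else 0)) = (\<Sum>k<N. if k = j then f k else 0)" by (intro sum.cong) auto
  then show *: "(\<Sum>k<N. f k * (if k = j then 1 else 0)) = f j" using assms by simp
  show "(\<Sum>k<N. f k * (if j = k then 1 else 0)) = f j" unfolding *[symmetric] by (intro sum.cong) auto
qed

text \<open>Symmetry of \<open>A\<close> lets \<open>A\<close> move from one factor to the other. This identity yields the resolvent
  identity and the symmetry of the resolvent at once.\<close>

lemma bilinear_shift_apply:
  assumes "sym_on N A"
  shows "(\<Sum>i<N. u i * shift_apply N A z v i) = (\<Sum>i<N. shift_apply N A w u i * v i) + (w - z) * (\<Sum>i<N. u i * v i)"
proof -
  have "(\<Sum>i<N. u i * (\<Sum>k<N. of_real (A i k) * v k)) = (\<Sum>i<N. \<Sum>k<N. u i * of_real (A i k) * v k)"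
    by (simp add: sum_distrib_left mult.assoc)
  also have "\<dots> = (\<Sum>k<N. \<Sum>i<N. u i * of_real (A i k) * v k)" by (rule sum.swap)
  also have "\<dots> = (\<Sum>k<N. (\<Sum>i<N. of_real (A k i) * u i) * v k)"
    using assms unfolding sum_distrib_right by (intro sum.cong refl) (auto simp: sym_on_def mult_ac)
  finally show ?thesis
    by (simp add: shift_apply_def algebra_simps sum_subtractf sum.distrib sum_distrib_left)
qed

text \<open>The form \<open>\<langle>v, A v\<rangle>\<close> is real, so only \<open>z\<close> contributes to the imaginary part of
  \<open>\<langle>v, (A - z) v\<rangle>\<close>. Invertibility of \<open>A - z\<close>, the Ward
  identity and the norm bound on the resolvent all come from this.\<close>

lemma Im_energy:
  assumes "sym_on N A"
  shows "Im z * (\<Sum>i<N. (cmod (v i))\<^sup>2) = - Im (\<Sum>i<N. cnj (v i) * shift_apply N A z v i)"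
proof -
  define S where "S = (\<Sum>i<N. cnj (v i) * shift_apply N A z v i)"
  have c: "cnj S = (\<Sum>i<N. shift_apply N A (cnj z) (\<lambda>i. cnj (v i)) i * v i)"
    unfolding S_def shift_apply_def by (simp add: mult.commute)
  have "S = cnj S + (cnj z - z) * (\<Sum>i<N. cnj (v i) * v i)"
    unfolding c unfolding S_def by (rule bilinear_shift_apply[OF assms])
  moreover have "(\<Sum>i<N. cnj (v i) * v i) = of_real (\<Sum>i<N. (cmod (v i))\<^sup>2)"
    by (simp add: complex_norm_square mult.commute flip: of_real_power)
  ultimately have "Im S = Im (cnj S + (cnj z - z) * of_real (\<Sum>i<N. (cmod (v i))\<^sup>2))" by simp
  then have "Im S = - Im S + (-2 * Im z) * (\<Sum>i<N. (cmod (v i))\<^sup>2)" by simp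
  then show ?thesis unfolding S_def[symmetric] by simp
qed

lemma shift_apply_inj:
  assumes "sym_on N A" "Im z > 0" "\<And>i. i < N \<Longrightarrow> shift_apply N A z v i = 0" "i < N"
  shows "v i = 0"
proof -
  have "Im z * (\<Sum>i<N. (cmod (v i))\<^sup>2) = 0"
    unfolding Im_energy[OF assms(1)] using assms(3) by simp
  then have "(\<Sum>i<N. (cmod (v i))\<^sup>2) = 0" using assms(2) by simp
  then show ?thesis using assms(4) by (simp add: sum_nonneg_eq_0_iff)
qed

lemma resolvent_matrix_det:
  fixes A :: "nat \<Rightarrow> nat \<Rightarrow> real"
  assumes "sym_on N A" "Im z > 0"
  defines "B \<equiv> map_mat complex_of_real (Matrix.mat N N (\<lambda>(i, j). A i j)) - z \<cdot>\<^sub>m 1\<^sub>m N"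
  shows "B \<in> carrier_mat N N" "Determinant.det B \<noteq> 0"
proof -
  show B: "B \<in> carrier_mat N N" unfolding B_def by auto
  show "Determinant.det B \<noteq> 0"
  proof
    assume "Determinant.det B = 0"
    then obtain v where v: "v \<in> carrier_vec N" "v \<noteq> 0\<^sub>v N" "B *\<^sub>v v = 0\<^sub>v N"
      using det_0_iff_vec_prod_zero_field[OF B] by blast
    have "shift_apply N A z (vec_index v) i = 0" if i: "i < N" for i
    proof -
      have "0 = (B *\<^sub>v v) $ i" using v(3) i by simp
      also have "\<dots> = (\<Sum>k<N. B $$ (i, k) * v $ k)"
        using i v(1) B by (simp add: scalar_prod_def atLeast0LessThan)
      also have "\<dots> = (\<Sum>k<N. of_real (A i k) * v $ k - (if k = i then z * v $ k else 0))"
        using i by (intro sum.cong) (auto simp: B_def algebra_simps)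
      also have "\<dots> = shift_apply N A z (vec_index v) i"
        using i by (simp add: sum_subtractf shift_apply_def)
      finally show ?thesis by simp
    qed
    then have "v $ i = 0" if "i < N" for i using shift_apply_inj[OF assms(1,2)] that by blast
    then have "v = 0\<^sub>v N" using v(1) by auto
    then show False using v(2) by simp
  qed
qed

lemma resolvent_inverse:
  fixes A :: "nat \<Rightarrow> nat \<Rightarrow> real"
  assumes "sym_on N A" "Im z > 0"
  defines "M \<equiv> Matrix.mat N N (\<lambda>(i, j). A i j)"
  defines "B \<equiv> map_mat complex_of_real M - z \<cdot>\<^sub>m 1\<^sub>m N"
  shows "B * resolvent M z = 1\<^sub>m N" "resolvent M z \<in> carrier_mat N N"
proof -
  have B: "B \<in> carrier_mat N N" and d: "Determinant.det B \<noteq> 0"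
    using resolvent_matrix_det[OF assms(1,2)] unfolding B_def M_def by auto
  have "mat_inverse B \<noteq> None"
    using det_non_zero_imp_unit[OF B d, of "()"] mat_inverse(1)[OF B, of "()"] by blast
  then obtain C where C: "mat_inverse B = Some C" by auto
  have "resolvent M z = C" using C unfolding resolvent_def B_def M_def by simp
  then show "B * resolvent M z = 1\<^sub>m N" "resolvent M z \<in> carrier_mat N N"
    using mat_inverse(2)[OF B C] by auto
qed

lemma shift_apply_green:
  assumes "sym_on N A" "Im z > 0" "i < N" "j < N"
  shows "shift_apply N A z (\<lambda>k. green N A z k j) i = (if i = j then 1 else 0)"
proof -
  define M where "M = Matrix.mat N N (\<lambda>(i, j). A i j)"
  define B where "B = map_mat complex_of_real M - z \<cdot>\<^sub>m 1\<^sub>m N"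
  have inv: "B * resolvent M z = 1\<^sub>m N" and R: "resolvent M z \<in> carrier_mat N N"
    using resolvent_inverse[OF assms(1,2)] unfolding B_def M_def by auto
  have B: "B \<in> carrier_mat N N" unfolding B_def M_def by auto
  have "(B * resolvent M z) $$ (i, j) = (\<Sum>k<N. B $$ (i, k) * resolvent M z $$ (k, j))"
    using B R assms(3,4) by (simp add: scalar_prod_def atLeast0LessThan)
  also have "\<dots> = (\<Sum>k<N. of_real (A i k) * green N A z k j - (if k = i then z * green N A z k j else 0))"
    using assms(3,4) by (intro sum.cong) (auto simp: B_def M_def green_def algebra_simps)
  also have "\<dots> = shift_apply N A z (\<lambda>k. green N A z k j) i"
    using assms(3) by (simp add: sum_subtractf shift_apply_def)
  finally show ?thesis using inv assms(3,4) by simp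
qed

lemma green_eqI:
  assumes "sym_on N A" "Im z > 0" "i < N"
    and "\<And>i. i < N \<Longrightarrow> shift_apply N A z v i = (\<Sum>j<N. (if i = j then c j else 0))"
  shows "v i = (\<Sum>j<N. c j * green N A z i j)"
proof -
  have "shift_apply N A z (\<lambda>i. v i - (\<Sum>j<N. c j * green N A z i j)) i = 0" if i: "i < N" for i
  proof -
    have "shift_apply N A z (\<lambda>i. v i - (\<Sum>j<N. c j * green N A z i j)) i
        = shift_apply N A z v i - (\<Sum>j<N. c j * shift_apply N A z (\<lambda>k. green N A z k j) i)"
    proof -
      have "(\<Sum>k<N. of_real (A i k) * (\<Sum>j<N. c j * green N A z k j)) = (\<Sum>j<N. c j * (\<Sum>k<N. of_real (A i k) * green N A z k j))"
        unfolding sum_distrib_left by (subst sum.swap) (simp add: mult_ac)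
      then show ?thesis
        unfolding shift_apply_def
        by (simp add: algebra_simps sum_subtractf sum_distrib_left)
    qed
    also have "\<dots> = (\<Sum>j<N. (if i = j then c j else 0)) - (\<Sum>j<N. c j * (if i = j then 1 else 0))"
      using assms(4)[OF i] shift_apply_green[OF assms(1,2) i] by simp
    also have "\<dots> = 0" using i by (simp add: sum_mult_delta)
    finally show ?thesis .
  qed
  from shift_apply_inj[OF assms(1,2) this assms(3)] show ?thesis by simp
qed

lemma resolvent_identity:
  assumes "sym_on N A" "Im z > 0" "Im w > 0" "i < N" "j < N"
  shows "green N A z j i - green N A w i j = (z - w) * (\<Sum>k<N. green N A z k i * green N A w k j)"
proof -
  have "(\<Sum>k<N. green N A z k i * shift_apply N A w (\<lambda>k. green N A w k j) k)
     = (\<Sum>k<N. green N A z k i * (if k = j then 1 else 0))"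
    using shift_apply_green[OF assms(1,3) _ assms(5)] by simp
  also have "\<dots> = green N A z j i" using assms(5) by (simp only: sum_mult_delta)
  finally have l: "(\<Sum>k<N. green N A z k i * shift_apply N A w (\<lambda>k. green N A w k j) k) = green N A z j i" .
  have "(\<Sum>k<N. shift_apply N A z (\<lambda>k. green N A z k i) k * green N A w k j)
     = (\<Sum>k<N. (if k = i then 1 else 0) * green N A w k j)"
    using shift_apply_green[OF assms(1,2) _ assms(4)] by simp
  also have "\<dots> = (\<Sum>k<N. (if k = i then green N A w k j else 0))" by (intro sum.cong) auto
  also have "\<dots> = green N A w i j" using assms(4) by simp
  finally have r: "(\<Sum>k<N. shift_apply N A z (\<lambda>k. green N A z k i) k * green N A w k j) = green N A w i j" .
  show ?thesis using bilinear_shift_apply[OF assms(1), of "\<lambda>k. green N A z k i" w "\<lambda>k. green N A w k j" z]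
    unfolding l r by (simp add: algebra_simps)
qed

lemma green_sym:
  assumes "sym_on N A" "Im z > 0" "i < N" "j < N"
  shows "green N A z j i = green N A z i j"
  using resolvent_identity[OF assms(1,2,2,3,4)] by simp

text \<open>The case of \<open>Im_energy\<close> in which \<open>v\<close> is the \<open>j\<close>-th column of the resolvent.\<close>

lemma Ward:
  assumes "sym_on N A" "Im z > 0" "j < N"
  shows "(\<Sum>k<N. (cmod (green N A z k j))\<^sup>2) = Im (green N A z j j) / Im z"
proof -
  have "Im z * (\<Sum>k<N. (cmod (green N A z k j))\<^sup>2) = - Im (\<Sum>k<N. cnj (green N A z k j) * shift_apply N A z (\<lambda>k. green N A z k j) k)"
    by (rule Im_energy[OF assms(1)])
  also have "(\<Sum>k<N. cnj (green N A z k j) * shift_apply N A z (\<lambda>k. green N A z k j) k)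
     = (\<Sum>k<N. cnj (green N A z k j) * (if k = j then 1 else 0))"
    using shift_apply_green[OF assms(1,2) _ assms(3)] by simp
  also have "\<dots> = cnj (green N A z j j)" using assms(3) by (simp only: sum_mult_delta)
  finally show ?thesis using assms(2) by (simp add: field_simps)
qed

lemma Im_green_pos:
  assumes "sym_on N A" "Im z > 0" "j < N"
  shows "Im (green N A z j j) > 0"
proof (rule ccontr)
  assume "\<not> ?thesis"
  then have "Im (green N A z j j) / Im z \<le> 0" using assms(2) by (simp add: divide_nonpos_pos)
  then have "(\<Sum>k<N. (cmod (green N A z k j))\<^sup>2) \<le> 0" using Ward[OF assms] by simp
  then have "(\<Sum>k<N. (cmod (green N A z k j))\<^sup>2) = 0" by (meson antisym sum_nonneg zero_le_power2)
  then have "green N A z k j = 0" if "k < N" for k using that by (simp add: sum_nonneg_eq_0_iff)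
  then have "shift_apply N A z (\<lambda>k. green N A z k j) j = 0" using assms(3) by (simp add: shift_apply_def)
  then show False using shift_apply_green[OF assms(1,2,3,3)] by simp
qed

lemma norm_green_diag_le:
  assumes "sym_on N A" "Im z > 0" "j < N"
  shows "cmod (green N A z j j) \<le> 1 / Im z"
proof -
  have "(cmod (green N A z j j))\<^sup>2 \<le> (\<Sum>k<N. (cmod (green N A z k j))\<^sup>2)"
    using assms(3) by (intro member_le_sum) auto
  also have "\<dots> = Im (green N A z j j) / Im z" by (rule Ward[OF assms])
  also have "\<dots> \<le> cmod (green N A z j j) / Im z"
    using assms(2) abs_Im_le_cmod[of "green N A z j j"] by (intro divide_right_mono) auto
  finally have "cmod (green N A z j j) * cmod (green N A z j j) \<le> cmod (green N A z j j) * (1 / Im z)"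
    by (simp add: power2_eq_square)
  moreover have "cmod (green N A z j j) > 0" using Im_green_pos[OF assms] by auto
  ultimately show ?thesis using mult_le_cancel_left_pos by blast
qed

lemma Ward_le:
  assumes "sym_on N A" "Im z > 0" "j < N"
  shows "(\<Sum>k<N. (cmod (green N A z k j))\<^sup>2) \<le> 1 / (Im z)\<^sup>2"
proof -
  have "Im (green N A z j j) \<le> 1 / Im z"
    using norm_green_diag_le[OF assms] abs_Im_le_cmod[of "green N A z j j"] by linarith
  then show ?thesis unfolding Ward[OF assms] using assms(2) by (simp add: field_simps power2_eq_square)
qed

lemma green_Lipschitz:
  assumes "sym_on N A" "Im z > 0" "Im w > 0" "i < N" "j < N"
  shows "cmod (green N A z i j - green N A w i j) \<le> cmod (z - w) / (Im z * Im w)"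
proof -
  have "cmod (\<Sum>k<N. green N A z k i * green N A w k j) \<le> (\<Sum>k<N. cmod (green N A z k i) * cmod (green N A w k j))"
    by (rule order_trans[OF norm_sum]) (simp add: norm_mult)
  also have "\<dots> \<le> sqrt (\<Sum>k<N. (cmod (green N A z k i))\<^sup>2) * sqrt (\<Sum>k<N. (cmod (green N A w k j))\<^sup>2)"
    using L2_set_mult_ineq[of "\<lambda>k. cmod (green N A z k i)" "\<lambda>k. cmod (green N A w k j)" "{..<N}"]
    by (simp add: L2_set_def)
  also have "\<dots> \<le> sqrt ((1 / Im z)\<^sup>2) * sqrt ((1 / Im w)\<^sup>2)"
    using Ward_le[OF assms(1,2,4)] Ward_le[OF assms(1,3,5)]
    by (intro mult_mono real_sqrt_le_mono) (auto simp: power_divide sum_nonneg)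
  also have "\<dots> = 1 / (Im z * Im w)" using assms(2,3) by simp
  finally have *: "cmod (\<Sum>k<N. green N A z k i * green N A w k j) \<le> 1 / (Im z * Im w)" .
  have "cmod (green N A z i j - green N A w i j) = cmod (z - w) * cmod (\<Sum>k<N. green N A z k i * green N A w k j)"
    using resolvent_identity[OF assms] green_sym[OF assms(1,2,4,5)] by (simp add: norm_mult)
  also have "\<dots> \<le> cmod (z - w) * (1 / (Im z * Im w))" by (intro mult_left_mono *) auto
  finally show ?thesis by simp
qed

text \<open>Zeroing row and column \<open>i\<close> has the effect of passing to the minor, but keeps the dimension: away
  from index \<open>i\<close> the resolvent is that of the minor.\<close>

definition isolate :: "nat \<Rightarrow> (nat \<Rightarrow> nat \<Rightarrow> real) \<Rightarrow> nat \<Rightarrow> nat \<Rightarrow> real" where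
  "isolate i A k l = (if k = i \<or> l = i then 0 else A k l)"

lemma sym_on_isolate: "sym_on N A \<Longrightarrow> sym_on N (isolate i A)"
  by (auto simp: sym_on_def isolate_def)

lemma green_isolate_row:
  assumes "sym_on N A" "Im z > 0" "i < N" "j < N" "j \<noteq> i"
  shows "green N (isolate i A) z i j = 0"
proof -
  have "shift_apply N (isolate i A) z (\<lambda>k. green N (isolate i A) z k j) i = 0"
    using shift_apply_green[OF sym_on_isolate[OF assms(1)] assms(2,3,4)] assms(5) by simp
  then have "z * green N (isolate i A) z i j = 0" by (simp add: shift_apply_def isolate_def)
  then show ?thesis using assms(2) by auto
qed

text \<open>Row \<open>i\<close> of \<open>A\<close> without its diagonal entry, applied to column \<open>j\<close> of the resolvent of the minor.\<close>

definition row_isolate :: "nat \<Rightarrow> (nat \<Rightarrow> nat \<Rightarrow> real) \<Rightarrow> complex \<Rightarrow> nat \<Rightarrow> nat \<Rightarrow> complex" where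
  "row_isolate N A z i j = (\<Sum>k<N. of_real (A i k) * (if k = i then 0 else green N (isolate i A) z k j))"

text \<open>The isolated resolvent column \<open>v\<close> has \<open>v i = 0\<close>, so applying \<open>A - z\<close> instead of the isolated
  matrix changes the image only at index \<open>i\<close>. Uniqueness of solutions identifies \<open>v\<close> as a
  combination of columns \<open>j\<close> and \<open>i\<close> of the full resolvent.\<close>

lemma green_isolate_expand:
  assumes "sym_on N A" "Im z > 0" "i < N" "j < N" "j \<noteq> i" "k < N"
  shows "green N (isolate i A) z k j = green N A z k j + row_isolate N A z i j * green N A z k i"
proof -
  let ?F = "green N (isolate i A) z"
  let ?r = "row_isolate N A z i j"
  have Fi: "?F i j = 0" by (rule green_isolate_row[OF assms(1-5)])
  have "shift_apply N A z (\<lambda>k. ?F k j) l = (\<Sum>q<N. (if l = q then (if q = j then 1 else 0) + (if q = i then ?r else 0) else 0))"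
    if l: "l < N" for l
  proof (cases "l = i")
    case True
    have "shift_apply N A z (\<lambda>k. ?F k j) l = ?r"
      unfolding shift_apply_def row_isolate_def True Fi by (auto intro!: sum.cong simp: Fi)
    then show ?thesis using True assms(3,5) by simp
  next
    case False
    have "shift_apply N A z (\<lambda>k. ?F k j) l = shift_apply N (isolate i A) z (\<lambda>k. ?F k j) l"
    proof -
      have e: "of_real (A l k) * ?F k j = of_real (isolate i A l k) * ?F k j" for k
        using False Fi by (cases "k = i") (simp_all add: isolate_def)
      show ?thesis unfolding shift_apply_def by (simp only: e)
    qed
    also have "\<dots> = (if l = j then 1 else 0)"
      by (rule shift_apply_green[OF sym_on_isolate[OF assms(1)] assms(2) l assms(4)])
    finally show ?thesis using False l by simp
  qed
  from green_eqI[OF assms(1,2,6) this]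
  have "?F k j = (\<Sum>q<N. ((if q = j then 1 else 0) + (if q = i then ?r else 0)) * green N A z k q)" .
  also have "\<dots> = (\<Sum>q<N. (if q = j then green N A z k q else 0) + (if q = i then ?r * green N A z k q else 0))"
    by (intro sum.cong) (auto simp: algebra_simps)
  also have "\<dots> = green N A z k j + ?r * green N A z k i"
    using assms(3,4) by (simp add: sum.distrib)
  finally show ?thesis .
qed

lemma green_offdiag:
  assumes "sym_on N A" "Im z > 0" "i < N" "j < N" "j \<noteq> i"
  shows "green N A z i j = - green N A z i i * row_isolate N A z i j"
  using green_isolate_expand[OF assms(1-5) assms(3)] green_isolate_row[OF assms] by (simp add: algebra_simps eq_neg_iff_add_eq_0)

lemma green_diag_nonzero: "sym_on N A \<Longrightarrow> Im z > 0 \<Longrightarrow> i < N \<Longrightarrow> green N A z i i \<noteq> 0"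
  using Im_green_pos[of N A z i] by (metis less_irrefl zero_complex.simps(2))

lemma green_isolate_eq:
  assumes "sym_on N A" "Im z > 0" "i < N" "j < N" "j \<noteq> i" "k < N"
  shows "green N (isolate i A) z k j = green N A z k j - green N A z k i * green N A z i j / green N A z i i"
proof -
  have "row_isolate N A z i j = - green N A z i j / green N A z i i"
    using green_offdiag[OF assms(1-5)] green_diag_nonzero[OF assms(1-3)] by simp
  then show ?thesis using green_isolate_expand[OF assms] by simp
qed

text \<open>The \<open>i\<close>-th diagonal equation of \<open>(A - z) G = 1\<close>, with the off-diagonal entries of column \<open>i\<close>
  eliminated by \<open>green_offdiag\<close>.\<close>

lemma Schur_complement:
  assumes "sym_on N A" "Im z > 0" "i < N"
  shows "green N A z i i * (of_real (A i i) - z - (\<Sum>j<N. if j = i then 0 else row_isolate N A z i j * of_real (A i j))) = 1"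
proof -
  have "1 = (\<Sum>k<N. of_real (A i k) * green N A z k i) - z * green N A z i i"
    using shift_apply_green[OF assms assms(3)] by (simp add: shift_apply_def)
  also have "(\<Sum>k<N. of_real (A i k) * green N A z k i)
     = (\<Sum>k<N. (if k = i then of_real (A i i) * green N A z i i else 0)
          - green N A z i i * (if k = i then 0 else row_isolate N A z i k * of_real (A i k)))"
  proof (rule sum.cong[OF refl])
    fix k assume k: "k \<in> {..<N}"
    show "of_real (A i k) * green N A z k i = (if k = i then of_real (A i i) * green N A z i i else 0)
          - green N A z i i * (if k = i then 0 else row_isolate N A z i k * of_real (A i k))"
    proof (cases "k = i")
      case False
      have "green N A z k i = - green N A z i i * row_isolate N A z i k"
        using green_sym[OF assms(1,2,3), of k] green_offdiag[OF assms _ False] k by simp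
      then show ?thesis using False by (simp only: if_False) (simp add: mult_ac)
    qed simp
  qed
  also have "\<dots> = of_real (A i i) * green N A z i i - green N A z i i * (\<Sum>j<N. if j = i then 0 else row_isolate N A z i j * of_real (A i j))"
    using assms(3) by (simp add: sum_subtractf sum_distrib_left)
  finally show ?thesis by (simp add: algebra_simps)
qed

section \<open>The self-consistent equation for matrices of signs\<close>

definition wigner :: "nat \<Rightarrow> (nat \<Rightarrow> nat \<Rightarrow> real) \<Rightarrow> nat \<Rightarrow> nat \<Rightarrow> real" where
  "wigner N X i j = X i j / sqrt (real N)"

text \<open>The resolvent of the minor, extended by zero. The value at \<open>(i, i)\<close> in particular is \<open>0\<close> and not
  \<open>- 1 / z\<close>, so sums over all indices are sums over the minor.\<close>

definition minor_res :: "nat \<Rightarrow> (nat \<Rightarrow> nat \<Rightarrow> real) \<Rightarrow> complex \<Rightarrow> nat \<Rightarrow> nat \<Rightarrow> nat \<Rightarrow> complex" where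
  "minor_res N X z i k l = (if k = i \<or> l = i then 0 else green N (isolate i (wigner N X)) z k l)"

definition sign_matrix :: "nat \<Rightarrow> (nat \<Rightarrow> nat \<Rightarrow> real) \<Rightarrow> bool" where
  "sign_matrix N X \<longleftrightarrow> (\<forall>i<N. \<forall>j<N. X i j = X j i \<and> \<bar>X i j\<bar> = 1)"

definition row_sum :: "nat \<Rightarrow> (nat \<Rightarrow> nat \<Rightarrow> real) \<Rightarrow> complex \<Rightarrow> nat \<Rightarrow> nat \<Rightarrow> complex" where
  "row_sum N X z i j = (\<Sum>k<N. of_real (X i k) * minor_res N X z i k j)"

definition row_form :: "nat \<Rightarrow> (nat \<Rightarrow> nat \<Rightarrow> real) \<Rightarrow> complex \<Rightarrow> nat \<Rightarrow> complex" where
  "row_form N X z i = (\<Sum>k<N. \<Sum>l\<in>{..<N} - {k}. of_real (X i k) * minor_res N X z i k l * of_real (X i l))"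

text \<open>The only probabilistic input. The scale of each bound is itself random, and the
  bounds are meaningful without any a priori control on the resolvent; this is what makes the
  induction over the grid deterministic.\<close>

definition large_deviation_bounds :: "real \<Rightarrow> nat \<Rightarrow> (nat \<Rightarrow> nat \<Rightarrow> real) \<Rightarrow> complex \<Rightarrow> bool" where
  "large_deviation_bounds \<phi> N X z \<longleftrightarrow> (\<forall>i<N.
     cmod (row_form N X z i) \<le> 72 * \<phi>\<^sup>2 * sqrt (\<Sum>k<N. \<Sum>l<N. (cmod (minor_res N X z i k l))\<^sup>2) \<and>
     (\<forall>j<N. j \<noteq> i \<longrightarrow> cmod (row_sum N X z i j) \<le> 6 * \<phi> * sqrt (\<Sum>k<N. (cmod (minor_res N X z i k j))\<^sup>2)))"

definition avg_res :: "nat \<Rightarrow> (nat \<Rightarrow> nat \<Rightarrow> real) \<Rightarrow> complex \<Rightarrow> complex" where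
  "avg_res N A z = (\<Sum>i<N. green N A z i i) / of_nat N"

text \<open>The control parameter \<open>\<Psi>\<close>.\<close>

abbreviation control :: "nat \<Rightarrow> complex \<Rightarrow> real" where
  "control N z \<equiv> 1 / sqrt (real N * Im z)"

lemma sym_on_wigner: "sign_matrix N X \<Longrightarrow> sym_on N (wigner N X)"
  by (simp add: sym_on_def wigner_def sign_matrix_def)

context
  fixes N :: nat and X :: "nat \<Rightarrow> nat \<Rightarrow> real" and z :: complex
  assumes X: "sign_matrix N X" and z: "Im z > 0" and N: "N \<ge> 1"
begin

private abbreviation (input) "G \<equiv> green N (wigner N X) z"
private abbreviation (input) "F \<equiv> minor_res N X z"
private abbreviation (input) "s \<equiv> avg_res N (wigner N X) z"

lemma row_isolate_wigner: "j \<noteq> i \<Longrightarrow> row_isolate N (wigner N X) z i j = row_sum N X z i j / of_real (sqrt (real N))"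
  unfolding row_isolate_def row_sum_def sum_divide_distrib
  by (intro sum.cong) (auto simp: minor_res_def wigner_def)

lemma minor_trace:
  assumes i: "i < N"
  shows "(\<Sum>k<N. F i k k) = of_nat N * s - (\<Sum>k<N. (G k i)\<^sup>2) / G i i"
proof -
  note S = sym_on_wigner[OF X]
  have "F i k k = G k k - (G k i)\<^sup>2 / G i i" if k: "k < N" for k
  proof (cases "k = i")
    case True
    then show ?thesis using green_diag_nonzero[OF S z i] by (simp add: minor_res_def power2_eq_square)
  next
    case False
    then show ?thesis using green_isolate_eq[OF S z i k False k] green_sym[OF S z i k] by (simp add: minor_res_def power2_eq_square)
  qed
  then show ?thesis using N by (simp add: sum_subtractf avg_res_def flip: sum_divide_distrib)
qed

text \<open>The traces differ by \<open>(\<Sum>k. (G k i)\<^sup>2) / G i i\<close>, and the Ward identity turns the sum of squares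
  into \<open>Im (G i i) / Im z\<close>.\<close>

lemma minor_trace_close:
  assumes i: "i < N"
  shows "cmod (of_nat N * s - (\<Sum>k<N. F i k k)) \<le> 1 / Im z"
proof -
  note S = sym_on_wigner[OF X]
  have g: "cmod (G i i) > 0" using green_diag_nonzero[OF S z i] by simp
  have "cmod (of_nat N * s - (\<Sum>k<N. F i k k)) = cmod (\<Sum>k<N. (G k i)\<^sup>2) / cmod (G i i)"
    unfolding minor_trace[OF i] by (simp add: norm_divide)
  also have "\<dots> \<le> (\<Sum>k<N. (cmod (G k i))\<^sup>2) / cmod (G i i)"
    by (intro divide_right_mono order_trans[OF norm_sum]) (auto simp: norm_power)
  also have "\<dots> = Im (G i i) / Im z / cmod (G i i)" by (simp only: Ward[OF S z i])
  also have "\<dots> \<le> 1 / Im z" using abs_Im_le_cmod[of "G i i"] g z by (simp add: field_simps)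
  finally show ?thesis .
qed

lemma minor_norm:
  assumes i: "i < N"
  shows "(\<Sum>k<N. \<Sum>l<N. (cmod (F i k l))\<^sup>2) \<le> (real N * Im s + 1 / Im z) / Im z"
proof -
  note S = sym_on_isolate[OF sym_on_wigner[OF X], of i]
  have "(\<Sum>k<N. \<Sum>l<N. (cmod (F i k l))\<^sup>2) = (\<Sum>l<N. \<Sum>k<N. (cmod (F i k l))\<^sup>2)" by (rule sum.swap)
  also have "\<dots> \<le> (\<Sum>l<N. Im (F i l l) / Im z)"
  proof (rule sum_mono)
    fix l assume l: "l \<in> {..<N}"
    show "(\<Sum>k<N. (cmod (F i k l))\<^sup>2) \<le> Im (F i l l) / Im z"
    proof (cases "l = i")
      case False
      have "(\<Sum>k<N. (cmod (F i k l))\<^sup>2) \<le> (\<Sum>k<N. (cmod (green N (isolate i (wigner N X)) z k l))\<^sup>2)"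
        by (intro sum_mono) (auto simp: minor_res_def)
      also have "\<dots> = Im (F i l l) / Im z" using Ward[OF S z] l False by (simp add: minor_res_def)
      finally show ?thesis .
    qed (simp add: minor_res_def)
  qed
  also have "\<dots> = Im (\<Sum>l<N. F i l l) / Im z" by (simp add: sum_divide_distrib)
  also have "\<dots> \<le> (real N * Im s + 1 / Im z) / Im z"
  proof (intro divide_right_mono)
    have "Im (\<Sum>l<N. F i l l) - Im (of_nat N * s) \<le> 1 / Im z"
      using minor_trace_close[OF i] abs_Im_le_cmod[of "of_nat N * s - (\<Sum>k<N. F i k k)"] by simp
    then show "Im (\<Sum>l<N. F i l l) \<le> real N * Im s + 1 / Im z" by simp
  qed (use z in simp)
  finally show ?thesis .
qed

text \<open>Since \<open>(X i k)\<^sup>2 = 1\<close>, the diagonal part of the quadratic form in the Schur complement is exactly the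
  trace of the minor, without a fluctuation of its own.\<close>

lemma diagonal_equation:
  assumes i: "i < N"
  shows "G i i * (- z - s + (of_real (X i i / sqrt (real N)) + (of_nat N * s - (\<Sum>k<N. F i k k)) / of_nat N - row_form N X z i / of_nat N)) = 1"
proof -
  note S = sym_on_wigner[OF X]
  have "(\<Sum>j<N. if j = i then 0 else row_isolate N (wigner N X) z i j * of_real (wigner N X i j))
     = (\<Sum>j<N. \<Sum>k<N. of_real (X i k) * F i k j * of_real (X i j)) / of_nat N"
  proof -
    have sq: "complex_of_real (sqrt (real N)) * complex_of_real (sqrt (real N)) = of_nat N"
      by (simp flip: of_real_mult)
    have "(if j = i then 0 else row_isolate N (wigner N X) z i j * of_real (wigner N X i j))
       = (\<Sum>k<N. of_real (X i k) * F i k j * of_real (X i j)) / of_nat N" for j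
    proof (cases "j = i")
      case True
      then show ?thesis by (simp add: minor_res_def)
    next
      case False
      then have "row_isolate N (wigner N X) z i j * of_real (wigner N X i j) = row_sum N X z i j * of_real (X i j) / of_nat N"
        by (simp add: row_isolate_wigner wigner_def sq)
      then show ?thesis using False by (simp add: row_sum_def sum_distrib_right)
    qed
    then show ?thesis by (simp add: sum_divide_distrib)
  qed
  also have "(\<Sum>j<N. \<Sum>k<N. of_real (X i k) * F i k j * of_real (X i j)) = (\<Sum>k<N. \<Sum>j<N. of_real (X i k) * F i k j * of_real (X i j))"
    by (rule sum.swap)
  also have "\<dots> = (\<Sum>k<N. F i k k + (\<Sum>j\<in>{..<N} - {k}. of_real (X i k) * F i k j * of_real (X i j)))"
  proof (rule sum.cong[OF refl])
    fix k assume k: "k \<in> {..<N}"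
    then have "X i k * X i k = 1" using X i by (metis abs_mult_self_eq lessThan_iff mult_1 sign_matrix_def)
    then have "of_real (X i k) * F i k k * of_real (X i k) = F i k k"
      by (metis mult.commute mult.left_commute mult.right_neutral of_real_1 of_real_mult)
    then show "(\<Sum>j<N. of_real (X i k) * F i k j * of_real (X i j)) = F i k k + (\<Sum>j\<in>{..<N} - {k}. of_real (X i k) * F i k j * of_real (X i j))"
      using k by (subst sum.remove[of _ k]) auto
  qed
  also have "\<dots> = (\<Sum>k<N. F i k k) + row_form N X z i" by (simp add: sum.distrib row_form_def)
  finally have eq: "(\<Sum>j<N. if j = i then 0 else row_isolate N (wigner N X) z i j * of_real (wigner N X i j))
     = ((\<Sum>k<N. F i k k) + row_form N X z i) / of_nat N" .
  have eq2: "of_real (wigner N X i i) - z - ((\<Sum>k<N. F i k k) + row_form N X z i) / of_nat N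
     = - z - s + (of_real (X i i / sqrt (real N)) + (of_nat N * s - (\<Sum>k<N. F i k k)) / of_nat N - row_form N X z i / of_nat N)"
    using N by (simp add: wigner_def diff_divide_distrib add_divide_distrib)
  show ?thesis using Schur_complement[OF S z i] unfolding eq eq2 .
qed

lemma diagonal_error:
  assumes i: "i < N" and ld: "large_deviation_bounds \<phi> N X z"
  shows "\<exists>e. G i i * (- z - s + e) = 1 \<and>
     cmod e \<le> 1 / sqrt (real N) + 1 / (real N * Im z) + 72 * \<phi>\<^sup>2 * sqrt ((Im s + 1 / (real N * Im z)) / (real N * Im z))"
proof (intro exI conjI, rule diagonal_equation[OF i])
  have x: "cmod (of_real (X i i / sqrt (real N))) = 1 / sqrt (real N)"
    using X i by (simp only: norm_of_real) (simp add: sign_matrix_def)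
  have t: "cmod ((of_nat N * s - (\<Sum>k<N. F i k k)) / of_nat N) \<le> 1 / (real N * Im z)"
  proof -
    have "cmod ((of_nat N * s - (\<Sum>k<N. F i k k)) / of_nat N) = cmod (of_nat N * s - (\<Sum>k<N. F i k k)) / real N"
      by (simp only: norm_divide norm_of_nat)
    also have "\<dots> \<le> 1 / Im z / real N" by (intro divide_right_mono minor_trace_close i) auto
    finally show ?thesis by (simp add: mult.commute)
  qed
  have root: "sqrt ((real N)\<^sup>2 * q) = real N * sqrt q" for q by (simp add: real_sqrt_mult)
  have "cmod (row_form N X z i) \<le> 72 * \<phi>\<^sup>2 * sqrt (\<Sum>k<N. \<Sum>l<N. (cmod (F i k l))\<^sup>2)"
    using ld i by (simp add: large_deviation_bounds_def)
  also have "\<dots> \<le> 72 * \<phi>\<^sup>2 * sqrt ((real N * Im s + 1 / Im z) / Im z)"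
    by (intro mult_left_mono real_sqrt_le_mono minor_norm i) auto
  also have "(real N * Im s + 1 / Im z) / Im z = (real N)\<^sup>2 * ((Im s + 1 / (real N * Im z)) / (real N * Im z))"
    using N z by (simp add: field_simps power2_eq_square)
  finally have "cmod (row_form N X z i) \<le> (72 * \<phi>\<^sup>2 * sqrt ((Im s + 1 / (real N * Im z)) / (real N * Im z))) * real N"
    unfolding root by (simp only: mult_ac)
  then have q: "cmod (row_form N X z i / of_nat N) \<le> 72 * \<phi>\<^sup>2 * sqrt ((Im s + 1 / (real N * Im z)) / (real N * Im z))"
    using N by (simp add: norm_divide pos_divide_le_eq)
  show "cmod (of_real (X i i / sqrt (real N)) + (of_nat N * s - (\<Sum>k<N. F i k k)) / of_nat N - row_form N X z i / of_nat N)
     \<le> 1 / sqrt (real N) + 1 / (real N * Im z) + 72 * \<phi>\<^sup>2 * sqrt ((Im s + 1 / (real N * Im z)) / (real N * Im z))"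
    by (rule order_trans[OF norm_triangle_ineq4 add_mono[OF order_trans[OF norm_triangle_ineq add_mono[OF _ t]] q]])
       (simp only: x order_refl)
qed

text \<open>The bound contains \<open>G i j\<close> on both sides, because the diagonal entry of the minor resolvent is
  expressed through the full one. It is solved for \<open>G i j\<close> in \<open>local_law_step\<close>, where the
  coefficient is small.\<close>

lemma offdiagonal_bound:
  assumes i: "i < N" and j: "j < N" "j \<noteq> i" and ld: "large_deviation_bounds \<phi> N X z" and phi: "\<phi> \<ge> 0"
  shows "cmod (G i j) \<le> cmod (G i i) * (6 * \<phi> * sqrt ((cmod (G j j) + (cmod (G i j))\<^sup>2 / cmod (G i i)) / (real N * Im z)))"
proof -
  note S = sym_on_wigner[OF X]
  note S' = sym_on_isolate[OF S, of i]
  let ?F = "green N (isolate i (wigner N X)) z"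
  have "(\<Sum>k<N. (cmod (F i k j))\<^sup>2) \<le> (\<Sum>k<N. (cmod (?F k j))\<^sup>2)"
    by (intro sum_mono) (auto simp: minor_res_def)
  also have "\<dots> = Im (?F j j) / Im z" by (rule Ward[OF S' z j(1)])
  also have "\<dots> \<le> (cmod (G j j) + (cmod (G i j))\<^sup>2 / cmod (G i i)) / Im z"
  proof (intro divide_right_mono)
    have "Im (?F j j) \<le> cmod (?F j j)" using abs_Im_le_cmod[of "?F j j"] by simp
    also have "cmod (?F j j) = cmod (G j j - (G i j)\<^sup>2 / G i i)"
      using green_isolate_eq[OF S z i j j(1)] green_sym[OF S z i j(1)] by (simp add: power2_eq_square)
    also have "\<dots> \<le> cmod (G j j) + cmod ((G i j)\<^sup>2 / G i i)" by (rule norm_triangle_ineq4)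
    finally show "Im (?F j j) \<le> cmod (G j j) + (cmod (G i j))\<^sup>2 / cmod (G i i)"
      by (simp add: norm_divide norm_power)
  qed (use z in simp)
  finally have w: "(\<Sum>k<N. (cmod (F i k j))\<^sup>2) \<le> (cmod (G j j) + (cmod (G i j))\<^sup>2 / cmod (G i i)) / Im z" .
  have "cmod (row_sum N X z i j) \<le> 6 * \<phi> * sqrt (\<Sum>k<N. (cmod (F i k j))\<^sup>2)"
    using ld i j by (simp add: large_deviation_bounds_def)
  also have "\<dots> \<le> 6 * \<phi> * sqrt ((cmod (G j j) + (cmod (G i j))\<^sup>2 / cmod (G i i)) / Im z)"
    using phi w by (intro mult_left_mono real_sqrt_le_mono) auto
  finally have r: "cmod (row_sum N X z i j) / sqrt (real N) \<le> 6 * \<phi> * sqrt ((cmod (G j j) + (cmod (G i j))\<^sup>2 / cmod (G i i)) / Im z) / sqrt (real N)"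
    by (intro divide_right_mono) auto
  have "cmod (G i j) = cmod (G i i) * (cmod (row_sum N X z i j) / sqrt (real N))"
    unfolding green_offdiag[OF S z i j] row_isolate_wigner[OF j(2)] by (simp add: norm_mult norm_divide)
  also have "\<dots> \<le> cmod (G i i) * (6 * \<phi> * sqrt ((cmod (G j j) + (cmod (G i j))\<^sup>2 / cmod (G i i)) / Im z) / sqrt (real N))"
    by (intro mult_left_mono r) auto
  finally show ?thesis by (simp add: real_sqrt_divide real_sqrt_mult mult_ac)
qed

end

section \<open>From the self-consistent equation to the local law\<close>

lemma diagonal_error_le:
  fixes \<phi> b :: real
  assumes X: "sign_matrix N X" and N: "N \<ge> 1" and i: "i < N"
    and ld: "large_deviation_bounds \<phi> N X z" and phi: "\<phi> \<ge> 1" and b: "b \<ge> 1"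
    and z: "Im z > 0" "Im z \<le> b\<^sup>2" "real N * Im z \<ge> 1"
    and ims: "Im (avg_res N (wigner N X) z) \<le> 5 / 4"
  defines "\<delta> \<equiv> (b + 109) * \<phi>\<^sup>2 * control N z"
  shows "\<exists>e. green N (wigner N X) z i i * (- z - avg_res N (wigner N X) z + e) = 1 \<and> cmod e \<le> \<delta>"
proof -
  define p where "p = control N z"
  let ?s = "avg_res N (wigner N X) z"
  have q1: "sqrt (real N * Im z) \<ge> 1" using z(3) by simp
  have p: "p > 0" "p \<le> 1" using q1 by (auto simp: p_def divide_le_eq_1)
  have p2: "1 / (real N * Im z) = p\<^sup>2" using z(3) by (simp add: p_def power_divide)
  have pp: "p\<^sup>2 \<le> p" using p by (simp add: power2_eq_square mult_left_le)
  obtain e where e: "green N (wigner N X) z i i * (- z - ?s + e) = 1"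
    "cmod e \<le> 1 / sqrt (real N) + 1 / (real N * Im z) + 72 * \<phi>\<^sup>2 * sqrt ((Im ?s + 1 / (real N * Im z)) / (real N * Im z))"
    using diagonal_error[OF X z(1) N i ld] by blast
  have phi2: "\<phi>\<^sup>2 \<ge> 1" using phi by simp
  have 1: "1 / sqrt (real N) \<le> b * p"
  proof -
    have "1 / sqrt (real N) = sqrt (Im z) * p" using z(1) by (simp add: p_def real_sqrt_mult)
    also have "\<dots> \<le> b * p" using z b p by (intro mult_right_mono real_le_lsqrt) auto
    finally show ?thesis .
  qed
  have 3: "sqrt ((Im ?s + 1 / (real N * Im z)) / (real N * Im z)) \<le> 3 / 2 * p"
  proof -
    have "Im ?s + p\<^sup>2 \<le> 9 / 4" using ims pp p by linarith
    then have "sqrt ((Im ?s + p\<^sup>2) * p\<^sup>2) \<le> sqrt ((9 / 4) * p\<^sup>2)" by (intro real_sqrt_le_mono mult_right_mono) auto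
    also have "\<dots> = 3 / 2 * p" using p by (simp add: real_sqrt_mult real_sqrt_divide real_sqrt_abs2[of 3, simplified])
    finally show ?thesis unfolding p2[symmetric] by simp
  qed
  have "cmod e \<le> b * p + p + 72 * \<phi>\<^sup>2 * (3 / 2 * p)"
    using e(2) 1 3 pp phi2 unfolding p2 
    by (intro order_trans[OF e(2)[unfolded p2]] add_mono mult_left_mono) auto
  also have "\<dots> = (b + 1) * p * 1 + 108 * \<phi>\<^sup>2 * p" by (simp add: algebra_simps)
  also have "\<dots> \<le> (b + 1) * p * \<phi>\<^sup>2 + 108 * \<phi>\<^sup>2 * p"
    using phi2 b p by (intro add_right_mono mult_left_mono) auto
  also have "\<dots> = \<delta>" unfolding \<delta>_def p_def[symmetric] by (simp add: algebra_simps)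
  finally show ?thesis using e(1) by blast
qed

text \<open>One point of the grid: a rough bound on \<open>s - m\<close> keeps all \<open>G i i\<close> bounded, so the self-consistent
  equation holds with error \<open>2 * \<delta>\<close> and \<open>quadratic_stability\<close> returns the sharp bound. The
  identity \<open>(s - m) * (s - 1 / m) = (1 / N) * (\<Sum>i. G i i * e i)\<close> is exact.\<close>

lemma local_law_step:
  fixes \<phi> b :: real
  assumes X: "sign_matrix N X" and N: "N \<ge> 1"
    and ld: "large_deviation_bounds \<phi> N X z" and phi: "\<phi> \<ge> 1" and b: "b \<ge> 1"
    and z: "Im z > 0" "Im z \<le> b\<^sup>2" "real N * Im z \<ge> 1"
  defines "\<delta> \<equiv> (b + 109) * \<phi>\<^sup>2 * control N z"
    and "G \<equiv> green N (wigner N X) z" and "s \<equiv> avg_res N (wigner N X) z" and "m \<equiv> stieltjes semicircle z"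
  assumes d: "\<delta> \<le> 1 / 4" and ap: "cmod (s - m) \<le> 1 / 4"
    and ap2: "(root_gap z)\<^sup>2 > 16 * (2 * \<delta>) \<Longrightarrow> cmod (s - m) \<le> root_gap z / 2"
  shows "cmod (s - m) \<le> 5 * sqrt (2 * \<delta>)"
    and "(root_gap z)\<^sup>2 > 16 * (2 * \<delta>) \<Longrightarrow> cmod (s - m) \<le> 2 * (2 * \<delta>) / root_gap z"
    and "\<And>i. i < N \<Longrightarrow> cmod (G i i - m) \<le> 2 * (cmod (s - m) + \<delta>)"
    and "\<And>i j. i < N \<Longrightarrow> j < N \<Longrightarrow> i \<noteq> j \<Longrightarrow> cmod z \<le> b \<Longrightarrow> cmod (G i j) \<le> 48 * \<delta>"
proof -
  define p where "p = control N z"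
  have p0: "p > 0" using N z(1) by (simp add: p_def)
  have dp: "\<delta> = (b + 109) * \<phi>\<^sup>2 * p" by (simp add: \<delta>_def p_def)
  have dpos: "\<delta> > 0" unfolding dp using b phi p0 by (intro mult_pos_pos) auto
  note M = semicircle_transform[OF z(1), folded m_def]
  have ims: "Im s \<le> 5 / 4"
  proof -
    have "Im s \<le> cmod s" using abs_Im_le_cmod[of s] by simp
    also have "\<dots> \<le> cmod (s - m) + cmod m" using norm_triangle_ineq[of "s - m" m] by simp
    finally show ?thesis using ap M(2) by simp
  qed
  have "\<exists>e. G i i * (- z - s + e) = 1 \<and> cmod e \<le> \<delta>" if "i < N" for i
    unfolding G_def s_def \<delta>_def by (rule diagonal_error_le[OF X N that ld phi b z ims[unfolded s_def]])
  then obtain e where e: "\<And>i. i < N \<Longrightarrow> G i i * (- z - s + e i) = 1" "\<And>i. i < N \<Longrightarrow> cmod (e i) \<le> \<delta>"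
    by metis
  \<comment> \<open>\<open>- z - m = 1 / m\<close> lies outside the unit disc, which keeps the denominators of all \<open>G i i\<close> away from \<open>0\<close>.\<close>
  have mz: "cmod (- z - m) \<ge> 1"
  proof -
    have "cmod m * cmod (- z - m) = 1" using M(1) by (metis norm_mult norm_one)
    then show ?thesis using M(2) mult_right_mono[of "cmod m" 1 "cmod (- z - m)"] by simp
  qed
  have low: "cmod (- z - s + e i) \<ge> 1 / 2" if "i < N" for i
  proof -
    have "cmod (- z - m) \<le> cmod (- z - s + e i) + cmod (s - m) + cmod (e i)"
    proof -
      have "- z - m = (- z - s + e i) + (s - m) - e i" by simp
      then have "cmod (- z - m) \<le> cmod ((- z - s + e i) + (s - m)) + cmod (e i)" by (metis norm_triangle_ineq4)
      then show ?thesis using norm_triangle_ineq[of "- z - s + e i" "s - m"] by linarith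
    qed
    then show ?thesis using mz ap e(2)[OF that] d by simp
  qed
  have prodn: "cmod (G i i) * cmod (- z - s + e i) = 1" if "i < N" for i using e(1)[OF that] by (metis norm_mult norm_one)
  have G2: "cmod (G i i) \<le> 2" if "i < N" for i
    using mult_left_mono[OF low[OF that], of "cmod (G i i)"] prodn[OF that] by simp
  have Gne: "cmod (G i i) > 0" if "i < N" for i using prodn[OF that] by (cases "G i i = 0") auto
  have "(s - m) * (s - 1 / m) = s * (s + z) + 1"
  proof -
    have f: "1 / m = - z - m" using M(1,6) by (simp add: field_simps)
    have "(s - m) * (s - 1 / m) = s * (s + z) + m * (- z - m)" unfolding f by (simp add: algebra_simps)
    then show ?thesis using M(1) by simp
  qed
  also have "\<dots> = (\<Sum>i<N. G i i * e i) / of_nat N"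
  proof -
    have "(\<Sum>i<N. G i i * e i) = (\<Sum>i<N. G i i * (s + z) + 1)"
      using e(1) by (intro sum.cong) (auto simp: algebra_simps add_eq_0_iff)
    also have "\<dots> = (\<Sum>i<N. G i i) * (s + z) + of_nat N" by (simp add: sum.distrib sum_distrib_right)
    also have "(\<Sum>i<N. G i i) = of_nat N * s" using N by (simp add: s_def avg_res_def G_def)
    finally show ?thesis using N by (simp add: field_simps)
  qed
  finally have eq: "(s - m) * (s - 1 / m) = (\<Sum>i<N. G i i * e i) / of_nat N" .
  have res: "cmod ((s - m) * (s - 1 / m)) \<le> 2 * \<delta>"
  proof -
    have "cmod (\<Sum>i<N. G i i * e i) \<le> (\<Sum>i<N. 2 * \<delta>)"
    proof (rule order_trans[OF norm_sum sum_mono])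
      fix i assume "i \<in> {..<N}"
      then show "cmod (G i i * e i) \<le> 2 * \<delta>"
        unfolding norm_mult using G2 e(2) by (intro mult_mono) auto
    qed
    then show ?thesis unfolding eq using N by (simp add: norm_divide divide_le_eq mult.commute)
  qed
  note st = quadratic_stability[OF _ res root_gap_eq[OF z(1), folded m_def, symmetric] ap2]
  show "cmod (s - m) \<le> 5 * sqrt (2 * \<delta>)" using st(1) dpos by simp
  show "(root_gap z)\<^sup>2 > 16 * (2 * \<delta>) \<Longrightarrow> cmod (s - m) \<le> 2 * (2 * \<delta>) / root_gap z" using st(2) dpos by simp
  show "cmod (G i i - m) \<le> 2 * (cmod (s - m) + \<delta>)" if i: "i < N" for i
  proof -
    have "G i i - m = G i i * (m * (- z - m)) - m * (G i i * (- z - s + e i))" using M(1) e(1)[OF i] by simp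
    also have "\<dots> = G i i * (m * (s - m - e i))" by (simp add: algebra_simps)
    finally have "cmod (G i i - m) = cmod (G i i) * (cmod m * cmod (s - m - e i))" by (simp add: norm_mult)
    also have "\<dots> \<le> 2 * (1 * (cmod (s - m) + \<delta>))"
      using G2[OF i] M(2) e(2)[OF i] norm_triangle_ineq4[of "s - m" "e i"] by (intro mult_mono) auto
    finally show ?thesis by simp
  qed
  show "cmod (G i j) \<le> 48 * \<delta>" if i: "i < N" and j: "j < N" "i \<noteq> j" and zb: "cmod z \<le> b" for i j
  proof -
    define x where "x = cmod (G i j)"
    have c: "1 / cmod (G i i) \<le> b + 2"
    proof -
      have "1 / cmod (G i i) = cmod (- z - s + e i)" using prodn[OF i] Gne[OF i] by (simp add: field_simps)
      also have "\<dots> \<le> cmod z + cmod s + cmod (e i)"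
        using norm_triangle_ineq[of "- z - s" "e i"] norm_triangle_ineq4[of "- z" s] by simp
      also have "cmod s \<le> cmod (s - m) + cmod m" using norm_triangle_ineq[of "s - m" m] by simp
      finally show ?thesis using zb ap M(2) e(2)[OF i] d by simp
    qed
    have x0: "x \<ge> 0" by (simp add: x_def)
    have "x \<le> cmod (G i i) * (6 * \<phi> * sqrt ((cmod (G j j) + x\<^sup>2 / cmod (G i i)) / (real N * Im z)))"
      unfolding x_def G_def using offdiagonal_bound[OF X z(1) N i j(1) _ ld] j(2) phi by auto
    also have "\<dots> = cmod (G i i) * (6 * \<phi> * (sqrt (cmod (G j j) + x\<^sup>2 * (1 / cmod (G i i))) * p))"
      by (simp add: p_def real_sqrt_divide)
    also have "\<dots> \<le> 2 * (6 * \<phi> * ((2 + sqrt (b + 2) * x) * p))"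
    proof (intro mult_mono mult_left_mono mult_right_mono G2 i)
      have "cmod (G j j) + x\<^sup>2 * (1 / cmod (G i i)) \<le> 2 + x\<^sup>2 * (b + 2)"
        using c G2[OF j(1)] by (intro add_mono mult_left_mono) auto
      also have "\<dots> \<le> (2 + sqrt (b + 2) * x)\<^sup>2"
        using b x0 by (simp add: power2_sum power_mult_distrib mult.commute)
      finally have "sqrt (cmod (G j j) + x\<^sup>2 * (1 / cmod (G i i))) \<le> sqrt ((2 + sqrt (b + 2) * x)\<^sup>2)" by (rule real_sqrt_le_mono)
      then show "sqrt (cmod (G j j) + x\<^sup>2 * (1 / cmod (G i i))) \<le> 2 + sqrt (b + 2) * x" using b x0 by simp
    qed (use phi p0 b x0 in auto)
    also have "\<dots> = 24 * (\<phi> * p) + (12 * (\<phi> * p) * sqrt (b + 2)) * x" by (simp add: algebra_simps)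
    finally have main: "x \<le> 24 * (\<phi> * p) + (12 * (\<phi> * p) * sqrt (b + 2)) * x" .
    have php: "\<phi> * p \<le> \<phi>\<^sup>2 * p" using phi p0 by (simp add: power2_eq_square)
    \<comment> \<open>This and \<open>\<delta> \<le> 1 / 4\<close> make the coefficient of \<open>x\<close> in \<open>main\<close> at most \<open>1 / 2\<close>.\<close>
    have sb: "12 * sqrt (b + 2) \<le> b + 109"
    proof -
      have "0 \<le> (sqrt (b + 2) - 6)\<^sup>2" by simp
      then show ?thesis using b by (simp add: power2_diff)
    qed
    have "12 * (\<phi> * p) * sqrt (b + 2) \<le> (12 * sqrt (b + 2)) * (\<phi>\<^sup>2 * p)"
      using mult_left_mono[OF php, of "12 * sqrt (b + 2)"] b by (simp add: mult_ac)
    also have "\<dots> \<le> (b + 109) * (\<phi>\<^sup>2 * p)" using p0 by (intro mult_right_mono sb) auto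
    finally have "12 * (\<phi> * p) * sqrt (b + 2) \<le> 1 / 2" using d unfolding dp by (simp add: mult_ac)
    from mult_right_mono[OF this x0] main have "x \<le> 48 * (\<phi> * p)" by simp
    also have "\<dots> \<le> 48 * \<delta>"
    proof -
      have "1 * (\<phi>\<^sup>2 * p) \<le> (b + 109) * (\<phi>\<^sup>2 * p)" using b p0 by (intro mult_right_mono) auto
      also have "\<dots> = \<delta>" unfolding dp by (rule mult.assoc[symmetric])
      finally show ?thesis using php by linarith
    qed
    finally show ?thesis by (simp add: x_def)
  qed
qed

text \<open>Mesh \<open>N powr (- 3)\<close>: the resolvent is Lipschitz with constant at most \<open>N\<^sup>2\<close> where
  \<open>Im z \<ge> 1 / N\<close>, so it changes by at most \<open>1 / N\<close> between neighbours.\<close>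

definition grid_point :: "nat \<Rightarrow> complex \<Rightarrow> nat \<Rightarrow> complex" where
  "grid_point N z k = z + \<i> * of_real (real k / real N ^ 3)"

lemma grid_point_simps [simp]:
  "Re (grid_point N z k) = Re z" "Im (grid_point N z k) = Im z + real k / real N ^ 3"
  by (simp_all add: grid_point_def)

lemma avg_res_Lipschitz:
  assumes "sym_on N A" "N \<ge> 1" "Im z > 0" "Im w > 0"
  shows "cmod (avg_res N A z - avg_res N A w) \<le> cmod (z - w) / (Im z * Im w)"
proof -
  have "avg_res N A z - avg_res N A w = (\<Sum>i<N. green N A z i i - green N A w i i) / of_nat N"
    by (simp add: avg_res_def sum_subtractf diff_divide_distrib)
  then have "cmod (avg_res N A z - avg_res N A w) \<le> (\<Sum>i<N. cmod (z - w) / (Im z * Im w)) / real N"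
    using assms by (simp only: norm_divide norm_of_nat)
      (intro divide_right_mono order_trans[OF norm_sum sum_mono] green_Lipschitz, auto)
  then show ?thesis using assms(2) by simp
qed

text \<open>Descending induction on the grid. At the top \<open>\<bar>s\<bar>\<close> and \<open>\<bar>m\<bar>\<close> are at most \<open>1 / 16\<close> while the root gap is
  at least \<open>4\<close>. In a step downwards the gap decreases and \<open>\<delta>\<close> increases, so if
  the roots are well separated at the lower point, they were so at the upper one; the bound
  \<open>2 * r / d \<le> d / 8\<close> there survives a perturbation of size \<open>2 / N\<close>.\<close>

lemma bootstrap:
  fixes \<phi> b :: real and z :: complex
  assumes X: "sign_matrix N X" and N: "N \<ge> 16" and phi: "\<phi> \<ge> 1" and b: "b \<ge> 1"
    and z: "Im z > 0" "real N * Im z \<ge> 1"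
    and n: "Im (grid_point N z n) \<ge> 16" "Im (grid_point N z n) \<le> b\<^sup>2"
    and ld: "\<And>k. k \<le> n \<Longrightarrow> large_deviation_bounds \<phi> N X (grid_point N z k)"
  defines "\<delta> \<equiv> \<lambda>z. (b + 109) * \<phi>\<^sup>2 * control N z"
    and "u \<equiv> \<lambda>z. cmod (avg_res N (wigner N X) z - stieltjes semicircle z)"
  assumes small: "\<delta> z \<le> 1 / 3200"
  shows "u z \<le> 1 / 4" "(root_gap z)\<^sup>2 > 16 * (2 * \<delta> z) \<Longrightarrow> u z \<le> root_gap z / 2"
proof -
  let ?g = "grid_point N z"
  have Ng: "real N * Im (?g k) \<ge> 1" for k
  proof -
    have "real N * Im z \<le> real N * Im (?g k)" by (intro mult_left_mono) auto
    then show ?thesis using z(2) by linarith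
  qed
  have gpos: "Im (?g k) > 0" for k using z(1) by (simp add: add_pos_nonneg)
  have mono: "Im (?g k) \<le> Im (?g l)" if "k \<le> l" for k l using that by (simp add: divide_right_mono)
  have Kpos: "(b + 109) * \<phi>\<^sup>2 > 0" using b phi by (intro mult_pos_pos) auto
  have dmono: "\<delta> (?g l) \<le> \<delta> (?g k)" if "k \<le> l" for k l
  proof -
    have "sqrt (real N * Im (?g k)) \<le> sqrt (real N * Im (?g l))"
      using mono[OF that] by (intro real_sqrt_le_mono mult_left_mono) auto
    moreover have "sqrt (real N * Im (?g k)) > 0" using Ng[of k] by simp
    ultimately show ?thesis unfolding \<delta>_def using Kpos by (intro mult_left_mono divide_left_mono mult_pos_pos) auto
  qed
  have g0: "?g 0 = z" by (simp add: grid_point_def)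
  have dsmall: "\<delta> (?g k) \<le> 1 / 3200" for k using dmono[of 0 k] small unfolding g0 by simp
  have d0: "\<delta> (?g k) > 0" for k unfolding \<delta>_def using Kpos Ng[of k] by (simp del: grid_point_simps)
  define P where "P = (\<lambda>k. u (?g k) \<le> 1 / 4 \<and> ((root_gap (?g k))\<^sup>2 > 16 * (2 * \<delta> (?g k)) \<longrightarrow> u (?g k) \<le> root_gap (?g k) / 2))"
  have "P 0"
  proof (rule inc_induct[of 0 n])
    show "P n"
    proof -
      note S = sym_on_wigner[OF X]
      have N1: "N \<ge> 1" using N by simp
      have "cmod (avg_res N (wigner N X) (?g n)) \<le> 1 / Im (?g n)"
      proof -
        have "cmod (\<Sum>i<N. green N (wigner N X) (?g n) i i) \<le> (\<Sum>i<N. 1 / Im (?g n))"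
          by (intro order_trans[OF norm_sum sum_mono] norm_green_diag_le S gpos) auto
        then show ?thesis unfolding avg_res_def using N1 by (simp add: norm_divide divide_le_eq mult.commute del: grid_point_simps)
      qed
      moreover have "cmod (stieltjes semicircle (?g n)) \<le> 1 / Im (?g n)" by (rule semicircle_transform(4)[OF gpos])
      moreover have "1 / Im (?g n) \<le> 1 / 16" using n(1) by (intro divide_left_mono) (auto simp del: grid_point_simps)
      ultimately have u8: "u (?g n) \<le> 1 / 8" unfolding u_def
        using norm_triangle_ineq4[of "avg_res N (wigner N X) (?g n)" "stieltjes semicircle (?g n)"] by linarith
      have "4\<^sup>2 \<le> (root_gap (?g n))\<^sup>2" using root_gap_ge[OF gpos[of n]] n(1) by (simp del: grid_point_simps)
      then have "root_gap (?g n) \<ge> 4" by (rule power2_le_imp_le) (simp add: root_gap_def)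
      then show ?thesis using u8 unfolding P_def by simp
    qed
  next
    fix k assume k: "k < n" and IH: "P (Suc k)"
    have N1: "N \<ge> 1" using N by simp
    have kn: "Suc k \<le> n" using k by simp
    let ?w = "?g (Suc k)" and ?v = "?g k"
    have wb: "Im ?w \<le> b\<^sup>2" using mono[OF kn] n(2) by linarith
    have step: "u ?w \<le> 5 * sqrt (2 * \<delta> ?w)" "(root_gap ?w)\<^sup>2 > 16 * (2 * \<delta> ?w) \<Longrightarrow> u ?w \<le> 2 * (2 * \<delta> ?w) / root_gap ?w"
    proof -
      have d4: "\<delta> ?w \<le> 1 / 4" by (rule order_trans[OF dsmall]) simp
      have u4: "u ?w \<le> 1 / 4" and u2: "(root_gap ?w)\<^sup>2 > 16 * (2 * \<delta> ?w) \<Longrightarrow> u ?w \<le> root_gap ?w / 2"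
        using IH unfolding P_def by blast+
      note st = local_law_step[OF X N1 ld[OF kn] phi b gpos wb Ng d4[unfolded \<delta>_def] u4[unfolded u_def] u2[unfolded u_def \<delta>_def]]
      show "u ?w \<le> 5 * sqrt (2 * \<delta> ?w)" unfolding u_def \<delta>_def by (rule st(1))
      show "u ?w \<le> 2 * (2 * \<delta> ?w) / root_gap ?w" if "(root_gap ?w)\<^sup>2 > 16 * (2 * \<delta> ?w)"
        unfolding u_def \<delta>_def by (rule st(2); rule that[unfolded \<delta>_def])
    qed
    have dist: "cmod (?v - ?w) = 1 / real N ^ 3"
    proof -
      have "?v - ?w = - \<i> * of_real (1 / real N ^ 3)"
        by (simp add: grid_point_def add_divide_distrib algebra_simps)
      then show ?thesis by (simp add: norm_mult norm_divide norm_power)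
    qed
    have in1: "Im ?v \<ge> 1 / real N" "Im ?w \<ge> 1 / real N"
      using Ng[of k] Ng[of "Suc k"] N1 by (simp_all add: divide_le_eq mult.commute del: grid_point_simps)
    have NN: "real N > 0" using N1 by simp
    have lip1: "cmod (avg_res N (wigner N X) ?v - avg_res N (wigner N X) ?w) \<le> 1 / real N"
    proof -
      have "cmod (avg_res N (wigner N X) ?v - avg_res N (wigner N X) ?w) \<le> cmod (?v - ?w) / (Im ?v * Im ?w)"
        by (rule avg_res_Lipschitz[OF sym_on_wigner[OF X] N1 gpos gpos])
      also have "\<dots> \<le> cmod (?v - ?w) / (1 / real N * (1 / real N))"
        using in1 NN by (intro divide_left_mono mult_mono mult_pos_pos gpos) (auto intro: less_imp_le[OF gpos] simp del: grid_point_simps)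
      also have "\<dots> = 1 / real N" unfolding dist using NN by (simp add: field_simps power3_eq_cube)
      finally show ?thesis .
    qed
    have lip2: "cmod (stieltjes semicircle ?v - stieltjes semicircle ?w) \<le> 1 / real N"
    proof -
      have "cmod (stieltjes semicircle ?v - stieltjes semicircle ?w) \<le> cmod (?v - ?w) / (1 / real N)"
        using in1 NN by (intro semicircle_Lipschitz) auto
      also have "\<dots> = 1 / real N ^ 2" unfolding dist using NN by (simp add: field_simps power3_eq_cube power2_eq_square)
      also have "\<dots> \<le> 1 / real N" using N1 NN by (intro divide_left_mono) (auto simp: power2_eq_square)
      finally show ?thesis .
    qed
    have uv: "u ?v \<le> u ?w + 2 / real N"
    proof -
      have "avg_res N (wigner N X) ?v - stieltjes semicircle ?v = (avg_res N (wigner N X) ?w - stieltjes semicircle ?w)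
          + (avg_res N (wigner N X) ?v - avg_res N (wigner N X) ?w) - (stieltjes semicircle ?v - stieltjes semicircle ?w)" by simp
      then have "u ?v \<le> u ?w + cmod (avg_res N (wigner N X) ?v - avg_res N (wigner N X) ?w) + cmod (stieltjes semicircle ?v - stieltjes semicircle ?w)"
        unfolding u_def by (metis (no_types, lifting) norm_triangle_ineq norm_triangle_ineq4 add_right_mono order_trans)
      then show ?thesis using lip1 lip2 by simp
    qed
    have N8: "2 / real N \<le> 1 / 8" using N by (simp add: divide_le_eq)
    have A: "u ?v \<le> 1 / 4"
    proof -
      have "sqrt (2 * \<delta> ?w) \<le> sqrt ((1 / 40)\<^sup>2)" using dsmall[of "Suc k"] by (intro real_sqrt_le_mono) (simp add: power2_eq_square)
      then have "5 * sqrt (2 * \<delta> ?w) \<le> 1 / 8" by simp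
      then show ?thesis using step(1) uv N8 by linarith
    qed
    have B: "u ?v \<le> root_gap ?v / 2" if big: "(root_gap ?v)\<^sup>2 > 16 * (2 * \<delta> ?v)"
    proof -
      let ?d = "root_gap ?v" and ?r = "2 * \<delta> ?v"
      have d00: "?d \<ge> 0" by (simp add: root_gap_def)
      have r0: "?r > 0" using d0[of k] by simp
      have dw: "?d \<le> root_gap ?w" by (rule root_gap_mono) (use gpos[of k] mono[of k "Suc k"] in simp_all)
      have rw: "2 * \<delta> ?w \<le> ?r" using dmono[of k "Suc k"] by simp
      have dpos: "?d > 0" using big r0 d00 by (cases "?d = 0") auto
      have "16 * (2 * \<delta> ?w) < (root_gap ?w)\<^sup>2"
        using big rw power_mono[OF dw d00, of 2] by linarith
      then have "u ?w \<le> 2 * (2 * \<delta> ?w) / root_gap ?w" by (rule step(2))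
      also have "\<dots> \<le> 2 * ?r / ?d"
        using rw dw dpos r0 by (intro frac_le) auto
      also have "\<dots> \<le> ?d / 8"
        using big dpos by (simp add: divide_le_eq power2_eq_square)
      finally have 1: "u ?w \<le> ?d / 8" .
      \<comment> \<open>The gap exceeds the Lipschitz error, because \<open>?d\<^sup>2 > 16 * ?r\<close> and \<open>?r\<close> is at least \<open>1 / N\<close>.\<close>
      have "2 / real N \<le> ?d / 4"
      proof -
        have "1 \<le> ?r * real N"
        proof -
          have "sqrt (real N * Im ?v) \<le> sqrt (real N * b\<^sup>2)"
            using mono[of k n] k n(2) by (intro real_sqrt_le_mono mult_left_mono) (auto simp del: grid_point_simps)
          also have "\<dots> = b * sqrt (real N)" using b by (simp add: real_sqrt_mult)
          also have "\<dots> \<le> (b + 109) * \<phi>\<^sup>2 * real N"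
          proof (intro mult_mono)
            show "b \<le> (b + 109) * \<phi>\<^sup>2" using b phi mult_mono[of b "b + 109" 1 "\<phi>\<^sup>2"] by simp
            show "sqrt (real N) \<le> real N" using N1 by (intro real_le_lsqrt) (auto simp: power2_eq_square)
          qed (use b in auto)
          finally have "1 \<le> (b + 109) * \<phi>\<^sup>2 * real N / sqrt (real N * Im ?v)"
            using Ng[of k] by (simp add: le_divide_eq del: grid_point_simps)
          also have "\<dots> = \<delta> ?v * real N" by (simp add: \<delta>_def)
          also have "\<dots> \<le> ?r * real N" using r0 by (intro mult_right_mono) auto
          finally show ?thesis .
        qed
        then have "1 / real N \<le> ?r" using NN by (simp add: divide_le_eq)
        then have "16 * (1 / real N) \<le> ?d\<^sup>2" using big by simp
        moreover have "64 * (1 / real N)\<^sup>2 \<le> 16 * (1 / real N)" 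
          using N NN by (simp add: power2_eq_square field_simps)
        ultimately have "(8 * (1 / real N))\<^sup>2 \<le> ?d\<^sup>2" by (simp only: power_mult_distrib) simp
        then have "8 * (1 / real N) \<le> ?d" using d00 by (rule power2_le_imp_le)
        then show ?thesis by simp
      qed
      then show ?thesis using 1 uv d00 by linarith
    qed
    show "P k" using A B unfolding P_def by blast
  qed simp
  then show "u z \<le> 1 / 4" "(root_gap z)\<^sup>2 > 16 * (2 * \<delta> z) \<Longrightarrow> u z \<le> root_gap z / 2"
    unfolding P_def g0 by auto
qed

text \<open>Both regimes of \<open>quadratic_stability\<close> combine into the single scale of the local law.\<close>

lemma stability_scale:
  assumes "r > 0" "u \<le> 5 * sqrt r" "d\<^sup>2 > 16 * r \<Longrightarrow> u \<le> 2 * r / d" "x \<le> d\<^sup>2" "x > 0" "d \<ge> 0"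
  shows "u \<le> 25 * r / sqrt (x + r)"
proof (cases "d\<^sup>2 > 16 * r")
  case True
  have d: "d > 0" using True assms(1,6) by (cases "d = 0") auto
  have s: "sqrt (x + r) \<le> 2 * d" using True assms d by (intro real_le_lsqrt) (auto simp: power_mult_distrib)
  have "2 * r / d = 4 * r / (2 * d)" using d by simp
  also have "\<dots> \<le> 25 * r / sqrt (x + r)" using s assms by (intro frac_le) auto
  finally show ?thesis using assms(3)[OF True] by simp
next
  case False
  have "sqrt (x + r) \<le> sqrt (25 * r)" using False assms by (intro real_sqrt_le_mono) auto
  then have s: "sqrt (x + r) \<le> 5 * sqrt r" by (simp add: real_sqrt_mult)
  have "5 * sqrt r = 25 * (sqrt r * sqrt r) / (5 * sqrt r)" using assms(1) by (simp add: field_simps)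
  also have "\<dots> = 25 * r / (5 * sqrt r)" using assms(1) by simp
  also have "\<dots> \<le> 25 * r / sqrt (x + r)" using s assms by (intro frac_le) auto
  finally show ?thesis using assms(2) by simp
qed

lemma deterministic_local_law:
  fixes \<phi> b :: real and z :: complex
  assumes X: "sign_matrix N X" and N: "N \<ge> 16" and phi: "\<phi> \<ge> 1" and b: "b \<ge> 1"
    and z: "Im z > 0" "real N * Im z \<ge> 1" "cmod z \<le> b"
    and n: "Im (grid_point N z n) \<ge> 16" "Im (grid_point N z n) \<le> b\<^sup>2"
    and ld: "\<And>k. k \<le> n \<Longrightarrow> large_deviation_bounds \<phi> N X (grid_point N z k)"
  defines "\<delta> \<equiv> (b + 109) * \<phi>\<^sup>2 * control N z"
    and "m \<equiv> stieltjes semicircle z" and "x \<equiv> edge_dist z"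
  assumes small: "\<delta> \<le> 1 / 3200"
  shows "cmod (avg_res N (wigner N X) z - m) \<le> 150 * \<delta> / sqrt (x + \<delta>) + 48 * \<delta>"
    and "\<And>i j. i < N \<Longrightarrow> j < N \<Longrightarrow> cmod (green N (wigner N X) z i j - (if i = j then m else 0)) \<le> 150 * \<delta> / sqrt (x + \<delta>) + 48 * \<delta>"
proof -
  let ?u = "cmod (avg_res N (wigner N X) z - m)"
  have N1: "N \<ge> 1" using N by simp
  have g0: "grid_point N z 0 = z" by (simp add: grid_point_def)
  have ld0: "large_deviation_bounds \<phi> N X z" using ld[of 0] unfolding g0 by simp
  have dpos: "\<delta> > 0" unfolding \<delta>_def using b phi z N1 by (intro mult_pos_pos) auto
  have zb: "Im z \<le> b\<^sup>2" using n(2) by (simp add: order_trans[rotated])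
  have d4: "\<delta> \<le> 1 / 4" using small by simp
  have bs1: "?u \<le> 1 / 4" unfolding m_def
    by (rule bootstrap(1)[OF X N phi b z(1,2) n _ small[unfolded \<delta>_def]]) (rule ld)
  have bs2: "?u \<le> root_gap z / 2" if "(root_gap z)\<^sup>2 > 16 * (2 * \<delta>)"
    using that unfolding m_def \<delta>_def
    by (intro bootstrap(2)[OF X N phi b z(1,2) n _ small[unfolded \<delta>_def]]) (rule ld)
  note st = local_law_step[OF X N1 ld0 phi b z(1) zb z(2) d4[unfolded \<delta>_def], folded \<delta>_def m_def, OF bs1 bs2]
  have x: "x > 0" using z(1) by (simp add: x_def add_nonneg_pos)
  have "?u \<le> 25 * (2 * \<delta>) / sqrt (x + 2 * \<delta>)"
  proof (rule stability_scale[where d = "root_gap z"])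
    show "?u \<le> 5 * sqrt (2 * \<delta>)" by (rule st(1))
    show "?u \<le> 2 * (2 * \<delta>) / root_gap z" if "(root_gap z)\<^sup>2 > 16 * (2 * \<delta>)" by (rule st(2); rule that)
    show "x \<le> (root_gap z)\<^sup>2" using root_gap_ge[OF z(1)] by (simp add: x_def)
  qed (use dpos x in \<open>simp_all add: root_gap_def\<close>)
  also have "\<dots> \<le> 50 * \<delta> / sqrt (x + \<delta>)" using dpos x by (intro frac_le) auto
  finally have u: "?u \<le> 50 * \<delta> / sqrt (x + \<delta>)" .
  have nn: "0 \<le> \<delta> / sqrt (x + \<delta>)" using dpos x by simp
  show "?u \<le> 150 * \<delta> / sqrt (x + \<delta>) + 48 * \<delta>" using u nn dpos by simp
  show "cmod (green N (wigner N X) z i j - (if i = j then m else 0)) \<le> 150 * \<delta> / sqrt (x + \<delta>) + 48 * \<delta>"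
    if "i < N" "j < N" for i j
  proof (cases "i = j")
    case True
    have "cmod (green N (wigner N X) z i i - m) \<le> 2 * (?u + \<delta>)" by (rule st(3), assumption, fact)
    then show ?thesis using True u nn dpos by simp
  next
    case False
    have "cmod (green N (wigner N X) z i j) \<le> 48 * \<delta>" by (rule st(4), assumption, fact+)
    then show ?thesis using False nn dpos by simp
  qed
qed

section \<open>Large deviations for independent biased signs\<close>

definition sign_pmf :: "real \<Rightarrow> real pmf" where
  "sign_pmf m = map_pmf (\<lambda>b. if b then 1 else -1) (bernoulli_pmf ((1 + m) / 2))"

abbreviation sign_field :: "'i set \<Rightarrow> real \<Rightarrow> ('i \<Rightarrow> real) pmf" where
  "sign_field J m \<equiv> Pi_pmf J undefined (\<lambda>_. sign_pmf m)"

lemma nn_integral_sign_pmf: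
  assumes "\<bar>m\<bar> \<le> 1" "\<And>x. f x \<ge> 0"
  shows "(\<integral>\<^sup>+x. ennreal (f x) \<partial>sign_pmf m) = ennreal ((1 + m) / 2 * f 1 + (1 - m) / 2 * f (-1))"
proof -
  have m: "0 \<le> (1 + m) / 2" "(1 + m) / 2 \<le> 1" using assms by auto
  have "(\<integral>\<^sup>+x. ennreal (f x) \<partial>sign_pmf m) = (\<integral>\<^sup>+b. ennreal (f (if b then 1 else -1)) \<partial>bernoulli_pmf ((1 + m) / 2))"
    by (simp add: sign_pmf_def)
  also have "\<dots> = ennreal (f 1) * ennreal ((1 + m) / 2) + ennreal (f (-1)) * ennreal (1 - (1 + m) / 2)"
    using nn_integral_bernoulli_pmf[OF m, of "\<lambda>b. f (if b then 1 else -1)"] assms by simp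
  also have "\<dots> = ennreal (f 1 * ((1 + m) / 2) + f (-1) * (1 - (1 + m) / 2))"
  proof -
    have "ennreal (f 1 * ((1 + m) / 2)) = ennreal (f 1) * ennreal ((1 + m) / 2)"
      by (rule ennreal_mult) (use assms m in auto)
    moreover have "ennreal (f (-1) * (1 - (1 + m) / 2)) = ennreal (f (-1)) * ennreal (1 - (1 + m) / 2)"
      by (rule ennreal_mult) (use assms m in auto)
    moreover have "0 \<le> f 1 * ((1 + m) / 2)" "0 \<le> f (-1) * (1 - (1 + m) / 2)"
      using assms m by (auto intro!: mult_nonneg_nonneg)
    ultimately show ?thesis by (metis ennreal_plus)
  qed
  also have "f 1 * ((1 + m) / 2) + f (-1) * (1 - (1 + m) / 2) = (1 + m) / 2 * f 1 + (1 - m) / 2 * f (-1)"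
    by (simp add: field_simps)
  finally show ?thesis .
qed

text \<open>Resampling one coordinate preserves a product distribution; the inner integral is the conditional
  expectation given all other coordinates.\<close>

lemma nn_integral_Pi_pmf_resample:
  assumes "finite J" "j \<in> J"
  shows "(\<integral>\<^sup>+y. f y \<partial>Pi_pmf J d p) = (\<integral>\<^sup>+y. (\<integral>\<^sup>+x. f (y(j := x)) \<partial>p j) \<partial>Pi_pmf J d p)"
proof -
  let ?Q = "Pi_pmf (J - {j}) d p"
  have J: "Pi_pmf J d p = map_pmf (\<lambda>(x, y). y(j := x)) (pair_pmf (p j) ?Q)"
    using Pi_pmf_insert[of "J - {j}" j d p] assms by (simp add: insert_absorb)
  have J': "Pi_pmf J d p = map_pmf (\<lambda>(y, x). y(j := x)) (pair_pmf ?Q (p j))"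
    unfolding J by (subst pair_commute_pmf) (simp add: pmf.map_comp o_def case_prod_unfold)
  have "(\<integral>\<^sup>+y. (\<integral>\<^sup>+x. f (y(j := x)) \<partial>p j) \<partial>Pi_pmf J d p)
      = (\<integral>\<^sup>+x'. (\<integral>\<^sup>+y. (\<integral>\<^sup>+x. f (y(j := x)) \<partial>p j) \<partial>?Q) \<partial>p j)"
    unfolding J by (simp add: nn_integral_pair_pmf')
  also have "\<dots> = (\<integral>\<^sup>+y. (\<integral>\<^sup>+x. f (y(j := x)) \<partial>p j) \<partial>?Q)"
    by simp
  also have "\<dots> = (\<integral>\<^sup>+y. f y \<partial>Pi_pmf J d p)"
    unfolding J' by (simp add: nn_integral_pair_pmf')
  finally show ?thesis by simp
qed

lemma tanh_le_self: "x \<ge> 0 \<Longrightarrow> tanh x \<le> (x::real)"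
proof -
  assume x: "x \<ge> 0"
  have "(\<lambda>x. x - tanh x) 0 \<le> (\<lambda>x. x - tanh x) x"
  proof (rule DERIV_nonneg_imp_nondecreasing[OF x])
    fix t :: real
    show "\<exists>y. ((\<lambda>x. x - tanh x) has_real_derivative y) (at t) \<and> 0 \<le> y"
      by (intro exI[of _ "(tanh t)^2"]) (auto intro!: derivative_eq_intros)
  qed
  then show ?thesis by simp
qed

lemma cosh_le_exp: "cosh (x::real) \<le> exp (x\<^sup>2 / 2)"
proof -
  have *: "ln (cosh x) \<le> x\<^sup>2 / 2" if x: "x \<ge> 0" for x :: real
  proof -
    have "(\<lambda>x. x\<^sup>2 / 2 - ln (cosh x)) 0 \<le> (\<lambda>x. x\<^sup>2 / 2 - ln (cosh x)) x"
    proof (rule DERIV_nonneg_imp_nondecreasing[OF x])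
      fix t :: real assume "0 \<le> t"
      then show "\<exists>y. ((\<lambda>x. x\<^sup>2 / 2 - ln (cosh x)) has_real_derivative y) (at t) \<and> 0 \<le> y"
        using tanh_le_self[of t] by (intro exI[of _ "t - tanh t"]) (auto intro!: derivative_eq_intros simp: tanh_def cosh_real_pos)
    qed
    then show ?thesis by simp
  qed
  have "ln (cosh x) \<le> x\<^sup>2 / 2" using *[of x] *[of "-x"] by (cases "x \<ge> 0") auto
  then show ?thesis by (metis cosh_real_pos exp_le_cancel_iff exp_ln)
qed

text \<open>The moment generating function of a sign of mean \<open>m\<close>, from \<open>cosh c \<le> exp (c\<^sup>2 / 2)\<close> and
  \<open>\<bar>tanh c\<bar> \<le> \<bar>c\<bar>\<close>.\<close>

lemma biased_cosh_le:
  assumes "\<bar>m\<bar> \<le> (1::real)"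
  shows "(1 + m) / 2 * exp c + (1 - m) / 2 * exp (- c) \<le> exp (c\<^sup>2 / 2 + \<bar>m\<bar> * \<bar>c\<bar>)"
proof -
  have s: "\<bar>sinh c\<bar> \<le> \<bar>c\<bar> * cosh c"
  proof -
    have "tanh \<bar>c\<bar> \<le> \<bar>c\<bar>" by (rule tanh_le_self) simp
    then have "sinh \<bar>c\<bar> \<le> \<bar>c\<bar> * cosh \<bar>c\<bar>" by (simp add: tanh_def field_simps cosh_real_pos)
    then show ?thesis by (cases "c \<ge> 0") auto
  qed
  have "(1 + m) / 2 * exp c + (1 - m) / 2 * exp (- c) = cosh c + m * sinh c"
    by (simp add: cosh_def sinh_def field_simps)
  also have "m * sinh c \<le> \<bar>m\<bar> * \<bar>sinh c\<bar>" by (metis abs_ge_self abs_mult)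
  also have "\<dots> \<le> \<bar>m\<bar> * (\<bar>c\<bar> * cosh c)" by (intro mult_left_mono s) auto
  also have "cosh c + \<bar>m\<bar> * (\<bar>c\<bar> * cosh c) = cosh c * (1 + \<bar>m\<bar> * \<bar>c\<bar>)" by (simp add: algebra_simps)
  also have "\<dots> \<le> exp (c\<^sup>2 / 2) * exp (\<bar>m\<bar> * \<bar>c\<bar>)"
    by (intro mult_mono cosh_le_exp exp_ge_add_one_self) auto
  finally show ?thesis by (simp add: exp_add)
qed

text \<open>The signs are revealed in the order \<open>h 0, h 1, \<dots>\<close>, and \<open>L k\<close> is predictable: it depends on none of
  the coordinates \<open>h l\<close> with \<open>l \<ge> k\<close>, but may depend on anything else, in particular on signs outside the
  range of \<open>h\<close>. Integrating out the last sign costs a factor at most \<open>1\<close> by \<open>biased_cosh_le\<close>.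
  The compensator is random, which is what admits random coefficients.\<close>

lemma exponential_supermartingale:
  fixes L :: "nat \<Rightarrow> ('i \<Rightarrow> real) \<Rightarrow> real"
  assumes "finite J" "\<bar>m\<bar> \<le> 1" "inj_on h {..<n}" "h ` {..<n} \<subseteq> J"
    and "\<And>k l y x. k \<le> l \<Longrightarrow> l < n \<Longrightarrow> L k (y(h l := x)) = L k y"
  shows "(\<integral>\<^sup>+y. ennreal (exp (\<Sum>k<n. y (h k) * L k y - (L k y)\<^sup>2 / 2 - \<bar>m\<bar> * \<bar>L k y\<bar>)) \<partial>sign_field J m) \<le> 1"
  using assms(3-5)
proof (induction n)
  case 0
  then show ?case by (simp add: measure_pmf.emeasure_space_1)
next
  case (Suc n)
  let ?P = "sign_field J m"
  let ?t = "\<lambda>k y. y (h k) * L k y - (L k y)\<^sup>2 / 2 - \<bar>m\<bar> * \<bar>L k y\<bar>"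
  have "(\<integral>\<^sup>+y. ennreal (exp (\<Sum>k<Suc n. ?t k y)) \<partial>?P)
      = (\<integral>\<^sup>+y. (\<integral>\<^sup>+x. ennreal (exp (\<Sum>k<Suc n. ?t k (y(h n := x)))) \<partial>sign_pmf m) \<partial>?P)"
    by (rule nn_integral_Pi_pmf_resample[OF assms(1)]) (use Suc.prems in auto)
  also have "\<dots> \<le> (\<integral>\<^sup>+y. ennreal (exp (\<Sum>k<n. ?t k y)) \<partial>?P)"
  proof (rule nn_integral_mono)
    fix y
    have eq: "(\<Sum>k<Suc n. ?t k (y(h n := x))) = (\<Sum>k<n. ?t k y) + (x * L n y - (L n y)\<^sup>2 / 2 - \<bar>m\<bar> * \<bar>L n y\<bar>)" for x
    proof -
      have "(\<Sum>k<n. ?t k (y(h n := x))) = (\<Sum>k<n. ?t k y)"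
      proof (rule sum.cong[OF refl])
        fix k assume k: "k \<in> {..<n}"
        then have "h k \<noteq> h n" using Suc.prems(1) by (auto simp: inj_on_def)
        then show "?t k (y(h n := x)) = ?t k y" using k by (simp add: Suc.prems(3))
      qed
      then show ?thesis by (simp add: Suc.prems(3))
    qed
    have "(\<integral>\<^sup>+x. ennreal (exp (\<Sum>k<Suc n. ?t k (y(h n := x)))) \<partial>sign_pmf m)
       = (\<integral>\<^sup>+x. ennreal (exp (\<Sum>k<n. ?t k y) * exp (x * L n y - (L n y)\<^sup>2 / 2 - \<bar>m\<bar> * \<bar>L n y\<bar>)) \<partial>sign_pmf m)"
      unfolding eq exp_add ..
    also have "\<dots> = ennreal ((1 + m) / 2 * (exp (\<Sum>k<n. ?t k y) * exp (1 * L n y - (L n y)\<^sup>2 / 2 - \<bar>m\<bar> * \<bar>L n y\<bar>))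
         + (1 - m) / 2 * (exp (\<Sum>k<n. ?t k y) * exp (-1 * L n y - (L n y)\<^sup>2 / 2 - \<bar>m\<bar> * \<bar>L n y\<bar>)))"
      by (rule nn_integral_sign_pmf[OF assms(2)]) simp
    also have "\<dots> \<le> ennreal (exp (\<Sum>k<n. ?t k y))"
    proof (rule ennreal_leI)
      have "(1 + m) / 2 * (exp (\<Sum>k<n. ?t k y) * exp (1 * L n y - (L n y)\<^sup>2 / 2 - \<bar>m\<bar> * \<bar>L n y\<bar>))
         + (1 - m) / 2 * (exp (\<Sum>k<n. ?t k y) * exp (-1 * L n y - (L n y)\<^sup>2 / 2 - \<bar>m\<bar> * \<bar>L n y\<bar>))
        = exp (\<Sum>k<n. ?t k y) * (((1 + m) / 2 * exp (L n y) + (1 - m) / 2 * exp (- L n y)) * exp (- ((L n y)\<^sup>2 / 2 + \<bar>m\<bar> * \<bar>L n y\<bar>)))"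
      proof -
        have e: "exp (1 * l - q - r) = exp l * exp (- (q + r))" "exp (-1 * l - q - r) = exp (- l) * exp (- (q + r))" for l q r :: real
          by (simp_all flip: exp_add)
        show ?thesis unfolding e by (simp only: algebra_simps)
      qed
      also have "\<dots> \<le> exp (\<Sum>k<n. ?t k y) * (exp ((L n y)\<^sup>2 / 2 + \<bar>m\<bar> * \<bar>L n y\<bar>) * exp (- ((L n y)\<^sup>2 / 2 + \<bar>m\<bar> * \<bar>L n y\<bar>)))"
        by (intro mult_left_mono mult_right_mono biased_cosh_le assms(2)) auto
      also have "\<dots> = exp (\<Sum>k<n. ?t k y)" by (simp flip: exp_add)
      finally show "(1 + m) / 2 * (exp (\<Sum>k<n. ?t k y) * exp (1 * L n y - (L n y)\<^sup>2 / 2 - \<bar>m\<bar> * \<bar>L n y\<bar>))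
         + (1 - m) / 2 * (exp (\<Sum>k<n. ?t k y) * exp (-1 * L n y - (L n y)\<^sup>2 / 2 - \<bar>m\<bar> * \<bar>L n y\<bar>)) \<le> exp (\<Sum>k<n. ?t k y)" .
    qed
    finally show "(\<integral>\<^sup>+x. ennreal (exp (\<Sum>k<Suc n. ?t k (y(h n := x)))) \<partial>sign_pmf m) \<le> ennreal (exp (\<Sum>k<n. ?t k y))" .
  qed
  also have "\<dots> \<le> 1" using Suc.prems by (intro Suc.IH) (auto simp: inj_on_def)
  finally show ?case .
qed

text \<open>Chernoff bound at exponent \<open>1\<close>. Under the normalisation \<open>\<Sum>k. (L k)\<^sup>2 \<le> 1\<close>, the Cauchy-Schwarz
  inequality bounds the compensator by \<open>1 / 2 + \<phi>\<close>.\<close>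

lemma real_sum_tail:
  fixes L :: "nat \<Rightarrow> ('i \<Rightarrow> real) \<Rightarrow> real"
  assumes "finite J" "\<bar>m\<bar> \<le> 1" "inj_on h {..<n}" "h ` {..<n} \<subseteq> J"
    and inv: "\<And>k l y x. k \<le> l \<Longrightarrow> l < n \<Longrightarrow> L k (y(h l := x)) = L k y"
    and L: "\<And>y. (\<Sum>k<n. (L k y)\<^sup>2) \<le> 1" and phi: "\<bar>m\<bar> * sqrt (real n) \<le> \<phi>"
  shows "measure (sign_field J m) {y. (\<Sum>k<n. y (h k) * L k y) > 3 * \<phi>} \<le> exp (1 / 2 - 2 * \<phi>)"
proof -
  let ?P = "sign_field J m"
  let ?t = "\<lambda>k y. y (h k) * L k y - (L k y)\<^sup>2 / 2 - \<bar>m\<bar> * \<bar>L k y\<bar>"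
  let ?A = "{y. (\<Sum>k<n. y (h k) * L k y) > 3 * \<phi>}"
  have "emeasure ?P ?A = (\<integral>\<^sup>+y. indicator ?A y \<partial>?P)" by simp
  also have "\<dots> \<le> (\<integral>\<^sup>+y. ennreal (exp (1 / 2 - 2 * \<phi>)) * ennreal (exp (\<Sum>k<n. ?t k y)) \<partial>?P)"
  proof (rule nn_integral_mono)
    fix y
    show "indicator ?A y \<le> ennreal (exp (1 / 2 - 2 * \<phi>)) * ennreal (exp (\<Sum>k<n. ?t k y))"
    proof (cases "y \<in> ?A")
      case True
      have "(\<Sum>k<n. \<bar>L k y\<bar>) \<le> sqrt (\<Sum>k<n. 1\<^sup>2) * sqrt (\<Sum>k<n. (L k y)\<^sup>2)"
        using L2_set_mult_ineq[of "\<lambda>_. 1" "\<lambda>k. L k y" "{..<n}"] by (simp add: L2_set_def)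
      also have "\<dots> \<le> sqrt (real n) * 1" using L[of y] by (intro mult_mono) (auto simp: sum_nonneg)
      finally have "\<bar>m\<bar> * (\<Sum>k<n. \<bar>L k y\<bar>) \<le> \<bar>m\<bar> * sqrt (real n)" by (simp add: mult_left_mono)
      then have 1: "\<bar>m\<bar> * (\<Sum>k<n. \<bar>L k y\<bar>) \<le> \<phi>" using phi by simp
      have "(\<Sum>k<n. ?t k y) = (\<Sum>k<n. y (h k) * L k y) - (\<Sum>k<n. (L k y)\<^sup>2) / 2 - \<bar>m\<bar> * (\<Sum>k<n. \<bar>L k y\<bar>)"
        by (simp add: sum_subtractf sum_divide_distrib sum_distrib_left)
      also have "\<dots> \<ge> 3 * \<phi> - 1 / 2 - \<phi>" using True 1 L[of y] by auto
      finally have "exp (2 * \<phi> - 1 / 2) \<le> exp (\<Sum>k<n. ?t k y)" by simp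
      then have "exp (1 / 2 - 2 * \<phi>) * exp (2 * \<phi> - 1 / 2) \<le> exp (1 / 2 - 2 * \<phi>) * exp (\<Sum>k<n. ?t k y)" by simp
      then have "1 \<le> exp (1 / 2 - 2 * \<phi>) * exp (\<Sum>k<n. ?t k y)" by (simp flip: exp_add)
      then have "1 \<le> ennreal (exp (1 / 2 - 2 * \<phi>) * exp (\<Sum>k<n. ?t k y))"
        using ennreal_leI by fastforce
      then show ?thesis using True by (simp add: ennreal_mult)
    qed simp
  qed
  also have "\<dots> = ennreal (exp (1 / 2 - 2 * \<phi>)) * (\<integral>\<^sup>+y. ennreal (exp (\<Sum>k<n. ?t k y)) \<partial>?P)"
    by (rule nn_integral_cmult) simp
  also have "\<dots> \<le> ennreal (exp (1 / 2 - 2 * \<phi>)) * 1"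
    by (intro mult_left_mono exponential_supermartingale assms) auto
  finally show ?thesis by (simp add: measure_pmf.emeasure_eq_measure)
qed

text \<open>Dividing by the scale \<open>\<sigma>\<close>, which depends on none of the signs of the sum, reduces the real and
  imaginary parts, with either sign, to \<open>real_sum_tail\<close>. Where \<open>\<sigma>\<close> vanishes, so does the sum.\<close>

lemma linear_form_tail:
  fixes a :: "nat \<Rightarrow> ('i \<Rightarrow> real) \<Rightarrow> complex"
  assumes "finite J" "\<bar>m\<bar> \<le> 1" "inj_on h {..<n}" "h ` {..<n} \<subseteq> J"
    and inv: "\<And>k l y x. k \<le> l \<Longrightarrow> l < n \<Longrightarrow> a k (y(h l := x)) = a k y"
    and sinv: "\<And>l y x. l < n \<Longrightarrow> \<sigma> (y(h l := x)) = \<sigma> y"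
    and pos: "\<And>y. \<sigma> y \<ge> 0" and bd: "\<And>y. (\<Sum>k<n. (cmod (a k y))\<^sup>2) \<le> (\<sigma> y)\<^sup>2"
    and phi: "\<bar>m\<bar> * sqrt (real n) \<le> \<phi>"
  shows "measure (sign_field J m) {y. cmod (\<Sum>k<n. of_real (y (h k)) * a k y) > 6 * \<phi> * \<sigma> y} \<le> 4 * exp (1 / 2 - 2 * \<phi>)"
proof -
  let ?P = "sign_field J m"
  let ?E = "\<lambda>f. {y. (\<Sum>k<n. y (h k) * (f (a k y) / \<sigma> y)) > 3 * \<phi>}"
  have *: "measure ?P (?E f) \<le> exp (1 / 2 - 2 * \<phi>)" if f: "\<And>z. \<bar>f z\<bar> \<le> cmod z" for f
  proof (rule real_sum_tail[OF assms(1-4) _ _ phi])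
    show "k \<le> l \<Longrightarrow> l < n \<Longrightarrow> f (a k (y(h l := x))) / \<sigma> (y(h l := x)) = f (a k y) / \<sigma> y" for k l x y
      by (simp add: inv sinv)
    show "(\<Sum>k<n. (f (a k y) / \<sigma> y)\<^sup>2) \<le> 1" for y
    proof (cases "\<sigma> y = 0")
      case False
      have "(\<Sum>k<n. (f (a k y))\<^sup>2) \<le> (\<Sum>k<n. (cmod (a k y))\<^sup>2)"
        using f by (intro sum_mono) (metis abs_ge_zero power2_abs power_mono)
      also have "\<dots> \<le> (\<sigma> y)\<^sup>2" by (rule bd)
      finally show ?thesis using False by (simp add: power_divide flip: sum_divide_distrib)
    qed simp
  qed
  have "{y. cmod (\<Sum>k<n. of_real (y (h k)) * a k y) > 6 * \<phi> * \<sigma> y}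
      \<subseteq> ?E Re \<union> ?E Im \<union> ?E (\<lambda>z. - Re z) \<union> ?E (\<lambda>z. - Im z)"
  proof
    fix y assume "y \<in> {y. cmod (\<Sum>k<n. of_real (y (h k)) * a k y) > 6 * \<phi> * \<sigma> y}"
    then have gt: "cmod (\<Sum>k<n. of_real (y (h k)) * a k y) > 6 * \<phi> * \<sigma> y" by simp
    have "\<sigma> y \<noteq> 0"
    proof
      assume s: "\<sigma> y = 0"
      then have "(\<Sum>k<n. (cmod (a k y))\<^sup>2) = 0" using bd[of y] by (simp add: antisym sum_nonneg)
      then have "\<And>k. k < n \<Longrightarrow> a k y = 0" by (simp add: sum_nonneg_eq_0_iff)
      then show False using gt s by simp
    qed
    then have s: "\<sigma> y > 0" using pos[of y] by simp
    let ?S = "\<Sum>k<n. of_real (y (h k)) * a k y"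
    have re: "(\<Sum>k<n. y (h k) * (Re (a k y) / \<sigma> y)) = Re ?S / \<sigma> y" and im: "(\<Sum>k<n. y (h k) * (Im (a k y) / \<sigma> y)) = Im ?S / \<sigma> y"
      by (simp_all add: sum_divide_distrib)
    have re': "(\<Sum>k<n. y (h k) * (- Re (a k y) / \<sigma> y)) = - Re ?S / \<sigma> y" and im': "(\<Sum>k<n. y (h k) * (- Im (a k y) / \<sigma> y)) = - Im ?S / \<sigma> y"
      by (simp_all add: sum_divide_distrib sum_negf)
    have "\<bar>Re ?S\<bar> + \<bar>Im ?S\<bar> > 6 * \<phi> * \<sigma> y" using gt cmod_le[of ?S] by linarith
    then have "Re ?S > 3 * \<phi> * \<sigma> y \<or> Im ?S > 3 * \<phi> * \<sigma> y \<or> - Re ?S > 3 * \<phi> * \<sigma> y \<or> - Im ?S > 3 * \<phi> * \<sigma> y" by linarith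
    then show "y \<in> ?E Re \<union> ?E Im \<union> ?E (\<lambda>z. - Re z) \<union> ?E (\<lambda>z. - Im z)"
      unfolding Un_iff mem_Collect_eq re im re' im' using s by (simp only: pos_less_divide_eq) blast
  qed
  then have "measure ?P {y. cmod (\<Sum>k<n. of_real (y (h k)) * a k y) > 6 * \<phi> * \<sigma> y} \<le> measure ?P (?E Re \<union> ?E Im \<union> ?E (\<lambda>z. - Re z) \<union> ?E (\<lambda>z. - Im z))"
    by (intro measure_pmf.finite_measure_mono) auto
  also have "\<dots> \<le> measure ?P (?E Re) + measure ?P (?E Im) + measure ?P (?E (\<lambda>z. - Re z)) + measure ?P (?E (\<lambda>z. - Im z))"
    by (intro order_trans[OF measure_Un_le] add_mono order_refl) auto
  also have "\<dots> \<le> exp (1 / 2 - 2 * \<phi>) + exp (1 / 2 - 2 * \<phi>) + exp (1 / 2 - 2 * \<phi>) + exp (1 / 2 - 2 * \<phi>)"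
    by (intro add_mono *) (auto simp: abs_Re_le_cmod abs_Im_le_cmod)
  finally show ?thesis by simp
qed

lemma sum_offdiag_sym:
  fixes f :: "nat \<Rightarrow> nat \<Rightarrow> complex"
  assumes "\<And>k l. k < n \<Longrightarrow> l < n \<Longrightarrow> f k l = f l k"
  shows "(\<Sum>k<n. \<Sum>l\<in>{..<n} - {k}. f k l) = 2 * (\<Sum>k<n. \<Sum>l<k. f k l)"
proof -
  have "(\<Sum>k<n. \<Sum>l\<in>{..<n} - {k}. f k l) = (\<Sum>k<n. (\<Sum>l<k. f k l) + (\<Sum>l\<in>{k<..<n}. f k l))"
  proof (rule sum.cong[OF refl])
    fix k assume "k \<in> {..<n}"
    then have "{..<n} - {k} = {..<k} \<union> {k<..<n}" "{..<k} \<inter> {k<..<n} = {}" by auto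
    then show "(\<Sum>l\<in>{..<n} - {k}. f k l) = (\<Sum>l<k. f k l) + (\<Sum>l\<in>{k<..<n}. f k l)"
      by (simp add: sum.union_disjoint)
  qed
  also have "\<dots> = (\<Sum>k<n. \<Sum>l<k. f k l) + (\<Sum>k<n. \<Sum>l\<in>{k<..<n}. f k l)" by (rule sum.distrib)
  also have "(\<Sum>k<n. \<Sum>l\<in>{k<..<n}. f k l) = (\<Sum>l<n. \<Sum>k<l. f k l)"
    by (subst sum.Sigma, simp, simp, subst sum.Sigma, simp, simp)
       (rule sum.reindex_bij_witness[of _ prod.swap prod.swap], auto)
  also have "\<dots> = (\<Sum>l<n. \<Sum>k<l. f l k)" using assms by (intro sum.cong refl) auto
  finally show ?thesis by simp
qed

text \<open>The form is twice the sum of \<open>y (h k) * a k\<close>, where \<open>a k\<close> is a linear form in the earlier signs. The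
  \<open>a k\<close> are predictable but not bounded by a deterministic multiple of the row norms, so they are set to \<open>0\<close>
  where they exceed their own large deviation bound. The truncated sum obeys \<open>linear_form_tail\<close>, and
  truncation acts only on an unlikely event.\<close>

lemma quadratic_form_tail:
  fixes B :: "nat \<Rightarrow> nat \<Rightarrow> ('i \<Rightarrow> real) \<Rightarrow> complex"
  assumes "finite J" "\<bar>m\<bar> \<le> 1" "inj_on h {..<n}" "h ` {..<n} \<subseteq> J"
    and inv: "\<And>k l q y x. q < n \<Longrightarrow> B k l (y(h q := x)) = B k l y"
    and sym: "\<And>k l y. k < n \<Longrightarrow> l < n \<Longrightarrow> B k l y = B l k y"
    and phi: "\<bar>m\<bar> * sqrt (real n) \<le> \<phi>"
  shows "measure (sign_field J m)
     {y. cmod (\<Sum>k<n. \<Sum>l\<in>{..<n} - {k}. of_real (y (h k)) * B k l y * of_real (y (h l))) > 72 * \<phi>\<^sup>2 * sqrt (\<Sum>k<n. \<Sum>l<n. (cmod (B k l y))\<^sup>2)}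
     \<le> 4 * (real n + 1) * exp (1 / 2 - 2 * \<phi>)"
proof -
  let ?P = "sign_field J m"
  define F where "F = (\<lambda>y. sqrt (\<Sum>k<n. \<Sum>l<n. (cmod (B k l y))\<^sup>2))"
  define lk where "lk = (\<lambda>k y. sqrt (\<Sum>l<k. (cmod (B k l y))\<^sup>2))"
  define a where "a = (\<lambda>k y. \<Sum>l<k. of_real (y (h l)) * B k l y)"
  define b where "b = (\<lambda>k y. if cmod (a k y) \<le> 6 * \<phi> * lk k y then a k y else 0)"
  have phi0: "\<phi> \<ge> 0" using phi by (rule order_trans[rotated]) auto
  have hne: "h l \<noteq> h q" if "l < k" "k \<le> q" "q < n" for l k q
    using assms(3) that by (metis inj_on_contraD lessThan_iff order.strict_trans2 order.strict_trans less_irrefl)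
  have ainv: "a k (y(h q := x)) = a k y" if "k \<le> q" "q < n" for k q y x
    unfolding a_def using inv[OF that(2)] hne[OF _ that] by (intro sum.cong) auto
  have linv: "lk k (y(h q := x)) = lk k y" if "q < n" for k q y x
    unfolding lk_def using inv[OF that] by simp
  have Finv: "F (y(h q := x)) = F y" if "q < n" for q y x
    unfolding F_def using inv[OF that] by simp
  have F0: "F y \<ge> 0" for y unfolding F_def by (simp add: sum_nonneg)
  have lin: "measure ?P {y. cmod (a k y) > 6 * \<phi> * lk k y} \<le> 4 * exp (1 / 2 - 2 * \<phi>)" if k: "k < n" for k
    unfolding a_def
  proof (rule linear_form_tail[OF assms(1,2)])
    show "inj_on h {..<k}" "h ` {..<k} \<subseteq> J" using assms(3,4) k by (auto simp: inj_on_def)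
    show "B k i (y(h l := x)) = B k i y" if "l < k" for i l y x using inv k that by simp
    show "lk k (y(h l := x)) = lk k y" if "l < k" for l y x using linv k that by simp
    show "lk k y \<ge> 0" for y unfolding lk_def by (simp add: sum_nonneg)
    show "(\<Sum>l<k. (cmod (B k l y))\<^sup>2) \<le> (lk k y)\<^sup>2" for y unfolding lk_def by (simp add: sum_nonneg)
    have "\<bar>m\<bar> * sqrt (real k) \<le> \<bar>m\<bar> * sqrt (real n)" using k by (intro mult_left_mono) auto
    then show "\<bar>m\<bar> * sqrt (real k) \<le> \<phi>" using phi by simp
  qed
  have trunc: "measure ?P {y. cmod (\<Sum>k<n. of_real (y (h k)) * b k y) > 6 * \<phi> * (6 * \<phi> * F y)} \<le> 4 * exp (1 / 2 - 2 * \<phi>)"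
  proof (rule linear_form_tail[OF assms(1-4) _ _ _ _ phi])
    show "k \<le> l \<Longrightarrow> l < n \<Longrightarrow> b k (y(h l := x)) = b k y" for k l y x
      unfolding b_def by (simp add: ainv linv)
    show "l < n \<Longrightarrow> 6 * \<phi> * F (y(h l := x)) = 6 * \<phi> * F y" for l y x by (simp add: Finv)
    show "0 \<le> 6 * \<phi> * F y" for y using phi0 F0 by simp
    fix y
    have "(\<Sum>k<n. (cmod (b k y))\<^sup>2) \<le> (\<Sum>k<n. (6 * \<phi>)\<^sup>2 * (\<Sum>l<n. (cmod (B k l y))\<^sup>2))"
    proof (rule sum_mono)
      fix k assume k: "k \<in> {..<n}"
      have "cmod (b k y) \<le> 6 * \<phi> * lk k y"
        unfolding b_def using phi0 by (auto simp: lk_def sum_nonneg)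
      then have "(cmod (b k y))\<^sup>2 \<le> (6 * \<phi> * lk k y)\<^sup>2" by (intro power_mono) auto
      also have "\<dots> = (6 * \<phi>)\<^sup>2 * (\<Sum>l<k. (cmod (B k l y))\<^sup>2)"
        by (simp add: power_mult_distrib lk_def sum_nonneg)
      also have "\<dots> \<le> (6 * \<phi>)\<^sup>2 * (\<Sum>l<n. (cmod (B k l y))\<^sup>2)"
        using k by (intro mult_left_mono sum_mono2) auto
      finally show "(cmod (b k y))\<^sup>2 \<le> (6 * \<phi>)\<^sup>2 * (\<Sum>l<n. (cmod (B k l y))\<^sup>2)" .
    qed
    also have "\<dots> = (6 * \<phi> * F y)\<^sup>2"
      by (simp add: power_mult_distrib F_def sum_nonneg sum_distrib_left)
    finally show "(\<Sum>k<n. (cmod (b k y))\<^sup>2) \<le> (6 * \<phi> * F y)\<^sup>2" .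
  qed
  let ?T = "{y. cmod (\<Sum>k<n. of_real (y (h k)) * b k y) > 6 * \<phi> * (6 * \<phi> * F y)}"
  let ?U = "\<Union>k<n. {y. cmod (a k y) > 6 * \<phi> * lk k y}"
  have sub: "{y. cmod (\<Sum>k<n. \<Sum>l\<in>{..<n} - {k}. of_real (y (h k)) * B k l y * of_real (y (h l))) > 72 * \<phi>\<^sup>2 * F y} \<subseteq> ?T \<union> ?U"
  proof
    fix y assume "y \<in> {y. cmod (\<Sum>k<n. \<Sum>l\<in>{..<n} - {k}. of_real (y (h k)) * B k l y * of_real (y (h l))) > 72 * \<phi>\<^sup>2 * F y}"
    then have gt: "cmod (\<Sum>k<n. \<Sum>l\<in>{..<n} - {k}. of_real (y (h k)) * B k l y * of_real (y (h l))) > 72 * \<phi>\<^sup>2 * F y" by simp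
    have eq: "(\<Sum>k<n. \<Sum>l\<in>{..<n} - {k}. of_real (y (h k)) * B k l y * of_real (y (h l)))
       = 2 * (\<Sum>k<n. of_real (y (h k)) * a k y)"
      by (subst sum_offdiag_sym) (auto simp: sym a_def sum_distrib_left mult_ac)
    show "y \<in> ?T \<union> ?U"
    proof (cases "y \<in> ?U")
      case False
      then have "b k y = a k y" if "k < n" for k using that by (auto simp: b_def not_less)
      then have "(\<Sum>k<n. of_real (y (h k)) * b k y) = (\<Sum>k<n. of_real (y (h k)) * a k y)" by simp
      then show ?thesis using gt unfolding eq by (simp add: norm_mult power2_eq_square)
    qed simp
  qed
  have "measure ?P {y. cmod (\<Sum>k<n. \<Sum>l\<in>{..<n} - {k}. of_real (y (h k)) * B k l y * of_real (y (h l))) > 72 * \<phi>\<^sup>2 * F y} \<le> measure ?P (?T \<union> ?U)"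
    by (intro measure_pmf.finite_measure_mono sub) auto
  also have "\<dots> \<le> measure ?P ?T + measure ?P ?U" by (rule measure_Un_le) auto
  also have "measure ?P ?U \<le> (\<Sum>k<n. measure ?P {y. cmod (a k y) > 6 * \<phi> * lk k y})"
    by (rule measure_UNION_le) auto
  also have "\<dots> \<le> (\<Sum>k<n. 4 * exp (1 / 2 - 2 * \<phi>))" by (intro sum_mono lin) auto
  finally show ?thesis using trunc unfolding F_def by (simp add: algebra_simps)
qed

section \<open>Curie-Weiss spins as a mixture of independent signs\<close>

lemma pmf_sign_pmf:
  assumes "\<bar>u\<bar> \<le> 1" "x \<in> {-1, 1}"
  shows "pmf (sign_pmf u) x = (1 + u * x) / 2"
proof -
  let ?f = "\<lambda>b. if b then 1 else -1 :: real"
  have inj: "inj ?f" by (auto simp: inj_def split: if_splits)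
  have b: "0 \<le> (1 + u) / 2" "(1 + u) / 2 \<le> 1" using assms(1) by auto
  have "pmf (sign_pmf u) (?f c) = pmf (bernoulli_pmf ((1 + u) / 2)) c" for c
    unfolding sign_pmf_def by (rule pmf_map_inj'[OF inj])
  from this[of True] this[of False] show ?thesis using assms(2) b by (auto simp: field_simps)
qed

lemma set_sign_pmf: "set_pmf (sign_pmf u) \<subseteq> {-1, 1}"
  unfolding sign_pmf_def by auto

text \<open>The mean of each spin, given the value \<open>t\<close> of the Gaussian field, for \<open>n\<close> spins.\<close>

definition cw_tilt :: "real \<Rightarrow> nat \<Rightarrow> real \<Rightarrow> real" where
  "cw_tilt \<beta> n t = tanh (sqrt (\<beta> / real n) * t)"

text \<open>The factor \<open>cosh (\<dots>) ^ n\<close> is the normalisation of the product weight \<open>exp (sqrt (\<beta> / n) * t * S)\<close>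
  over all configurations, up to \<open>2 ^ n\<close>.\<close>

definition cw_density :: "real \<Rightarrow> nat \<Rightarrow> real \<Rightarrow> real" where
  "cw_density \<beta> n t = exp (- t\<^sup>2 / 2) * cosh (sqrt (\<beta> / real n) * t) ^ n"

definition cw_mass :: "real \<Rightarrow> nat \<Rightarrow> real" where
  "cw_mass \<beta> n = enn2real (\<integral>\<^sup>+t. ennreal (cw_density \<beta> n t) \<partial>lborel)"

definition cw_mixing :: "real \<Rightarrow> nat \<Rightarrow> real measure" where
  "cw_mixing \<beta> n = density lborel (\<lambda>t. ennreal (cw_density \<beta> n t / cw_mass \<beta> n))"

lemma cw_tilt_le: "\<bar>cw_tilt \<beta> n t\<bar> \<le> 1"
  unfolding cw_tilt_def using tanh_real_bounds[of "sqrt (\<beta> / real n) * t"] by auto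

lemma continuous_cw_tilt: "continuous_on UNIV (cw_tilt \<beta> n)"
  unfolding cw_tilt_def tanh_def by (intro continuous_intros) (auto simp: cosh_real_pos less_imp_neq[symmetric])

lemma cw_tilt_measurable [measurable]: "cw_tilt \<beta> n \<in> borel_measurable borel"
  by (rule borel_measurable_continuous_onI[OF continuous_cw_tilt])

lemma cw_density_pos: "cw_density \<beta> n t > 0"
  by (simp add: cw_density_def cosh_real_pos)

lemma cw_density_measurable [measurable]: "cw_density \<beta> n \<in> borel_measurable borel"
  unfolding cw_density_def by (intro borel_measurable_continuous_onI continuous_intros) auto

lemma nn_integral_gaussian:
  "(\<integral>\<^sup>+t. ennreal (exp (- t\<^sup>2 / 2 + c * t)) \<partial>lborel) = ennreal (sqrt (2 * pi) * exp (c\<^sup>2 / 2))"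
proof -
  have "(\<integral>\<^sup>+t. ennreal (exp (- t\<^sup>2 / 2 + c * t)) \<partial>lborel)
     = (\<integral>\<^sup>+t. ennreal (sqrt (2 * pi) * exp (c\<^sup>2 / 2)) * ennreal (normal_density c 1 t) \<partial>lborel)"
  proof (rule nn_integral_cong)
    fix t :: real
    have "- t\<^sup>2 / 2 + c * t = c\<^sup>2 / 2 + (- (t - c)\<^sup>2 / 2)" by (simp add: power2_eq_square field_simps)
    then have "exp (- t\<^sup>2 / 2 + c * t) = exp (c\<^sup>2 / 2) * exp (- (t - c)\<^sup>2 / 2)" by (metis exp_add)
    then have "exp (- t\<^sup>2 / 2 + c * t) = (sqrt (2 * pi) * exp (c\<^sup>2 / 2)) * normal_density c 1 t"
      by (simp add: normal_density_def)
    then show "ennreal (exp (- t\<^sup>2 / 2 + c * t)) = ennreal (sqrt (2 * pi) * exp (c\<^sup>2 / 2)) * ennreal (normal_density c 1 t)"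
      by (simp add: ennreal_mult)
  qed
  also have "\<dots> = ennreal (sqrt (2 * pi) * exp (c\<^sup>2 / 2)) * (\<integral>\<^sup>+t. ennreal (normal_density c 1 t) \<partial>lborel)"
    by (rule nn_integral_cmult) simp
  also have "(\<integral>\<^sup>+t. ennreal (normal_density c 1 t) \<partial>lborel) = 1"
    using prob_space.emeasure_space_1[OF prob_space_normal_density[of 1 c]] by (simp add: emeasure_density)
  finally show ?thesis by simp
qed

lemma cw_density_integral:
  "(\<integral>\<^sup>+t. ennreal (cw_density \<beta> n t) \<partial>lborel) < \<infinity>" "(\<integral>\<^sup>+t. ennreal (cw_density \<beta> n t) \<partial>lborel) > 0"
proof -
  let ?a = "sqrt (\<beta> / real n)"
  have cosh_le: "cosh x \<le> exp \<bar>x\<bar>" for x :: real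
  proof -
    have "exp x \<le> exp \<bar>x\<bar>" "exp (- x) \<le> exp \<bar>x\<bar>" by auto
    moreover have "(a + b) / 2 \<le> c" if "a \<le> c" "b \<le> c" for a b c :: real using that by simp
    ultimately show ?thesis unfolding cosh_field_def by blast
  qed
  have bd: "cw_density \<beta> n t \<le> exp (- t\<^sup>2 / 2 + (real n * ?a) * t) + exp (- t\<^sup>2 / 2 + (- (real n * ?a)) * t)" for t
  proof -
    have "cosh (?a * t) ^ n \<le> exp \<bar>?a * t\<bar> ^ n" by (intro power_mono cosh_le) (simp add: cosh_real_nonneg)
    also have "\<dots> = exp (real n * \<bar>?a * t\<bar>)" by (simp add: exp_of_nat_mult)
    also have "\<dots> \<le> exp (real n * (?a * t)) + exp (- (real n * (?a * t)))"
      by (cases "?a * t \<ge> 0") (auto simp: abs_if intro: add_increasing add_increasing2)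
    finally have "cw_density \<beta> n t \<le> exp (- t\<^sup>2 / 2) * (exp (real n * (?a * t)) + exp (- (real n * (?a * t))))"
      unfolding cw_density_def by (intro mult_left_mono) auto
    also have "\<dots> = exp (- t\<^sup>2 / 2 + (real n * ?a) * t) + exp (- t\<^sup>2 / 2 + (- (real n * ?a)) * t)"
      by (simp only: distrib_left exp_add[symmetric] mult.assoc mult_minus_left)
    finally show ?thesis .
  qed
  have "(\<integral>\<^sup>+t. ennreal (cw_density \<beta> n t) \<partial>lborel)
     \<le> (\<integral>\<^sup>+t. ennreal (exp (- t\<^sup>2 / 2 + (real n * ?a) * t)) + ennreal (exp (- t\<^sup>2 / 2 + (- (real n * ?a)) * t)) \<partial>lborel)"
    by (intro nn_integral_mono) (use bd in \<open>simp flip: ennreal_plus\<close>)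
  also have "\<dots> = (\<integral>\<^sup>+t. ennreal (exp (- t\<^sup>2 / 2 + (real n * ?a) * t)) \<partial>lborel) + (\<integral>\<^sup>+t. ennreal (exp (- t\<^sup>2 / 2 + (- (real n * ?a)) * t)) \<partial>lborel)"
    by (rule nn_integral_add) measurable
  also have "\<dots> < \<infinity>" unfolding nn_integral_gaussian by (simp flip: ennreal_plus)
  finally show "(\<integral>\<^sup>+t. ennreal (cw_density \<beta> n t) \<partial>lborel) < \<infinity>" .
  have "exp (- t\<^sup>2 / 2 + 0 * t) \<le> cw_density \<beta> n t" for t
  proof -
    have "1 \<le> cosh (?a * t) ^ n" using cosh_real_ge_1 by (rule one_le_power)
    then show ?thesis unfolding cw_density_def by simp
  qed
  then have "(\<integral>\<^sup>+t. ennreal (exp (- t\<^sup>2 / 2 + 0 * t)) \<partial>lborel) \<le> (\<integral>\<^sup>+t. ennreal (cw_density \<beta> n t) \<partial>lborel)"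
    by (intro nn_integral_mono ennreal_leI)
  moreover have "(\<integral>\<^sup>+t. ennreal (exp (- t\<^sup>2 / 2 + 0 * t)) \<partial>lborel) > 0"
    unfolding nn_integral_gaussian by simp
  ultimately show "(\<integral>\<^sup>+t. ennreal (cw_density \<beta> n t) \<partial>lborel) > 0" by (rule order.strict_trans2[rotated])
qed

lemma cw_mass_pos: "cw_mass \<beta> n > 0"
  unfolding cw_mass_def using cw_density_integral[of \<beta> n] by (simp add: enn2real_positive_iff)

lemma cw_mass_eq: "(\<integral>\<^sup>+t. ennreal (cw_density \<beta> n t) \<partial>lborel) = ennreal (cw_mass \<beta> n)"
  unfolding cw_mass_def using cw_density_integral(1)[of \<beta> n] by simp

lemma nn_integral_cw_mixing:
  assumes [measurable]: "f \<in> borel_measurable borel"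
  shows "(\<integral>\<^sup>+t. f t \<partial>cw_mixing \<beta> n) = (\<integral>\<^sup>+t. ennreal (cw_density \<beta> n t) * f t \<partial>lborel) / ennreal (cw_mass \<beta> n)"
proof -
  have "(\<integral>\<^sup>+t. f t \<partial>cw_mixing \<beta> n) = (\<integral>\<^sup>+t. ennreal (cw_density \<beta> n t / cw_mass \<beta> n) * f t \<partial>lborel)"
    unfolding cw_mixing_def by (rule nn_integral_density) measurable
  also have "\<dots> = (\<integral>\<^sup>+t. ennreal (cw_density \<beta> n t) * f t / ennreal (cw_mass \<beta> n) \<partial>lborel)"
    using cw_mass_pos[of \<beta> n] cw_density_pos[of \<beta> n]
    by (intro nn_integral_cong) (simp add: divide_ennreal[symmetric] less_imp_le ennreal_times_divide mult.commute)
  also have "\<dots> = (\<integral>\<^sup>+t. ennreal (cw_density \<beta> n t) * f t \<partial>lborel) / ennreal (cw_mass \<beta> n)"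
    by (rule nn_integral_divide) measurable
  finally show ?thesis .
qed

lemma sets_cw_mixing [measurable_cong, simp]: "sets (cw_mixing \<beta> n) = sets borel"
  and space_cw_mixing [simp]: "space (cw_mixing \<beta> n) = UNIV"
  by (simp_all add: cw_mixing_def)

lemma prob_space_cw_mixing: "prob_space (cw_mixing \<beta> n)"
proof
  have "emeasure (cw_mixing \<beta> n) (space (cw_mixing \<beta> n)) = (\<integral>\<^sup>+t. 1 \<partial>cw_mixing \<beta> n)" by simp
  also have "\<dots> = ennreal (cw_mass \<beta> n) / ennreal (cw_mass \<beta> n)"
    by (subst nn_integral_cw_mixing) (simp_all add: cw_mass_eq)
  also have "\<dots> = 1" using cw_mass_pos[of \<beta> n] by (simp add: divide_ennreal)
  finally show "emeasure (cw_mixing \<beta> n) (space (cw_mixing \<beta> n)) = 1" .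
qed

lemma pmf_Pi_sign:
  assumes "finite J" "y \<in> J \<rightarrow>\<^sub>E {-1, 1}"
  shows "pmf (sign_field J (cw_tilt \<beta> n t)) y = (\<Prod>i\<in>J. (1 + cw_tilt \<beta> n t * y i) / 2)"
proof -
  have "pmf (sign_field J (cw_tilt \<beta> n t)) y = (\<Prod>i\<in>J. pmf (sign_pmf (cw_tilt \<beta> n t)) (y i))"
    using assms by (intro pmf_Pi') auto
  also have "\<dots> = (\<Prod>i\<in>J. (1 + cw_tilt \<beta> n t * y i) / 2)"
    using assms by (intro prod.cong refl pmf_sign_pmf cw_tilt_le) auto
  finally show ?thesis .
qed

lemma pmf_Pi_sign_measurable:
  assumes "finite J" "y \<in> J \<rightarrow>\<^sub>E {-1, 1}"
  shows "(\<lambda>t. ennreal (pmf (sign_field J (cw_tilt \<beta> n t)) y)) \<in> borel_measurable borel"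
  unfolding pmf_Pi_sign[OF assms] by measurable

text \<open>Since \<open>(1 + u * y) / 2 = exp (a * t * y) / (2 * cosh (a * t))\<close> for a sign \<open>y\<close>, with \<open>a = sqrt (\<beta> / n)\<close>,
  the density cancels all hyperbolic cosines and leaves a Gaussian integral.\<close>

lemma mixture_atom:
  assumes "finite J" "J \<noteq> {}" "\<beta> \<ge> 0" "y \<in> J \<rightarrow>\<^sub>E {-1, 1}"
  shows "(\<integral>\<^sup>+t. ennreal (pmf (sign_field J (cw_tilt \<beta> (card J) t)) y) \<partial>cw_mixing \<beta> (card J))
     = ennreal (sqrt (2 * pi) / (2 ^ card J * cw_mass \<beta> (card J)) * curie_weiss_weight \<beta> J y)"
proof -
  let ?n = "card J" and ?a = "sqrt (\<beta> / real (card J))" and ?S = "\<Sum>i\<in>J. y i"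
  have n: "?n > 0" using assms by (simp add: card_gt_0_iff)
  have "cw_density \<beta> ?n t * pmf (sign_field J (cw_tilt \<beta> ?n t)) y = 1 / 2 ^ ?n * exp (- t\<^sup>2 / 2 + (?a * ?S) * t)" for t
  proof -
    have f: "(1 + cw_tilt \<beta> ?n t * y i) / 2 = exp (?a * t * y i) / (2 * cosh (?a * t))" if "i \<in> J" for i
    proof -
      have h1: "(1 + tanh x) / 2 = exp x / (2 * cosh x)" for x :: real
        unfolding cosh_plus_sinh[symmetric] tanh_def using cosh_real_pos[of x] by (simp add: field_simps)
      have h2: "(1 - tanh x) / 2 = exp (- x) / (2 * cosh x)" for x :: real
        unfolding cosh_minus_sinh[symmetric] tanh_def using cosh_real_pos[of x] by (simp add: field_simps)
      have "y i = 1 \<or> y i = -1" using assms(4) that by auto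
      then show ?thesis
        using h1[of "?a * t"] h2[of "?a * t"] by (auto simp: cw_tilt_def)
    qed
    have "pmf (sign_field J (cw_tilt \<beta> ?n t)) y = (\<Prod>i\<in>J. exp (?a * t * y i) / (2 * cosh (?a * t)))"
      unfolding pmf_Pi_sign[OF assms(1,4)] by (intro prod.cong refl f)
    also have "\<dots> = exp (?a * t * ?S) / (2 * cosh (?a * t)) ^ ?n"
      using assms(1) by (simp add: prod_dividef exp_sum sum_distrib_left)
    finally have p: "pmf (sign_field J (cw_tilt \<beta> ?n t)) y = exp (?a * t * ?S) / (2 * cosh (?a * t)) ^ ?n" .
    have e: "exp (- t\<^sup>2 / 2 + (?a * ?S) * t) = exp (- t\<^sup>2 / 2) * exp (?a * t * ?S)" by (simp only: exp_add mult_ac)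
    show ?thesis
      using cosh_real_pos[of "?a * t"] unfolding p e by (simp add: cw_density_def power_mult_distrib)
  qed
  then have "(\<integral>\<^sup>+t. ennreal (cw_density \<beta> ?n t) * ennreal (pmf (sign_field J (cw_tilt \<beta> ?n t)) y) \<partial>lborel)
     = (\<integral>\<^sup>+t. ennreal (1 / 2 ^ ?n) * ennreal (exp (- t\<^sup>2 / 2 + (?a * ?S) * t)) \<partial>lborel)"
    using cw_density_pos[of \<beta> ?n] by (simp add: ennreal_mult'[symmetric] less_imp_le)
  also have "\<dots> = ennreal (1 / 2 ^ ?n) * ennreal (sqrt (2 * pi) * exp ((?a * ?S)\<^sup>2 / 2))"
    unfolding nn_integral_gaussian[symmetric] by (rule nn_integral_cmult) simp
  also have "\<dots> = ennreal (1 / 2 ^ ?n * (sqrt (2 * pi) * curie_weiss_weight \<beta> J y))"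
  proof -
    have e: "(?a * ?S)\<^sup>2 / 2 = \<beta> / (2 * real ?n) * ?S\<^sup>2" using assms(3) by (simp add: power_mult_distrib)
    show ?thesis unfolding e curie_weiss_weight_def by (rule ennreal_mult'[symmetric]) simp
  qed
  finally show ?thesis
    using cw_mass_pos[of \<beta> ?n]
    by (subst nn_integral_cw_mixing[OF pmf_Pi_sign_measurable[OF assms(1,4)]])
       (simp add: divide_ennreal curie_weiss_weight_def)
qed

lemma set_Pi_sign:
  assumes "finite J"
  shows "set_pmf (sign_field J u) \<subseteq> J \<rightarrow>\<^sub>E {-1, 1}"
proof
  fix y assume "y \<in> set_pmf (sign_field J u)"
  then have "y \<in> PiE_dflt J undefined (set_pmf \<circ> (\<lambda>_. sign_pmf u))" using set_Pi_pmf_subset'[OF assms, of undefined "\<lambda>_. sign_pmf u"] by (rule rev_subsetD)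
  then show "y \<in> J \<rightarrow>\<^sub>E {-1, 1}" using set_sign_pmf[of u] by (auto simp: PiE_dflt_def PiE_def extensional_def)
qed

lemma emeasure_Pi_sign:
  assumes "finite J"
  shows "emeasure (sign_field J u) A = (\<Sum>y\<in>(J \<rightarrow>\<^sub>E {-1, 1}) \<inter> A. ennreal (pmf (sign_field J u) y))"
proof -
  let ?P = "sign_field J u"
  have fin: "finite (J \<rightarrow>\<^sub>E {-1, 1 :: real})" using assms by (intro finite_PiE) auto
  have "emeasure ?P A = emeasure ?P (((J \<rightarrow>\<^sub>E {-1, 1}) \<inter> A) \<inter> set_pmf ?P)"
    using set_Pi_sign[OF assms, of u] emeasure_Int_set_pmf[of ?P A]
    by (metis (no_types, lifting) inf.absorb_iff2 inf.assoc inf.commute)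
  also have "\<dots> = emeasure ?P ((J \<rightarrow>\<^sub>E {-1, 1}) \<inter> A)" by (rule emeasure_Int_set_pmf)
  also have "\<dots> = (\<Sum>y\<in>(J \<rightarrow>\<^sub>E {-1, 1}) \<inter> A. ennreal (pmf ?P y))"
    using fin by (subst emeasure_measure_pmf_finite) auto
  finally show ?thesis .
qed

text \<open>Both sides normalise the same weights to a probability, so the constants agree.\<close>

lemma mixture_const:
  assumes "finite J" "J \<noteq> {}" "\<beta> \<ge> 0"
  shows "sqrt (2 * pi) / (2 ^ card J * cw_mass \<beta> (card J)) = 1 / (\<Sum>y \<in> J \<rightarrow>\<^sub>E {-1, 1}. curie_weiss_weight \<beta> J y)"
proof -
  let ?S = "J \<rightarrow>\<^sub>E {-1, 1 :: real}" and ?c = "sqrt (2 * pi) / (2 ^ card J * cw_mass \<beta> (card J))"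
  let ?p = "\<lambda>t. sign_field J (cw_tilt \<beta> (card J) t)"
  have fin: "finite ?S" using assms(1) by (intro finite_PiE) auto
  have c: "?c \<ge> 0" using cw_mass_pos[of \<beta> "card J"] by simp
  have "1 = (\<integral>\<^sup>+t. 1 \<partial>cw_mixing \<beta> (card J))"
    using prob_space.emeasure_space_1[OF prob_space_cw_mixing[of \<beta> "card J"]] by simp
  also have "\<dots> = (\<integral>\<^sup>+t. (\<Sum>y\<in>?S. ennreal (pmf (?p t) y)) \<partial>cw_mixing \<beta> (card J))"
    using emeasure_Pi_sign[OF assms(1), of _ UNIV] by (simp add: measure_pmf.emeasure_space_1[simplified])
  also have "\<dots> = (\<Sum>y\<in>?S. \<integral>\<^sup>+t. ennreal (pmf (?p t) y) \<partial>cw_mixing \<beta> (card J))"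
    by (rule nn_integral_sum) (use pmf_Pi_sign_measurable[OF assms(1)] in simp)
  also have "\<dots> = (\<Sum>y\<in>?S. ennreal (?c * curie_weiss_weight \<beta> J y))"
    by (intro sum.cong refl mixture_atom assms)
  also have "\<dots> = ennreal (?c * (\<Sum>y\<in>?S. curie_weiss_weight \<beta> J y))"
    unfolding sum_distrib_left using c by (intro sum_ennreal mult_nonneg_nonneg) (auto simp: curie_weiss_weight_def)
  finally have "?c * (\<Sum>y\<in>?S. curie_weiss_weight \<beta> J y) = 1"
    by (metis ennreal_eq_1)
  then show ?thesis by (metis eq_divide_eq mult_zero_right zero_neq_one)
qed

text \<open>The atoms in \<open>{-1, 1}\<close> carry the full mass on both sides, so it suffices to compare them.\<close>

lemma curie_weiss_mixture:
  assumes cw: "curie_weiss_distributed \<beta> J \<Omega> X" and J: "finite J" "J \<noteq> {}" and b: "\<beta> \<ge> 0"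
    and meas: "{\<omega> \<in> space \<Omega>. Q (\<lambda>i. X i \<omega>)} \<in> sets \<Omega>"
    and dep: "\<And>y y'. (\<And>i. i \<in> J \<Longrightarrow> y i = y' i) \<Longrightarrow> Q y = Q y'"
  shows "emeasure \<Omega> {\<omega> \<in> space \<Omega>. Q (\<lambda>i. X i \<omega>)}
     = (\<integral>\<^sup>+t. emeasure (sign_field J (cw_tilt \<beta> (card J) t)) {y. Q y} \<partial>cw_mixing \<beta> (card J))"
proof -
  interpret prob_space \<Omega> using cw by (simp add: curie_weiss_distributed_def)
  have X [measurable]: "\<And>i. i \<in> J \<Longrightarrow> X i \<in> borel_measurable \<Omega>" using cw by (simp add: curie_weiss_distributed_def)
  let ?S = "J \<rightarrow>\<^sub>E {-1, 1 :: real}"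
  let ?c = "1 / (\<Sum>y \<in> ?S. curie_weiss_weight \<beta> J y)"
  let ?E = "\<lambda>y. {\<omega> \<in> space \<Omega>. \<forall>i\<in>J. X i \<omega> = y i}"
  have fin: "finite ?S" using J(1) by (intro finite_PiE) auto
  have E [measurable]: "?E y \<in> sets \<Omega>" for y using J(1) by measurable
  have Ey: "emeasure \<Omega> (?E y) = ennreal (?c * curie_weiss_weight \<beta> J y)" if "y \<in> ?S" for y
    using cw that by (simp add: curie_weiss_distributed_def emeasure_eq_measure)
  have disj: "disjoint_family_on ?E ?S"
    unfolding disjoint_family_on_def
  proof (intro ballI impI)
    fix y y' assume y: "y \<in> ?S" "y' \<in> ?S" "y \<noteq> y'"
    then obtain i where "i \<in> J" "y i \<noteq> y' i" by (metis PiE_ext)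
    then show "?E y \<inter> ?E y' = {}" by auto
  qed
  have sum: "emeasure \<Omega> (\<Union>y\<in>A. ?E y) = (\<Sum>y\<in>A. emeasure \<Omega> (?E y))" if "A \<subseteq> ?S" for A
    using that fin disj by (intro sum_emeasure[symmetric]) (auto intro: finite_subset disjoint_family_on_mono)
  have atom: "emeasure \<Omega> (?E y) = (\<integral>\<^sup>+t. ennreal (pmf (sign_field J (cw_tilt \<beta> (card J) t)) y) \<partial>cw_mixing \<beta> (card J))"
    if y: "y \<in> ?S" for y
    unfolding Ey[OF y] mixture_atom[OF J b y] mixture_const[OF J b] ..
  have mix: "(\<Sum>y\<in>?S \<inter> A. emeasure \<Omega> (?E y)) = (\<integral>\<^sup>+t. emeasure (sign_field J (cw_tilt \<beta> (card J) t)) A \<partial>cw_mixing \<beta> (card J))" for A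
  proof -
    have "(\<Sum>y\<in>?S \<inter> A. emeasure \<Omega> (?E y)) = (\<Sum>y\<in>?S \<inter> A. \<integral>\<^sup>+t. ennreal (pmf (sign_field J (cw_tilt \<beta> (card J) t)) y) \<partial>cw_mixing \<beta> (card J))"
      by (intro sum.cong refl atom) auto
    also have "\<dots> = (\<integral>\<^sup>+t. (\<Sum>y\<in>?S \<inter> A. ennreal (pmf (sign_field J (cw_tilt \<beta> (card J) t)) y)) \<partial>cw_mixing \<beta> (card J))"
      by (rule nn_integral_sum[symmetric]) (use pmf_Pi_sign_measurable[OF J(1)] in simp)
    finally show ?thesis unfolding emeasure_Pi_sign[OF J(1)] .
  qed
  have "emeasure \<Omega> (\<Union>y\<in>?S. ?E y) = 1"
  proof -
    have "emeasure \<Omega> (\<Union>y\<in>?S. ?E y) = (\<integral>\<^sup>+t. 1 \<partial>cw_mixing \<beta> (card J))"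
      using sum[of ?S] mix[of UNIV] by (simp add: measure_pmf.emeasure_space_1[simplified])
    then show ?thesis using prob_space.emeasure_space_1[OF prob_space_cw_mixing[of \<beta> "card J"]] by simp
  qed
  then have ae: "AE \<omega> in \<Omega>. \<omega> \<in> (\<Union>y\<in>?S. ?E y)"
    using fin by (intro AE_prob_1) (simp add: emeasure_eq_measure)
  have "emeasure \<Omega> {\<omega> \<in> space \<Omega>. Q (\<lambda>i. X i \<omega>)} = emeasure \<Omega> (\<Union>y\<in>?S \<inter> {y. Q y}. ?E y)"
  proof (rule emeasure_eq_AE)
    show "AE \<omega> in \<Omega>. \<omega> \<in> {\<omega> \<in> space \<Omega>. Q (\<lambda>i. X i \<omega>)} \<longleftrightarrow> \<omega> \<in> (\<Union>y\<in>?S \<inter> {y. Q y}. ?E y)"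
      using ae
    proof eventually_elim
      fix \<omega> assume "\<omega> \<in> (\<Union>y\<in>?S. ?E y)"
      then obtain y where y: "y \<in> ?S" "\<omega> \<in> ?E y" by auto
      have "Q (\<lambda>i. X i \<omega>) = Q y" by (rule dep) (use y(2) in auto)
      then have 1: "\<omega> \<in> {\<omega> \<in> space \<Omega>. Q (\<lambda>i. X i \<omega>)} \<longleftrightarrow> Q y" using y(2) by blast
      have "Q y' = Q y" if "\<omega> \<in> ?E y'" for y'
        by (rule dep) (use y(2) that in auto)
      then have 2: "\<omega> \<in> (\<Union>y\<in>?S \<inter> {y. Q y}. ?E y) \<longleftrightarrow> Q y" using y by blast
      show "\<omega> \<in> {\<omega> \<in> space \<Omega>. Q (\<lambda>i. X i \<omega>)} \<longleftrightarrow> \<omega> \<in> (\<Union>y\<in>?S \<inter> {y. Q y}. ?E y)"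
        unfolding 1 2 ..
    qed
    show "(\<Union>y\<in>?S \<inter> {y. Q y}. ?E y) \<in> sets \<Omega>" using fin by (intro sets.finite_UN) auto
  qed (rule meas)
  also have "\<dots> = (\<Sum>y\<in>?S \<inter> {y. Q y}. emeasure \<Omega> (?E y))" by (rule sum) auto
  finally show ?thesis unfolding mix .
qed

section \<open>Moments of the mixing measure\<close>

text \<open>At \<open>\<beta> = 1\<close> the exponent of the mixing density has no quadratic term at \<open>0\<close>; this is the quartic
  term, with \<open>tanh x\<close> in place of \<open>x\<close> so that it holds on the whole line. Two differentiations, with a
  term of the right sign dropped in between, reduce it to \<open>(tanh x) ^ 4 \<ge> 0\<close>.\<close>

lemma ln_cosh_le_tanh:
  fixes x :: real
  shows "ln (cosh x) \<le> x\<^sup>2 / 2 - tanh x ^ 4 / 12"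
proof -
  have t3: "t - tanh t - tanh t ^ 3 / 3 \<ge> 0" if t: "t \<ge> 0" for t :: real
  proof -
    have "(\<lambda>x. x - tanh x - tanh x ^ 3 / 3) 0 \<le> (\<lambda>x. x - tanh x - tanh x ^ 3 / 3) t"
    proof (rule DERIV_nonneg_imp_nondecreasing[OF t])
      fix x :: real
      show "\<exists>y. ((\<lambda>x. x - tanh x - tanh x ^ 3 / 3) has_real_derivative y) (at x) \<and> 0 \<le> y"
      proof (intro exI[of _ "tanh x ^ 4"] conjI)
        show "((\<lambda>x. x - tanh x - tanh x ^ 3 / 3) has_real_derivative tanh x ^ 4) (at x)"
          by (auto intro!: derivative_eq_intros simp: field_simps power2_eq_square power4_eq_xxxx)
      qed simp
    qed
    then show ?thesis by simp
  qed
  have *: "ln (cosh x) \<le> x\<^sup>2 / 2 - tanh x ^ 4 / 12" if x: "x \<ge> 0" for x :: real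
  proof -
    have "(\<lambda>x. x\<^sup>2 / 2 - tanh x ^ 4 / 12 - ln (cosh x)) 0 \<le> (\<lambda>x. x\<^sup>2 / 2 - tanh x ^ 4 / 12 - ln (cosh x)) x"
    proof (rule DERIV_nonneg_imp_nondecreasing[OF x])
      fix t :: real assume t: "0 \<le> t"
      have "tanh t ^ 3 * (1 - (tanh t)\<^sup>2) \<le> tanh t ^ 3 * 1"
        using t by (intro mult_left_mono) auto
      then have "t - tanh t ^ 3 * (1 - (tanh t)\<^sup>2) / 3 - tanh t \<ge> 0" using t3[OF t] by simp
      then show "\<exists>y. ((\<lambda>x. x\<^sup>2 / 2 - tanh x ^ 4 / 12 - ln (cosh x)) has_real_derivative y) (at t) \<and> 0 \<le> y"
      proof (intro exI[of _ "t - tanh t ^ 3 * (1 - (tanh t)\<^sup>2) / 3 - tanh t"] conjI)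
        have d1: "((\<lambda>x. ln (cosh x)) has_real_derivative tanh t) (at t)"
          by (auto intro!: derivative_eq_intros simp: tanh_def cosh_real_pos)
        have d2: "((\<lambda>x. tanh x ^ 4 / 12) has_real_derivative tanh t ^ 3 * (1 - (tanh t)\<^sup>2) / 3) (at t)"
          by (auto intro!: derivative_eq_intros)
        show "((\<lambda>x. x\<^sup>2 / 2 - tanh x ^ 4 / 12 - ln (cosh x)) has_real_derivative t - tanh t ^ 3 * (1 - (tanh t)\<^sup>2) / 3 - tanh t) (at t)"
          by (intro DERIV_diff d1 d2) (auto intro!: derivative_eq_intros)
      qed
    qed
    then show ?thesis by simp
  qed
  show ?thesis using *[of x] *[of "-x"] by (cases "x \<ge> 0") auto
qed

lemma cw_density_eq:
  "cw_density \<beta> n t = exp (- (t\<^sup>2 / 2 - real n * ln (cosh (sqrt (\<beta> / real n) * t))))"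
proof -
  have "cosh (sqrt (\<beta> / real n) * t) ^ n = exp (real n * ln (cosh (sqrt (\<beta> / real n) * t)))"
    by (simp add: exp_of_nat_mult cosh_real_pos)
  moreover have "exp (- (t\<^sup>2 / 2 - L)) = exp (- t\<^sup>2 / 2) * exp L" for L
    by (simp flip: exp_add)
  ultimately show ?thesis by (simp add: cw_density_def)
qed

lemma slope_sq:
  assumes "0 \<le> \<beta>" "\<beta> \<le> 1" "n > 0"
  shows "real n * (sqrt (\<beta> / real n) * t)\<^sup>2 \<le> t\<^sup>2"
  using assms by (simp add: power_mult_distrib mult_left_le_one_le)

text \<open>Doubling the argument multiplies the quadratic part of the exponent by four, and
  \<open>cosh (2 * x) = (cosh x)\<^sup>2 * (1 + (tanh x)\<^sup>2)\<close> with \<open>1 + (tanh x)\<^sup>2 \<le> exp (x\<^sup>2)\<close>, so for \<open>\<beta> \<le> 1\<close> the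
  exponent at least doubles. Rescaling the integral then compares the mass of \<open>sqrt w\<close> with that of \<open>w\<close>.\<close>

lemma cw_density_doubling:
  assumes "0 \<le> \<beta>" "\<beta> \<le> 1" "n > 0"
  shows "cw_density \<beta> n (2 * t) \<le> (cw_density \<beta> n t)\<^sup>2"
proof -
  define x where "x = sqrt (\<beta> / real n) * t"
  have "cosh (2 * x) = (cosh x)\<^sup>2 * (1 + (tanh x)\<^sup>2)"
    using cosh_double[of x] by (simp add: tanh_def field_simps)
  moreover have "1 + (tanh x)\<^sup>2 > 0" "cosh x > 0" by (simp_all add: add_pos_nonneg cosh_real_pos)
  ultimately have "ln (cosh (2 * x)) = ln ((cosh x)\<^sup>2) + ln (1 + (tanh x)\<^sup>2)"
    by (simp only: ln_mult_pos zero_less_power)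
  then have "ln (cosh (2 * x)) = 2 * ln (cosh x) + ln (1 + (tanh x)\<^sup>2)"
    using cosh_real_pos[of x] by (simp add: ln_realpow)
  also have "ln (1 + (tanh x)\<^sup>2) \<le> (tanh x)\<^sup>2" by (rule ln_add_one_self_le_self) simp
  also have "(tanh x)\<^sup>2 \<le> x\<^sup>2"
  proof -
    have "\<bar>tanh x\<bar> \<le> \<bar>x\<bar>" using tanh_le_self[of "\<bar>x\<bar>"] by simp
    then show ?thesis using abs_le_square_iff by blast
  qed
  finally have "real n * ln (cosh (2 * x)) \<le> real n * (2 * ln (cosh x) + x\<^sup>2)" by (intro mult_left_mono) auto
  also have "\<dots> \<le> 2 * (real n * ln (cosh x)) + t\<^sup>2" using slope_sq[OF assms, of t] by (simp add: x_def algebra_simps)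
  finally have "real n * ln (cosh (2 * x)) \<le> 2 * (real n * ln (cosh x)) + t\<^sup>2" .
  then show ?thesis
    unfolding cw_density_eq by (simp add: x_def mult_ac power_mult_distrib flip: exp_double)
qed

lemma cw_density_le_tanh:
  assumes "0 \<le> \<beta>" "\<beta> \<le> 1" "n > 0"
  shows "cw_density \<beta> n t \<le> exp (- (real n * cw_tilt \<beta> n t ^ 4 / 12))"
proof -
  define x where "x = sqrt (\<beta> / real n) * t"
  have "real n * ln (cosh x) \<le> real n * (x\<^sup>2 / 2 - tanh x ^ 4 / 12)" by (intro mult_left_mono ln_cosh_le_tanh) auto
  then have "real n * ln (cosh x) \<le> t\<^sup>2 / 2 - real n * tanh x ^ 4 / 12"
    using slope_sq[OF assms, of t] by (simp add: x_def algebra_simps)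
  then show ?thesis unfolding cw_density_eq cw_tilt_def x_def[symmetric] by simp
qed

lemma power_exp_bound:
  fixes q :: real
  assumes "p > 0" "q \<ge> 0"
  shows "q ^ p * exp (- (q ^ 4 / 24)) \<le> 1 + (24 * real p) ^ p"
proof -
  have "q ^ 4 / 24 / real p \<le> 1 + q ^ 4 / 24 / real p" by simp
  then have "(q ^ 4 / 24 / real p) ^ p \<le> (1 + q ^ 4 / 24 / real p) ^ p" by (intro power_mono) auto
  also have "\<dots> \<le> exp (q ^ 4 / 24)" using assms zero_le_even_power[of 4 q]
    by (intro exp_ge_one_plus_x_over_n_power_n) (auto intro: order_trans[of _ 0])
  finally have "(q ^ 4) ^ p \<le> (24 * real p) ^ p * exp (q ^ 4 / 24)"
    using assms by (simp add: power_divide power_mult_distrib field_simps)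
  moreover have "q ^ p \<le> 1 + (q ^ 4) ^ p"
  proof (cases "q \<le> 1")
    case True
    then have "q ^ p \<le> 1" using assms by (simp add: power_le_one)
    then show ?thesis using assms by (simp add: add_increasing2)
  next
    case False
    then have "q ^ p \<le> q ^ (4 * p)" by (intro power_increasing) auto
    then show ?thesis by (simp add: power_mult)
  qed
  ultimately have "q ^ p \<le> 1 + (24 * real p) ^ p * exp (q ^ 4 / 24)" by linarith
  then have "q ^ p * exp (- (q ^ 4 / 24)) \<le> (1 + (24 * real p) ^ p * exp (q ^ 4 / 24)) * exp (- (q ^ 4 / 24))"
    by (intro mult_right_mono) auto
  also have "\<dots> = exp (- (q ^ 4 / 24)) + (24 * real p) ^ p" by (simp add: algebra_simps exp_minus)
  also have "\<dots> \<le> 1 + (24 * real p) ^ p" by simp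
  finally show ?thesis .
qed

text \<open>Split \<open>w = sqrt w * sqrt w\<close>. One factor is at most \<open>exp (- q ^ 4 / 24)\<close> with
  \<open>q = sqrt N * \<bar>u\<bar>\<close> and absorbs the moment \<open>q ^ p\<close>. The other has at most twice the mass of \<open>w\<close>, by
  \<open>cw_density_doubling\<close>, so the normalising constant cancels, uniformly in \<open>\<beta> \<le> 1\<close>.\<close>

lemma tilt_moment:
  assumes b: "0 \<le> \<beta>" "\<beta> \<le> 1" and N: "N > 0" and p: "p > 0"
  shows "(\<integral>\<^sup>+t. ennreal (\<bar>cw_tilt \<beta> (N\<^sup>2) t\<bar> ^ p) \<partial>cw_mixing \<beta> (N\<^sup>2))
     \<le> ennreal (2 * (1 + (24 * real p) ^ p) * real N powr (- (real p / 2)))"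
proof -
  let ?n = "N\<^sup>2" and ?C = "1 + (24 * real p) ^ p"
  let ?w = "cw_density \<beta> ?n" and ?u = "cw_tilt \<beta> ?n"
  have n: "?n > 0" using N by simp
  have C: "?C \<ge> 0" by (simp add: add_nonneg_nonneg)
  have NN: "real N powr (- (real p / 2)) = 1 / sqrt (real N) ^ p"
    using N by (simp add: powr_minus_divide powr_half_sqrt[symmetric] powr_realpow[symmetric] powr_powr)
  have pw: "?w t * \<bar>?u t\<bar> ^ p \<le> ?C * real N powr (- (real p / 2)) * sqrt (?w t)" for t
  proof -
    let ?q = "sqrt (real N) * \<bar>?u t\<bar>"
    have q4: "?q ^ 4 = real ?n * ?u t ^ 4"
    proof -
      have "sqrt (real N) ^ 4 = (sqrt (real N) ^ 2) ^ 2" by (simp only: power_mult[symmetric]) simp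
      then show ?thesis by (simp add: power_mult_distrib)
    qed
    have "sqrt (?w t) \<le> sqrt (exp (- (real ?n * ?u t ^ 4 / 12)))" by (intro real_sqrt_le_mono cw_density_le_tanh b n)
    also have "\<dots> = exp (- (?q ^ 4 / 24))"
    proof -
      have "exp (- (real ?n * ?u t ^ 4 / 12)) = (exp (- (?q ^ 4 / 24)))\<^sup>2"
        unfolding q4 by (simp flip: exp_double)
      then show ?thesis by simp
    qed
    finally have "?q ^ p * sqrt (?w t) \<le> ?q ^ p * exp (- (?q ^ 4 / 24))" by (intro mult_left_mono) auto
    also have "\<dots> \<le> ?C" by (intro power_exp_bound p) auto
    finally have "sqrt (real N) ^ p * (\<bar>?u t\<bar> ^ p * sqrt (?w t)) \<le> ?C" by (simp add: power_mult_distrib mult_ac)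
    then have "\<bar>?u t\<bar> ^ p * sqrt (?w t) \<le> ?C * (1 / sqrt (real N) ^ p)" using N by (simp add: field_simps)
    then have "\<bar>?u t\<bar> ^ p * sqrt (?w t) * sqrt (?w t) \<le> ?C * (1 / sqrt (real N) ^ p) * sqrt (?w t)"
      by (intro mult_right_mono) (auto simp: less_imp_le cw_density_pos)
    moreover have "?w t * \<bar>?u t\<bar> ^ p = \<bar>?u t\<bar> ^ p * sqrt (?w t) * sqrt (?w t)"
      using cw_density_pos[of \<beta> ?n t] by (simp add: mult.assoc)
    ultimately show ?thesis unfolding NN by (simp only:)
  qed
  \<comment> \<open>Substituting \<open>2 * t\<close> for \<open>t\<close> brings in \<open>cw_density_doubling\<close>.\<close>
  have half: "(\<integral>\<^sup>+t. ennreal (sqrt (?w t)) \<partial>lborel) \<le> 2 * ennreal (cw_mass \<beta> ?n)"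
  proof -
    have "(\<integral>\<^sup>+t. ennreal (sqrt (?w t)) \<partial>lborel) = ennreal \<bar>2\<bar> * (\<integral>\<^sup>+t. ennreal (sqrt (?w (0 + 2 * t))) \<partial>lborel)"
      by (rule nn_integral_real_affine) auto
    also have "\<dots> \<le> ennreal \<bar>2\<bar> * (\<integral>\<^sup>+t. ennreal (?w t) \<partial>lborel)"
    proof (intro mult_left_mono nn_integral_mono ennreal_leI)
      fix t
      have "sqrt (?w (0 + 2 * t)) \<le> sqrt ((?w t)\<^sup>2)" using cw_density_doubling[OF b n, of t] by (intro real_sqrt_le_mono) simp
      then show "sqrt (?w (0 + 2 * t)) \<le> ?w t" using cw_density_pos[of \<beta> ?n t] by simp
    qed auto
    finally show ?thesis by (simp add: cw_mass_eq)
  qed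
  have "(\<integral>\<^sup>+t. ennreal (\<bar>?u t\<bar> ^ p) \<partial>cw_mixing \<beta> ?n) = (\<integral>\<^sup>+t. ennreal (?w t) * ennreal (\<bar>?u t\<bar> ^ p) \<partial>lborel) / ennreal (cw_mass \<beta> ?n)"
    by (rule nn_integral_cw_mixing) measurable
  also have "(\<integral>\<^sup>+t. ennreal (?w t) * ennreal (\<bar>?u t\<bar> ^ p) \<partial>lborel) \<le> (\<integral>\<^sup>+t. ennreal (?C * real N powr (- (real p / 2))) * ennreal (sqrt (?w t)) \<partial>lborel)"
    using pw C cw_density_pos[of \<beta> ?n]
    by (intro nn_integral_mono) (simp add: ennreal_mult'[symmetric] less_imp_le ennreal_leI)
  also have "\<dots> = ennreal (?C * real N powr (- (real p / 2))) * (\<integral>\<^sup>+t. ennreal (sqrt (?w t)) \<partial>lborel)"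
    by (rule nn_integral_cmult) measurable
  also have "\<dots> \<le> ennreal (?C * real N powr (- (real p / 2))) * (2 * ennreal (cw_mass \<beta> ?n))"
    by (intro mult_left_mono half) auto
  also have "\<dots> / ennreal (cw_mass \<beta> ?n) = ennreal (2 * ?C * real N powr (- (real p / 2)))"
  proof -
    have "ennreal (?C * real N powr (- (real p / 2))) * (2 * ennreal (cw_mass \<beta> ?n)) = ennreal (?C * real N powr (- (real p / 2)) * (2 * cw_mass \<beta> ?n))"
      using C cw_mass_pos[of \<beta> ?n] by (simp add: ennreal_mult less_imp_le)
    then show ?thesis using C cw_mass_pos[of \<beta> ?n] by (simp add: divide_ennreal less_imp_le)
  qed
  finally show ?thesis by (simp add: divide_right_mono_ennreal)
qed

section \<open>Curie-Weiss ensembles are of Curie-Weiss type\<close>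

definition sign_measure :: "real \<Rightarrow> real measure" where
  "sign_measure u = distr (measure_pmf (sign_pmf u)) borel (\<lambda>x. x)"

lemma sets_sign_measure [simp, measurable_cong]: "sets (sign_measure u) = sets borel"
  by (simp add: sign_measure_def)

lemma prob_space_sign_measure: "prob_space (sign_measure u)"
  unfolding sign_measure_def by (rule measure_pmf.prob_space_distr) simp

lemma integral_sign_measure:
  fixes f :: "real \<Rightarrow> real"
  assumes "\<bar>u\<bar> \<le> 1" "f \<in> borel_measurable borel"
  shows "(\<integral>x. f x \<partial>sign_measure u) = (1 + u) / 2 * f 1 + (1 - u) / 2 * f (-1)"
proof -
  have b: "0 \<le> (1 + u) / 2" "(1 + u) / 2 \<le> 1" using assms(1) by auto
  have "(\<integral>x. f x \<partial>sign_measure u) = (\<integral>x. f x \<partial>sign_pmf u)"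
    unfolding sign_measure_def by (rule integral_distr) (use assms(2) in auto)
  also have "\<dots> = (\<integral>c. f (if c then 1 else -1) \<partial>bernoulli_pmf ((1 + u) / 2))"
    unfolding sign_pmf_def by (rule integral_map_pmf)
  also have "\<dots> = f 1 * ((1 + u) / 2) + f (-1) * (1 - (1 + u) / 2)" using b by simp
  also have "\<dots> = (1 + u) / 2 * f 1 + (1 - u) / 2 * f (-1)" by (simp add: field_simps)
  finally show ?thesis .
qed

lemma nn_integral_sign_measure:
  assumes "\<bar>u\<bar> \<le> 1" "\<And>x. f x \<ge> 0" "f \<in> borel_measurable borel"
  shows "(\<integral>\<^sup>+x. ennreal (f x) \<partial>sign_measure u) = ennreal ((1 + u) / 2 * f 1 + (1 - u) / 2 * f (-1))"
proof -
  have "(\<integral>\<^sup>+x. ennreal (f x) \<partial>sign_measure u) = (\<integral>\<^sup>+x. ennreal (f x) \<partial>sign_pmf u)"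
    unfolding sign_measure_def by (rule nn_integral_distr) (use assms(3) in auto)
  then show ?thesis using nn_integral_sign_pmf[OF assms(1,2)] by simp
qed

lemma sign_measure_moments:
  assumes "\<And>t. \<bar>g t\<bar> \<le> 1"
  shows "mixing_moment (\<lambda>t. sign_measure (g t)) 1 t = g t" "mixing_moment (\<lambda>t. sign_measure (g t)) 2 t = 1"
  unfolding mixing_moment_def using assms[of t]
  by (subst integral_sign_measure; simp add: field_simps)+

text \<open>The integral of \<open>f\<close> depends on \<open>t\<close> only through the values \<open>f 1\<close>, \<open>f (-1)\<close> and the continuous mean \<open>g t\<close>,
  so the map is continuous into the weak topology and hence measurable.\<close>

lemma sign_measure_mixing:
  assumes "prob_space T" "sets T = sets borel" "\<And>t :: real. \<bar>g t\<bar> \<le> 1" "continuous_on UNIV g"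
  shows "mixing_space T (\<lambda>t. sign_measure (g t))"
proof -
  have cont: "continuous_map euclidean weak_topology (\<lambda>t. sign_measure (g t))"
    unfolding weak_topology_def
  proof (rule continuous_on_generated_topo)
    fix W assume "W \<in> {{\<nu>. prob_space \<nu> \<and> sets \<nu> = sets borel \<and> (\<integral>x. f x \<partial>\<nu>) \<in> U} | (f :: real \<Rightarrow> real) (U :: real set).
        continuous_on UNIV f \<and> bounded (range f) \<and> open U}"
    then obtain f U where W: "W = {\<nu>. prob_space \<nu> \<and> sets \<nu> = sets borel \<and> (\<integral>x. f x \<partial>\<nu>) \<in> U}"
      and f: "continuous_on UNIV (f :: real \<Rightarrow> real)" and U: "open (U :: real set)" by blast
    have fm: "f \<in> borel_measurable borel" using f by (rule borel_measurable_continuous_onI)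
    have "(\<lambda>t. sign_measure (g t)) -` W \<inter> topspace euclidean = (\<lambda>t. (1 + g t) / 2 * f 1 + (1 - g t) / 2 * f (-1)) -` U"
      unfolding W by (auto simp: integral_sign_measure[OF assms(3) fm] prob_space_sign_measure)
    moreover have "open \<dots>"
      by (intro open_vimage U continuous_intros assms(4)) auto
    ultimately show "openin euclidean ((\<lambda>t. sign_measure (g t)) -` W \<inter> topspace euclidean)" by simp
  next
    have "sign_measure (g t) \<in> topspace weak_topology" for t
      by (simp add: topspace_weak_topology prob_space_sign_measure)
    then show "(\<lambda>t. sign_measure (g t)) ` topspace euclidean \<subseteq> \<Union> {{\<nu>. prob_space \<nu> \<and> sets \<nu> = sets borel \<and> (\<integral>x. f x \<partial>\<nu>) \<in> U} | (f :: real \<Rightarrow> real) (U :: real set).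
        continuous_on UNIV f \<and> bounded (range f) \<and> open U}"
      unfolding weak_topology_def topology_generated_by_topspace by blast
  qed
  have sp: "space T = UNIV" using sets_eq_imp_space_eq[OF assms(2)] by simp
  have "(\<lambda>t. sign_measure (g t)) \<in> T \<rightarrow>\<^sub>M weak_borel"
    unfolding weak_borel_def
  proof (rule measurable_measure_of)
    show "{U. openin weak_topology U} \<subseteq> Pow (topspace weak_topology)" using openin_subset by blast
    show "(\<lambda>t. sign_measure (g t)) \<in> space T \<rightarrow> topspace weak_topology"
      by (simp add: topspace_weak_topology prob_space_sign_measure)
    fix W assume "W \<in> {U. openin weak_topology U}"
    then have "openin euclidean {t \<in> topspace euclidean. sign_measure (g t) \<in> W}"
      using openin_continuous_map_preimage[OF cont] by blast
    then have "open ((\<lambda>t. sign_measure (g t)) -` W)" by (simp add: vimage_def)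
    then show "(\<lambda>t. sign_measure (g t)) -` W \<inter> space T \<in> sets T" unfolding assms(2) sp by simp
  qed
  then show ?thesis using assms(1) by (simp add: mixing_space_def)
qed

lemma PiM_sign_measure:
  assumes "finite I"
  shows "(\<Pi>\<^sub>M i\<in>I. sign_measure u) = distr (measure_pmf (sign_field I u)) (\<Pi>\<^sub>M i\<in>I. borel) (\<lambda>y. restrict y I)"
    (is "_ = ?R")
proof -
  interpret product_sigma_finite "\<lambda>_. sign_measure u"
    unfolding product_sigma_finite_def by (simp add: prob_space_imp_sigma_finite prob_space_sign_measure)
  have meas: "(\<lambda>y. restrict y I) \<in> measure_pmf (sign_field I u) \<rightarrow>\<^sub>M (\<Pi>\<^sub>M i\<in>I. (borel :: real measure))"
    by (simp add: space_PiM)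
  have "?R = (\<Pi>\<^sub>M i\<in>I. sign_measure u)"
  proof (rule PiM_eqI[OF assms])
    show "sets ?R = sets (\<Pi>\<^sub>M i\<in>I. sign_measure u)"
      by (simp, intro sets_PiM_cong) auto
    fix A assume A: "\<And>i. i \<in> I \<Longrightarrow> A i \<in> sets (sign_measure u)"
    then have A': "Pi\<^sub>E I A \<in> sets (\<Pi>\<^sub>M i\<in>I. (borel :: real measure))"
      using assms by (intro sets_PiM_I_finite) auto
    have "emeasure ?R (Pi\<^sub>E I A) = (\<integral>\<^sup>+y. indicator ((\<lambda>y. restrict y I) -` Pi\<^sub>E I A) y \<partial>sign_field I u)"
      using emeasure_distr[OF meas A'] by simp
    also have "\<dots> = (\<integral>\<^sup>+y. (\<Prod>i\<in>I. indicator (A i) (y i)) \<partial>sign_field I u)"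
    proof (rule nn_integral_cong)
      fix y
      show "indicator ((\<lambda>y. restrict y I) -` Pi\<^sub>E I A) y = (\<Prod>i\<in>I. indicator (A i) (y i) :: ennreal)"
        using assms by (auto simp: indicator_def PiE_iff prod.If_cases split: if_splits)
    qed
    also have "\<dots> = (\<Prod>i\<in>I. \<integral>\<^sup>+x. indicator (A i) x \<partial>sign_pmf u)" by (rule nn_integral_prod_Pi_pmf[OF assms])
    also have "\<dots> = (\<Prod>i\<in>I. emeasure (sign_measure u) (A i))"
      using A by (intro prod.cong refl) (simp add: sign_measure_def emeasure_distr)
    finally show "emeasure ?R (Pi\<^sub>E I A) = (\<Prod>i\<in>I. emeasure (sign_measure u) (A i))" .
  qed
  then show ?thesis by simp
qed

text \<open>A marginal of a mixture of products is the mixture of the marginals, which lets \<open>I\<close> be smaller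
  than the index set \<open>J\<close> of all spins.\<close>

lemma curie_weiss_de_finetti:
  assumes cw: "curie_weiss_distributed \<beta> J \<Omega> X" and J: "finite J" "J \<noteq> {}" "I \<subseteq> J" and b: "\<beta> \<ge> 0"
  shows "de_finetti_type I \<Omega> X (cw_mixing \<beta> (card J)) (\<lambda>t. sign_measure (cw_tilt \<beta> (card J) t))"
  unfolding de_finetti_type_def
proof (intro conjI ballI)
  show fin: "finite I" using J finite_subset by blast
  show "prob_space \<Omega>" using cw by (simp add: curie_weiss_distributed_def)
  have X: "\<And>i. i \<in> J \<Longrightarrow> X i \<in> borel_measurable \<Omega>" using cw by (simp add: curie_weiss_distributed_def)
  show "X i \<in> borel_measurable \<Omega>" if "i \<in> I" for i using X that J by auto
  show "mixing_space (cw_mixing \<beta> (card J)) (\<lambda>t. sign_measure (cw_tilt \<beta> (card J) t))"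
    by (intro sign_measure_mixing prob_space_cw_mixing sets_cw_mixing cw_tilt_le continuous_cw_tilt)
  fix B assume B: "B \<in> sets (\<Pi>\<^sub>M i\<in>I. (borel :: real measure))"
  let ?Q = "\<lambda>y. restrict y I \<in> B"
  let ?u = "cw_tilt \<beta> (card J)"
  have XI: "(\<lambda>\<omega>. \<lambda>i\<in>I. X i \<omega>) \<in> \<Omega> \<rightarrow>\<^sub>M (\<Pi>\<^sub>M i\<in>I. borel)"
    using X J by (intro measurable_restrict) auto
  have "{\<omega> \<in> space \<Omega>. ?Q (\<lambda>i. X i \<omega>)} \<in> sets \<Omega>"
    using measurable_sets[OF XI B] by (simp add: vimage_def Int_def conj_commute)
  moreover have "?Q y = ?Q y'" if "\<And>i. i \<in> J \<Longrightarrow> y i = y' i" for y y' :: "'a \<Rightarrow> real"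
  proof -
    have "restrict y I = restrict y' I" using that J by (intro restrict_ext) auto
    then show ?thesis by simp
  qed
  ultimately have "emeasure \<Omega> {\<omega> \<in> space \<Omega>. ?Q (\<lambda>i. X i \<omega>)}
     = (\<integral>\<^sup>+t. emeasure (sign_field J (?u t)) {y. ?Q y} \<partial>cw_mixing \<beta> (card J))"
    by (rule curie_weiss_mixture[OF cw J(1,2) b])
  also have "\<dots> = (\<integral>\<^sup>+t. emeasure (\<Pi>\<^sub>M i\<in>I. sign_measure (?u t)) B \<partial>cw_mixing \<beta> (card J))"
  proof (rule nn_integral_cong)
    fix t
    let ?r = "\<lambda>f x. if x \<in> I then f x else undefined"
    have meas: "(\<lambda>y. restrict y I) \<in> measure_pmf (sign_field I (?u t)) \<rightarrow>\<^sub>M (\<Pi>\<^sub>M i\<in>I. (borel :: real measure))"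
      by (simp add: space_PiM)
    have "emeasure (\<Pi>\<^sub>M i\<in>I. sign_measure (?u t)) B = emeasure (sign_field I (?u t)) {y. ?Q y}"
      unfolding PiM_sign_measure[OF fin] using emeasure_distr[OF meas B] by (simp add: vimage_def)
    also have "\<dots> = emeasure (sign_field J (?u t)) (?r -` {y. ?Q y})"
      unfolding Pi_pmf_subset[OF J(1,3), of undefined "\<lambda>_. sign_pmf (?u t)"] by simp
    also have "?r -` {y. ?Q y} = {y. ?Q y}"
    proof -
      have r: "restrict (?r f) I = restrict f I" for f by (intro restrict_ext) auto
      show ?thesis unfolding vimage_def mem_Collect_eq r ..
    qed
    finally show "emeasure (sign_field J (?u t)) {y. ?Q y} = emeasure (\<Pi>\<^sub>M i\<in>I. sign_measure (?u t)) B" by simp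
  qed
  finally show "emeasure \<Omega> {\<omega> \<in> space \<Omega>. (\<lambda>i\<in>I. X i \<omega>) \<in> B} = (\<integral>\<^sup>+t. emeasure (\<Pi>\<^sub>M i\<in>I. sign_measure (?u t)) B \<partial>cw_mixing \<beta> (card J))" .
qed

lemma sign_measure_central_moments:
  assumes u: "\<bar>u\<bar> \<le> 1" and p: "p > 0"
  shows "(\<integral>\<^sup>+y. ennreal (\<bar>y - u\<bar> ^ p) \<partial>sign_measure u) \<le> ennreal (2 ^ p)"
    and "(\<integral>\<^sup>+y. ennreal (\<bar>y\<^sup>2 - 1\<bar> ^ p) \<partial>sign_measure u) = 0"
proof -
  have "(\<integral>\<^sup>+y. ennreal (\<bar>y - u\<bar> ^ p) \<partial>sign_measure u) = ennreal ((1 + u) / 2 * \<bar>1 - u\<bar> ^ p + (1 - u) / 2 * \<bar>-1 - u\<bar> ^ p)"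
    by (rule nn_integral_sign_measure[OF u]) auto
  also have "\<dots> \<le> ennreal ((1 + u) / 2 * 2 ^ p + (1 - u) / 2 * 2 ^ p)"
    using u by (intro ennreal_leI add_mono mult_left_mono power_mono) auto
  also have "(1 + u) / 2 * 2 ^ p + (1 - u) / 2 * 2 ^ p = (2 ^ p :: real)" by (simp add: field_simps)
  finally show "(\<integral>\<^sup>+y. ennreal (\<bar>y - u\<bar> ^ p) \<partial>sign_measure u) \<le> ennreal (2 ^ p)" .
  show "(\<integral>\<^sup>+y. ennreal (\<bar>y\<^sup>2 - 1\<bar> ^ p) \<partial>sign_measure u) = 0"
    using p by (subst nn_integral_sign_measure[OF u]) (auto simp: power_0_left)
qed

text \<open>The spins square to \<open>1\<close>, so the second moments contribute nothing and only the mean has to be estimated,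
  with \<open>N\<^sup>2\<close> spins in \<open>tilt_moment\<close>.\<close>

lemma curie_weiss_ensemble_type:
  assumes b: "0 \<le> \<beta>" "\<beta> \<le> 1" and ens: "curie_weiss_ensemble \<beta> M H"
  shows "curie_weiss_type TYPE(real) M H"
proof -
  have "\<forall>N. \<exists>X :: nat \<times> nat \<Rightarrow> 'a \<Rightarrow> real. N \<ge> 1 \<longrightarrow> curie_weiss_distributed \<beta> ({..<N} \<times> {..<N}) (M N) X \<and>
      (\<forall>\<omega>\<in>space (M N). H N \<omega> =
        Matrix.mat N N (\<lambda>(i, j). 1 / sqrt (real N) * (if i \<le> j then X (i, j) \<omega> else X (j, i) \<omega>)))"
    using ens unfolding curie_weiss_ensemble_def by blast
  from choice[OF this] obtain X where XH: "\<And>N. N \<ge> 1 \<Longrightarrow> curie_weiss_distributed \<beta> ({..<N} \<times> {..<N}) (M N) (X N) \<and>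
      (\<forall>\<omega>\<in>space (M N). H N \<omega> =
        Matrix.mat N N (\<lambda>(i, j). 1 / sqrt (real N) * (if i \<le> j then X N (i, j) \<omega> else X N (j, i) \<omega>)))"
    by blast
  have X: "\<And>N. N \<ge> 1 \<Longrightarrow> curie_weiss_distributed \<beta> ({..<N} \<times> {..<N}) (M N) (X N)"
    and H: "\<And>N \<omega>. N \<ge> 1 \<Longrightarrow> \<omega> \<in> space (M N) \<Longrightarrow> H N \<omega> =
      Matrix.mat N N (\<lambda>(i, j). 1 / sqrt (real N) * (if i \<le> j then X N (i, j) \<omega> else X N (j, i) \<omega>))"
    using XH by blast+
  have card: "card ({..<N} \<times> {..<N}) = N\<^sup>2" for N :: nat by (simp add: power2_eq_square)
  let ?T = "\<lambda>N. cw_mixing \<beta> (N\<^sup>2)" and ?P = "\<lambda>N t. sign_measure (cw_tilt \<beta> (N\<^sup>2) t)"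
  show ?thesis
    unfolding curie_weiss_type_def
  proof (rule exI[of _ X], rule exI[of _ ?T], rule exI[of _ ?P], intro conjI allI impI ballI)
    fix N :: nat and \<omega> assume N: "N \<ge> 1" and w: "\<omega> \<in> space (M N)"
    show "H N \<omega> \<in> carrier_mat N N" unfolding H[OF N w] by simp
    show "transpose_mat (H N \<omega>) = H N \<omega>" unfolding H[OF N w] by (rule eq_matI) auto
    fix i j :: nat assume "i \<le> j" "j < N"
    then show "H N \<omega> $$ (i, j) = 1 / sqrt (real N) * X N (i, j) \<omega>" unfolding H[OF N w] by simp
  next
    fix N :: nat assume N: "N \<ge> 1"
    have "{(i, j). i \<le> j \<and> j < N} \<subseteq> {..<N} \<times> {..<N}" by auto
    from curie_weiss_de_finetti[OF X[OF N] _ _ this b(1)]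
    show "de_finetti_type {(i, j). i \<le> j \<and> j < N} (M N) (X N) (?T N) (?P N)"
      unfolding card using N by (simp add: lessThan_empty_iff)
  next
    fix p :: nat assume p: "p > 0" "even p"
    let ?C = "2 * (1 + (24 * real p) ^ p)"
    show "\<exists>K\<ge>0. \<forall>N\<ge>1.
       (\<integral>\<^sup>+t. ennreal (\<bar>mixing_moment (?P N) 1 t\<bar> ^ p) \<partial>?T N) \<le> ennreal (K * real N powr (- (real p / 2))) \<and>
       (\<integral>\<^sup>+t. ennreal (\<bar>1 - mixing_moment (?P N) 2 t\<bar> ^ p) \<partial>?T N) \<le> ennreal (K * real N powr (- (real p / 2))) \<and>
       (SUP t\<in>space (?T N). \<integral>\<^sup>+y. ennreal (\<bar>y - mixing_moment (?P N) 1 t\<bar> ^ p) \<partial>?P N t) \<le> ennreal K \<and>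
       (SUP t\<in>space (?T N). \<integral>\<^sup>+y. ennreal (\<bar>y\<^sup>2 - mixing_moment (?P N) 2 t\<bar> ^ p) \<partial>?P N t) \<le> ennreal K"
    proof (intro exI[of _ "?C + 2 ^ p"] conjI allI impI)
      have C0: "?C \<ge> 0" by (simp add: add_nonneg_nonneg)
      then show "0 \<le> ?C + 2 ^ p" by (rule add_nonneg_nonneg) simp
      fix N :: nat assume N: "N \<ge> 1"
      note mom = sign_measure_moments[of "cw_tilt \<beta> (N\<^sup>2)", OF cw_tilt_le]
      have "(\<integral>\<^sup>+t. ennreal (\<bar>cw_tilt \<beta> (N\<^sup>2) t\<bar> ^ p) \<partial>?T N) \<le> ennreal (?C * real N powr (- (real p / 2)))"
        using N p by (intro tilt_moment b) auto
      also have "\<dots> \<le> ennreal ((?C + 2 ^ p) * real N powr (- (real p / 2)))"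
        by (intro ennreal_leI mult_right_mono) auto
      finally show "(\<integral>\<^sup>+t. ennreal (\<bar>mixing_moment (?P N) 1 t\<bar> ^ p) \<partial>?T N) \<le> ennreal ((?C + 2 ^ p) * real N powr (- (real p / 2)))"
        unfolding mom .
      show "(\<integral>\<^sup>+t. ennreal (\<bar>1 - mixing_moment (?P N) 2 t\<bar> ^ p) \<partial>?T N) \<le> ennreal ((?C + 2 ^ p) * real N powr (- (real p / 2)))"
        unfolding mom using p by (simp add: power_0_left)
      show "(SUP t\<in>space (?T N). \<integral>\<^sup>+y. ennreal (\<bar>y - mixing_moment (?P N) 1 t\<bar> ^ p) \<partial>?P N t) \<le> ennreal (?C + 2 ^ p)"
        unfolding mom
        by (intro SUP_least order_trans[OF sign_measure_central_moments(1)] ennreal_leI cw_tilt_le p(1)) (use C0 in simp)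
      show "(SUP t\<in>space (?T N). \<integral>\<^sup>+y. ennreal (\<bar>y\<^sup>2 - mixing_moment (?P N) 2 t\<bar> ^ p) \<partial>?P N t) \<le> ennreal (?C + 2 ^ p)"
        unfolding mom sign_measure_central_moments(2)[OF cw_tilt_le p(1)] by simp
    qed
  qed
qed

section \<open>The local law for the Curie-Weiss ensemble\<close>

definition sym_ext :: "(nat \<times> nat \<Rightarrow> real) \<Rightarrow> nat \<Rightarrow> nat \<Rightarrow> real" where
  "sym_ext y i j = (if i \<le> j then y (i, j) else y (j, i))"

text \<open>The position in the upper triangle that determines the entries \<open>(i, k)\<close> and \<open>(k, i)\<close>.\<close>

definition row_entry :: "nat \<Rightarrow> nat \<Rightarrow> nat \<times> nat" where
  "row_entry i k = (min i k, max i k)"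

abbreviation wigner_mat :: "nat \<Rightarrow> (nat \<times> nat \<Rightarrow> real) \<Rightarrow> real mat" where
  "wigner_mat N y \<equiv> Matrix.mat N N (\<lambda>(i, j). wigner N (sym_ext y) i j)"

lemma sym_ext_row: "sym_ext y i k = y (row_entry i k)"
  by (auto simp: sym_ext_def row_entry_def min_def max_def)

lemma sym_ext_sym: "sym_on N (wigner N (sym_ext y))"
  by (auto simp: sym_on_def wigner_def sym_ext_def)

lemma inj_row_entry: "inj_on (row_entry i) A"
  by (auto simp: inj_on_def row_entry_def min_def max_def split: if_splits)

text \<open>The independence behind the large deviation bounds: the minor does not see the signs of row \<open>i\<close>.\<close>

lemma minor_res_row_invariant:
  "minor_res N (sym_ext (y(row_entry i q := x))) z i = minor_res N (sym_ext y) z i"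
proof -
  have "isolate i (wigner N (sym_ext (y(row_entry i q := x)))) = isolate i (wigner N (sym_ext y))"
    by (intro ext) (auto simp: isolate_def wigner_def sym_ext_def row_entry_def min_def max_def)
  then show ?thesis by (intro ext) (simp add: minor_res_def)
qed

lemma minor_res_sym:
  assumes "Im z > 0" "k < N" "l < N"
  shows "minor_res N (sym_ext y) z i k l = minor_res N (sym_ext y) z i l k"
  using green_sym[OF sym_on_isolate[OF sym_ext_sym] assms] by (auto simp: minor_res_def)

lemma large_deviation_prob:
  fixes N :: nat
  defines "J \<equiv> {..<N} \<times> {..<N}"
  assumes m: "\<bar>m\<bar> \<le> 1" and phi: "\<bar>m\<bar> * sqrt (real N) \<le> \<phi>" and z: "Im z > 0" and N: "N \<ge> 1"
  shows "measure (sign_field J m) {y. \<not> large_deviation_bounds \<phi> N (sym_ext y) z} \<le> 12 * (real N)\<^sup>2 * exp (1 / 2 - 2 * \<phi>)"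
proof -
  let ?P = "sign_field J m" and ?e = "exp (1 / 2 - 2 * \<phi>)"
  have J: "finite J" by (simp add: J_def)
  have h: "row_entry i ` {..<N} \<subseteq> J" if "i < N" for i using that by (auto simp: row_entry_def J_def min_def max_def)
  let ?A = "\<lambda>i. {y. cmod (row_form N (sym_ext y) z i) > 72 * \<phi>\<^sup>2 * sqrt (\<Sum>k<N. \<Sum>l<N. (cmod (minor_res N (sym_ext y) z i k l))\<^sup>2)}"
  let ?B = "\<lambda>i j. {y. cmod (row_sum N (sym_ext y) z i j) > 6 * \<phi> * sqrt (\<Sum>k<N. (cmod (minor_res N (sym_ext y) z i k j))\<^sup>2)}"
  have A: "measure ?P (?A i) \<le> 4 * (real N + 1) * ?e" if i: "i < N" for i
    unfolding row_form_def sym_ext_row[of _ i]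
    by (rule quadratic_form_tail[OF J m inj_row_entry h[OF i] _ _ phi]) (simp_all add: minor_res_row_invariant minor_res_sym[OF z])
  have B: "measure ?P (?B i j) \<le> 4 * ?e" if i: "i < N" for i j
    unfolding row_sum_def sym_ext_row[of _ i]
    by (rule linear_form_tail[OF J m inj_row_entry h[OF i] _ _ _ _ phi]) (simp_all add: minor_res_row_invariant sum_nonneg)
  have "{y. \<not> large_deviation_bounds \<phi> N (sym_ext y) z} \<subseteq> (\<Union>i<N. ?A i \<union> (\<Union>j<N. ?B i j))"
    by (auto simp: large_deviation_bounds_def not_le)
  then have "measure ?P {y. \<not> large_deviation_bounds \<phi> N (sym_ext y) z} \<le> measure ?P (\<Union>i<N. ?A i \<union> (\<Union>j<N. ?B i j))"
    by (intro measure_pmf.finite_measure_mono) auto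
  also have "\<dots> \<le> (\<Sum>i<N. measure ?P (?A i \<union> (\<Union>j<N. ?B i j)))" by (rule measure_UNION_le) auto
  also have "\<dots> \<le> (\<Sum>i<N. 4 * (real N + 1) * ?e + real N * (4 * ?e))"
  proof (rule sum_mono)
    fix i assume i: "i \<in> {..<N}"
    have "measure ?P (?A i \<union> (\<Union>j<N. ?B i j)) \<le> measure ?P (?A i) + measure ?P (\<Union>j<N. ?B i j)" by (rule measure_Un_le) auto
    also have "measure ?P (\<Union>j<N. ?B i j) \<le> (\<Sum>j<N. measure ?P (?B i j))" by (rule measure_UNION_le) auto
    also have "\<dots> \<le> (\<Sum>j<N. 4 * ?e)" using i by (intro sum_mono B) auto
    finally show "measure ?P (?A i \<union> (\<Union>j<N. ?B i j)) \<le> 4 * (real N + 1) * ?e + real N * (4 * ?e)"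
      using A[of i] i by simp
  qed
  also have "\<dots> = (8 * (real N)\<^sup>2 + 4 * real N) * ?e" by (simp add: power2_eq_square algebra_simps)
  also have "\<dots> \<le> 12 * (real N)\<^sup>2 * ?e"
    using N by (intro mult_right_mono) (auto simp: power2_eq_square)
  finally show ?thesis .
qed

lemma local_law_error_le:
  assumes N: "N \<ge> 1"
    and "cmod (avg_res N A z - stieltjes semicircle z) \<le> R"
    and "\<And>i j. i < N \<Longrightarrow> j < N \<Longrightarrow> cmod (green N A z i j - (if i = j then stieltjes semicircle z else 0)) \<le> R"
  shows "local_law_error (Matrix.mat N N (\<lambda>(i, j). A i j)) z \<le> R"
proof -
  have ne: "{..<N} \<times> {..<N} \<noteq> {}" using N by (simp add: lessThan_empty_iff)
  have "resolvent_error (Matrix.mat N N (\<lambda>(i, j). A i j)) z \<le> R"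
    unfolding resolvent_error_def using assms(3) ne by (subst Max_le_iff) (auto simp: green_def)
  moreover have "resolvent_trace (Matrix.mat N N (\<lambda>(i, j). A i j)) z = avg_res N A z"
    by (simp add: resolvent_trace_def avg_res_def green_def)
  ultimately show ?thesis using assms(2) by (simp add: local_law_error_def)
qed

text \<open>The law for independent signs of a fixed small mean \<open>m\<close>. The grid has \<open>16 * N ^ 3 + 1\<close> points,
  reaching from \<open>z\<close> up to height \<open>Im z + 16\<close>.\<close>

lemma quenched_local_law:
  fixes N :: nat and b \<phi> m :: real and z :: complex
  defines "J \<equiv> {..<N} \<times> {..<N}"
  defines "\<delta> \<equiv> (b + 109) * \<phi>\<^sup>2 * control N z"
  assumes m: "\<bar>m\<bar> \<le> 1" and mphi: "\<bar>m\<bar> * sqrt (real N) \<le> \<phi>"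
    and N: "N \<ge> 16" and phi: "\<phi> \<ge> 1" and b: "b \<ge> 1"
    and z: "Im z > 0" "real N * Im z \<ge> 1" "cmod z \<le> b" "Im z + 16 \<le> b\<^sup>2"
    and small: "\<delta> \<le> 1 / 3200"
  shows "measure (sign_field J m)
      {y. local_law_error (wigner_mat N y) z > 150 * \<delta> / sqrt (edge_dist z + \<delta>) + 48 * \<delta>}
    \<le> (16 * real N ^ 3 + 1) * (12 * (real N)\<^sup>2 * exp (1 / 2 - 2 * \<phi>))"
proof -
  let ?P = "sign_field J m" and ?n = "16 * N ^ 3"
  let ?bad = "\<lambda>k. {y. \<not> large_deviation_bounds \<phi> N (sym_ext y) (grid_point N z k)}"
  let ?E = "{y. local_law_error (wigner_mat N y) z > 150 * \<delta> / sqrt (edge_dist z + \<delta>) + 48 * \<delta>}"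
  have N1: "N \<ge> 1" using N by simp
  have J: "finite J" by (simp add: J_def)
  have top: "Im (grid_point N z ?n) = Im z + 16" using N1 by simp
  have "?E \<inter> set_pmf ?P \<subseteq> (\<Union>k\<le>?n. ?bad k)"
  proof
    fix y assume y: "y \<in> ?E \<inter> set_pmf ?P"
    show "y \<in> (\<Union>k\<le>?n. ?bad k)"
    proof (rule ccontr)
      assume "\<not> ?thesis"
      then have ld: "large_deviation_bounds \<phi> N (sym_ext y) (grid_point N z k)" if "k \<le> ?n" for k using that by auto
      have "y \<in> J \<rightarrow>\<^sub>E {-1, 1}" using y set_Pi_sign[OF J, of m] by blast
      then have "y p \<in> {-1, 1}" if "p \<in> J" for p using that by (rule PiE_mem)
      then have "\<bar>y (i, j)\<bar> = 1" if "i < N" "j < N" for i j using that unfolding J_def by fastforce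
      then have s: "sign_matrix N (sym_ext y)"
        unfolding sign_matrix_def by (auto simp: sym_ext_def)
      note D = deterministic_local_law[OF s N phi b z(1-3) _ _ ld small[unfolded \<delta>_def], of ?n, folded \<delta>_def]
      have "local_law_error (wigner_mat N y) z \<le> 150 * \<delta> / sqrt (edge_dist z + \<delta>) + 48 * \<delta>"
        by (rule local_law_error_le[OF N1]; rule D) (use z top in auto)
      then show False using y by simp
    qed
  qed
  then have "measure ?P (?E \<inter> set_pmf ?P) \<le> measure ?P (\<Union>k\<le>?n. ?bad k)"
    by (intro measure_pmf.finite_measure_mono) auto
  also have "\<dots> \<le> (\<Sum>k\<le>?n. measure ?P (?bad k))" by (rule measure_UNION_le) auto
  also have "\<dots> \<le> (\<Sum>k\<le>?n. 12 * (real N)\<^sup>2 * exp (1 / 2 - 2 * \<phi>))"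
    unfolding J_def by (intro sum_mono large_deviation_prob m mphi N1) (use z(1) in \<open>simp add: add_pos_nonneg\<close>)
  also have "\<dots> = (16 * real N ^ 3 + 1) * (12 * (real N)\<^sup>2 * exp (1 / 2 - 2 * \<phi>))" by simp
  finally show ?thesis by (simp add: measure_Int_set_pmf)
qed

lemma det_measurable:
  fixes f :: "'a \<Rightarrow> nat \<Rightarrow> nat \<Rightarrow> complex"
  assumes "\<And>i j. i < n \<Longrightarrow> j < n \<Longrightarrow> (\<lambda>\<omega>. f \<omega> i j) \<in> borel_measurable M"
  shows "(\<lambda>\<omega>. Determinant.det (Matrix.mat n n (\<lambda>(i, j). f \<omega> i j))) \<in> borel_measurable M"
proof -
  have p: "p i < n" if "p permutes {0..<n}" "i < n" for p i
    using permutes_in_image[OF that(1), of i] that(2) by simp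
  have "Determinant.det (Matrix.mat n n (\<lambda>(i, j). f \<omega> i j)) = (\<Sum>p | p permutes {0..<n}. signof p * (\<Prod>i = 0..<n. f \<omega> i (p i)))" for \<omega>
    unfolding Determinant.det_def using p by (auto intro!: sum.cong prod.cong)
  moreover have "(\<lambda>\<omega>. \<Sum>p | p permutes {0..<n}. signof p * (\<Prod>i = 0..<n. f \<omega> i (p i))) \<in> borel_measurable M"
    using assms p by (intro borel_measurable_sum borel_measurable_times borel_measurable_prod) auto
  ultimately show ?thesis by simp
qed

text \<open>Cramer's rule expresses each entry as a rational function of the matrix entries.\<close>

lemma green_measurable:
  fixes A :: "'a \<Rightarrow> nat \<Rightarrow> nat \<Rightarrow> real"
  assumes A: "\<And>i j. i < N \<Longrightarrow> j < N \<Longrightarrow> (\<lambda>\<omega>. A \<omega> i j) \<in> borel_measurable M"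
    and S: "\<And>\<omega>. sym_on N (A \<omega>)" and z: "Im z > 0" and ij: "i < N" "j < N"
  shows "(\<lambda>\<omega>. green N (A \<omega>) z i j) \<in> borel_measurable M"
proof -
  define b where "b = (\<lambda>\<omega> i j. complex_of_real (A \<omega> i j) - (if i = j then z else 0))"
  define B where "B = (\<lambda>\<omega>. Matrix.mat N N (\<lambda>(i, j). b \<omega> i j))"
  have bm: "(\<lambda>\<omega>. b \<omega> i j) \<in> borel_measurable M" if "i < N" "j < N" for i j
    unfolding b_def using A[OF that] by measurable
  have Beq: "B \<omega> = map_mat complex_of_real (Matrix.mat N N (\<lambda>(i, j). A \<omega> i j)) - z \<cdot>\<^sub>m 1\<^sub>m N" for \<omega>
    unfolding B_def b_def by (rule eq_matI) auto
  have cof: "cofactor (B \<omega>) j i = (- 1) ^ (j + i) * Determinant.det (Matrix.mat (N - 1) (N - 1)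
      (\<lambda>(i', j'). b \<omega> (if i' < j then i' else Suc i') (if j' < i then j' else Suc j')))" for \<omega>
  proof -
    have "mat_delete (B \<omega>) j i = Matrix.mat (N - 1) (N - 1) (\<lambda>(i', j'). b \<omega> (if i' < j then i' else Suc i') (if j' < i then j' else Suc j'))"
      unfolding mat_delete_def B_def by (rule eq_matI) auto
    then show ?thesis by (simp add: cofactor_def)
  qed
  have eq: "green N (A \<omega>) z i j = cofactor (B \<omega>) j i / Determinant.det (B \<omega>)" for \<omega>
  proof -
    let ?R = "resolvent (Matrix.mat N N (\<lambda>(i, j). A \<omega> i j)) z"
    have Bc: "B \<omega> \<in> carrier_mat N N" by (simp add: B_def)
    have d: "Determinant.det (B \<omega>) \<noteq> 0" unfolding Beq by (rule resolvent_matrix_det(2)[OF S z])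
    have R: "B \<omega> * ?R = 1\<^sub>m N" "?R \<in> carrier_mat N N" unfolding Beq using resolvent_inverse[OF S z] by auto
    note adj = adj_mat[OF Bc]
    have "adj_mat (B \<omega>) = adj_mat (B \<omega>) * (B \<omega> * ?R)" using adj(1) unfolding R(1) by simp
    also have "\<dots> = (adj_mat (B \<omega>) * B \<omega>) * ?R" by (rule assoc_mult_mat[OF adj(1) Bc R(2), symmetric])
    also have "\<dots> = Determinant.det (B \<omega>) \<cdot>\<^sub>m ?R" unfolding adj(3) using R(2) by (simp add: mult_smult_assoc_mat[OF one_carrier_mat R(2)])
    finally have "adj_mat (B \<omega>) $$ (i, j) = (Determinant.det (B \<omega>) \<cdot>\<^sub>m ?R) $$ (i, j)" by simp
    then have "cofactor (B \<omega>) j i = Determinant.det (B \<omega>) * ?R $$ (i, j)"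
      using Bc R(2) ij by (simp add: adj_mat_def)
    then show ?thesis using d by (simp add: green_def)
  qed
  have "(\<lambda>\<omega>. Determinant.det (Matrix.mat (N - 1) (N - 1)
      (\<lambda>(i', j'). b \<omega> (if i' < j then i' else Suc i') (if j' < i then j' else Suc j')))) \<in> borel_measurable M"
    by (rule det_measurable) (use bm in auto)
  moreover have "(\<lambda>\<omega>. Determinant.det (B \<omega>)) \<in> borel_measurable M"
    unfolding B_def by (rule det_measurable) (use bm in auto)
  ultimately show ?thesis unfolding eq cof by measurable
qed

lemma local_law_error_measurable:
  fixes A :: "'a \<Rightarrow> nat \<Rightarrow> nat \<Rightarrow> real"
  assumes A: "\<And>i j. i < N \<Longrightarrow> j < N \<Longrightarrow> (\<lambda>\<omega>. A \<omega> i j) \<in> borel_measurable M"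
    and S: "\<And>\<omega>. sym_on N (A \<omega>)" and z: "Im z > 0"
  shows "(\<lambda>\<omega>. local_law_error (Matrix.mat N N (\<lambda>(i, j). A \<omega> i j)) z) \<in> borel_measurable M"
proof -
  have "local_law_error (Matrix.mat N N (\<lambda>(i, j). A \<omega> i j)) z
    = max (Max ((\<lambda>p. cmod (green N (A \<omega>) z (fst p) (snd p) - (if fst p = snd p then stieltjes semicircle z else 0))) ` ({..<N} \<times> {..<N})))
       (cmod ((\<Sum>i<N. green N (A \<omega>) z i i) / of_nat N - stieltjes semicircle z))" for \<omega>
    unfolding local_law_error_def resolvent_error_def resolvent_trace_def green_def by (simp add: case_prod_unfold)
  moreover have "(\<lambda>\<omega>. max (Max ((\<lambda>p. cmod (green N (A \<omega>) z (fst p) (snd p) - (if fst p = snd p then stieltjes semicircle z else 0))) ` ({..<N} \<times> {..<N})))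
       (cmod ((\<Sum>i<N. green N (A \<omega>) z i i) / of_nat N - stieltjes semicircle z))) \<in> borel_measurable M"
    using green_measurable[OF A S z]
    by (intro borel_measurable_max borel_measurable_Max borel_measurable_norm borel_measurable_diff borel_measurable_divide borel_measurable_sum) auto
  ultimately show ?thesis by simp
qed

lemma wigner_entry_measurable:
  assumes "curie_weiss_distributed \<beta> ({..<N} \<times> {..<N}) \<Omega> X" "i < N" "j < N"
  shows "(\<lambda>\<omega>. wigner N (sym_ext (\<lambda>q. X q \<omega>)) i j) \<in> borel_measurable \<Omega>"
proof -
  have "X q \<in> borel_measurable \<Omega>" if "q \<in> {..<N} \<times> {..<N}" for q
    using assms(1) that unfolding curie_weiss_distributed_def by blast
  from this[of "row_entry i j"] show ?thesis unfolding wigner_def sym_ext_row using assms(2,3)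
    by (intro borel_measurable_divide borel_measurable_const) (auto simp: row_entry_def min_def max_def)
qed

lemma curie_weiss_ensemble_wigner:
  assumes "curie_weiss_ensemble \<beta> M H" "N \<ge> 1"
  obtains X where "curie_weiss_distributed \<beta> ({..<N} \<times> {..<N}) (M N) X"
    and "\<And>\<omega>. \<omega> \<in> space (M N) \<Longrightarrow> H N \<omega> = wigner_mat N (\<lambda>q. X q \<omega>)"
proof -
  obtain X where X: "curie_weiss_distributed \<beta> ({..<N} \<times> {..<N}) (M N) X"
    and H: "\<And>\<omega>. \<omega> \<in> space (M N) \<Longrightarrow> H N \<omega> = Matrix.mat N N (\<lambda>(i, j). 1 / sqrt (real N) * (if i \<le> j then X (i, j) \<omega> else X (j, i) \<omega>))"
    using assms unfolding curie_weiss_ensemble_def by blast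
  have "H N \<omega> = wigner_mat N (\<lambda>q. X q \<omega>)" if "\<omega> \<in> space (M N)" for \<omega>
    unfolding H[OF that] by (rule eq_matI) (auto simp: wigner_def sym_ext_def)
  with X show ?thesis by (rule that)
qed

lemma local_law_error_nonneg: "local_law_error A z \<ge> 0"
  unfolding local_law_error_def by (simp add: le_max_iff_disj)

text \<open>Average of \<open>quenched_local_law\<close> over the mixing measure. Where the mean is too large, the probability is
  bounded by \<open>1 \<le> (\<bar>u\<bar> * sqrt N / \<phi>) ^ p\<close>, and \<open>tilt_moment\<close> estimates the average of the right-hand side.\<close>

lemma annealed_local_law:
  fixes N :: nat and b \<phi> \<beta> :: real and z :: complex
  defines "J \<equiv> {..<N} \<times> {..<N}"
  defines "\<delta> \<equiv> (b + 109) * \<phi>\<^sup>2 * control N z"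
  assumes cw: "curie_weiss_distributed \<beta> J \<Omega> X" and beta: "0 \<le> \<beta>" "\<beta> \<le> 1" and p: "p > 0"
    and N: "N \<ge> 16" and phi: "\<phi> \<ge> 1" and b: "b \<ge> 1"
    and z: "Im z > 0" "real N * Im z \<ge> 1" "cmod z \<le> b" "Im z + 16 \<le> b\<^sup>2"
    and small: "\<delta> \<le> 1 / 3200" and R: "150 * \<delta> / sqrt (edge_dist z + \<delta>) + 48 * \<delta> \<le> R"
  shows "emeasure \<Omega> {\<omega> \<in> space \<Omega>. local_law_error (wigner_mat N (\<lambda>q. X q \<omega>)) z > R}
    \<le> ennreal (2 * (1 + (24 * real p) ^ p) / \<phi> ^ p + (16 * real N ^ 3 + 1) * (12 * (real N)\<^sup>2 * exp (1 / 2 - 2 * \<phi>)))"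
proof -
  let ?err = "\<lambda>y. local_law_error (wigner_mat N y) z"
  let ?u = "cw_tilt \<beta> (N\<^sup>2)" and ?e = "(16 * real N ^ 3 + 1) * (12 * (real N)\<^sup>2 * exp (1 / 2 - 2 * \<phi>))"
  let ?C = "2 * (1 + (24 * real p) ^ p)"
  have J: "finite J" "J \<noteq> {}" using N by (auto simp: J_def lessThan_empty_iff)
  have card: "card J = N\<^sup>2" by (simp add: J_def power2_eq_square)
  have NN: "real N > 0" using N by simp
  have "(\<lambda>\<omega>. ?err (\<lambda>q. X q \<omega>)) \<in> borel_measurable \<Omega>"
    using cw unfolding J_def by (intro local_law_error_measurable wigner_entry_measurable sym_ext_sym z)
  then have meas: "{\<omega> \<in> space \<Omega>. ?err (\<lambda>q. X q \<omega>) > R} \<in> sets \<Omega>" by measurable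
  have dep: "(?err y > R) = (?err y' > R)" if "\<And>q. q \<in> J \<Longrightarrow> y q = y' q" for y y'
  proof -
    have "wigner_mat N y = wigner_mat N y'"
      using that by (intro eq_matI) (auto simp: wigner_def sym_ext_def J_def)
    then show ?thesis by simp
  qed
  have "emeasure \<Omega> {\<omega> \<in> space \<Omega>. ?err (\<lambda>q. X q \<omega>) > R} = (\<integral>\<^sup>+t. emeasure (sign_field J (?u t)) {y. ?err y > R} \<partial>cw_mixing \<beta> (N\<^sup>2))"
    using curie_weiss_mixture[OF cw J beta(1) meas dep] unfolding card by simp
  also have "\<dots> \<le> (\<integral>\<^sup>+t. ennreal ((sqrt (real N) / \<phi>) ^ p) * ennreal (\<bar>?u t\<bar> ^ p) + ennreal ?e \<partial>cw_mixing \<beta> (N\<^sup>2))"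
  proof (rule nn_integral_mono)
    fix t
    show "emeasure (sign_field J (?u t)) {y. ?err y > R} \<le> ennreal ((sqrt (real N) / \<phi>) ^ p) * ennreal (\<bar>?u t\<bar> ^ p) + ennreal ?e"
    proof (cases "\<bar>?u t\<bar> * sqrt (real N) \<le> \<phi>")
      case True
      have "measure (sign_field J (?u t)) {y. ?err y > R}
         \<le> measure (sign_field J (?u t)) {y. ?err y > 150 * \<delta> / sqrt (edge_dist z + \<delta>) + 48 * \<delta>}"
        using R by (intro measure_pmf.finite_measure_mono) auto
      also have "\<dots> \<le> ?e"
        unfolding J_def \<delta>_def by (rule quenched_local_law[OF cw_tilt_le True N phi b z small[unfolded \<delta>_def]])
      finally show ?thesis by (simp add: measure_pmf.emeasure_eq_measure ennreal_leI add_increasing)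
    next
      case False
      then have "1 \<le> sqrt (real N) / \<phi> * \<bar>?u t\<bar>" using phi by (simp add: field_simps)
      then have "1 \<le> (sqrt (real N) / \<phi> * \<bar>?u t\<bar>) ^ p" by (rule one_le_power)
      also have "\<dots> = (sqrt (real N) / \<phi>) ^ p * \<bar>?u t\<bar> ^ p" by (rule power_mult_distrib)
      finally have "ennreal 1 \<le> ennreal ((sqrt (real N) / \<phi>) ^ p * \<bar>?u t\<bar> ^ p)" by (rule ennreal_leI)
      then have "1 \<le> ennreal ((sqrt (real N) / \<phi>) ^ p) * ennreal (\<bar>?u t\<bar> ^ p)"
        using phi by (simp add: ennreal_mult)
      then show ?thesis using measure_pmf.emeasure_le_1 by (meson add_increasing2 order_trans zero_le)
    qed
  qed
  also have "\<dots> = ennreal ((sqrt (real N) / \<phi>) ^ p) * (\<integral>\<^sup>+t. ennreal (\<bar>?u t\<bar> ^ p) \<partial>cw_mixing \<beta> (N\<^sup>2)) + ennreal ?e"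
  proof -
    have "(\<integral>\<^sup>+t. ennreal ((sqrt (real N) / \<phi>) ^ p) * ennreal (\<bar>?u t\<bar> ^ p) + ennreal ?e \<partial>cw_mixing \<beta> (N\<^sup>2))
      = (\<integral>\<^sup>+t. ennreal ((sqrt (real N) / \<phi>) ^ p) * ennreal (\<bar>?u t\<bar> ^ p) \<partial>cw_mixing \<beta> (N\<^sup>2)) + (\<integral>\<^sup>+t. ennreal ?e \<partial>cw_mixing \<beta> (N\<^sup>2))"
      by (rule nn_integral_add) measurable
    also have "(\<integral>\<^sup>+t. ennreal ?e \<partial>cw_mixing \<beta> (N\<^sup>2)) = ennreal ?e"
      using prob_space.emeasure_space_1[OF prob_space_cw_mixing[of \<beta> "N\<^sup>2"]] by simp
    finally show ?thesis by (simp add: nn_integral_cmult)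
  qed
  also have "\<dots> \<le> ennreal ((sqrt (real N) / \<phi>) ^ p) * ennreal (?C * real N powr (- (real p / 2))) + ennreal ?e"
    using N by (intro add_right_mono mult_left_mono tilt_moment beta p) auto
  also have "\<dots> = ennreal ((sqrt (real N) / \<phi>) ^ p * (?C * real N powr (- (real p / 2))) + ?e)"
  proof -
    have g: "ennreal x * ennreal y + ennreal w = ennreal (x * y + w)" if "0 \<le> x" "0 \<le> y" "0 \<le> w" for x y w
      using that by (simp add: ennreal_mult)
    have "0 \<le> ?C" by (simp add: add_nonneg_nonneg)
    then show ?thesis using phi by (intro g mult_nonneg_nonneg) auto
  qed
  also have "(sqrt (real N) / \<phi>) ^ p * (?C * real N powr (- (real p / 2))) = ?C / \<phi> ^ p"
  proof -
    have "sqrt (real N) ^ p = real N powr (real p / 2)"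
      using NN by (simp add: powr_half_sqrt[symmetric] powr_realpow[symmetric] powr_powr)
    then show ?thesis using NN by (simp add: power_divide powr_minus_divide)
  qed
  finally show ?thesis .
qed

lemma powr_eventually_ge:
  fixes A c :: real
  assumes "c > 0"
  shows "\<exists>N0 \<ge> 1. \<forall>N \<ge> N0. A \<le> real N powr c"
proof (intro exI conjI allI impI)
  let ?A = "max A 1" and ?N0 = "nat \<lceil>max A 1 powr (1 / c)\<rceil> + 1"
  show "1 \<le> ?N0" by simp
  fix N assume "?N0 \<le> N"
  then have "?A powr (1 / c) \<le> real N" by linarith
  then have "(?A powr (1 / c)) powr c \<le> real N powr c" using assms by (intro powr_mono2) auto
  moreover have "(?A powr (1 / c)) powr c = ?A" using assms by (simp add: powr_powr)
  ultimately show "A \<le> real N powr c" by simp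
qed

text \<open>Choice of parameters: \<open>\<phi> = N powr \<alpha>\<close> with \<open>8 * \<alpha> = min \<epsilon> \<tau>\<close>. Being small against \<open>\<tau>\<close> it
  makes \<open>\<phi>\<^sup>2 * \<Psi>\<close> tend to \<open>0\<close>, and being small against \<open>\<epsilon>\<close> it lets
  \<open>N powr \<epsilon>\<close> absorb \<open>\<phi>\<^sup>2\<close> and all constants. The moment \<open>q\<close> is large enough that
  \<open>\<phi> ^ q\<close> exceeds \<open>N powr (D + 5)\<close>. The finitely many small \<open>N\<close> are covered by the constant. The factor
  \<open>sqrt \<tau>\<close> is there to serve both assertions of the theorem, since
  \<open>\<kappa> + \<eta> \<ge> \<tau>\<close> in the bulk.\<close>

lemma local_law_tail:
  assumes beta: "0 \<le> \<beta>" "\<beta> \<le> 1" and ens: "curie_weiss_ensemble \<beta> M H"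
    and tau: "0 < \<tau>" "\<tau> < 1" and eps: "\<epsilon> > 0" and D: "D > 0"
  shows "\<exists>C\<ge>0. \<forall>N\<ge>1. \<forall>z\<in>spectral_domain (1 / \<tau>) \<tau> N.
    emeasure (M N) {\<omega> \<in> space (M N). local_law_error (H N \<omega>) z > real N powr \<epsilon> * (sqrt \<tau> *
       (control N z / sqrt (edge_dist z + control N z)))}
    \<le> ennreal (C * real N powr (- D))"
proof -
  define \<alpha> where "\<alpha> = min \<epsilon> \<tau> / 8"
  define b where "b = 2 / \<tau> + 16"
  define K where "K = b + 109"
  define L where "L = 2 / \<tau> + 3"
  have al: "\<alpha> > 0" "\<tau> / 2 - 2 * \<alpha> > 0" "\<epsilon> - 2 * \<alpha> > 0" using eps tau by (auto simp: \<alpha>_def min_def)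
  have b1: "b \<ge> 16" using tau by (simp add: b_def)
  have K1: "K \<ge> 1" using b1 by (simp add: K_def)
  have L0: "L > 0" using tau by (simp add: L_def add_pos_pos)
  obtain N1 where N1: "\<And>N. N \<ge> N1 \<Longrightarrow> 3200 * K \<le> real N powr (\<tau> / 2 - 2 * \<alpha>)" using powr_eventually_ge[OF al(2)] by blast
  obtain N2 where N2: "\<And>N. N \<ge> N2 \<Longrightarrow> K * (150 + 48 * sqrt L) / sqrt \<tau> \<le> real N powr (\<epsilon> - 2 * \<alpha>)" using powr_eventually_ge[OF al(3)] by blast
  define N0 where "N0 = max 16 (max N1 N2)"
  obtain q :: nat where q: "real q > (D + 5) / \<alpha>" using reals_Archimedean2 by blast
  have q0: "q > 0" using q al D by (metis add_pos_pos divide_pos_pos not_gr_zero of_nat_0 order_less_asym zero_less_numeral)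
  have aq: "\<alpha> * real q \<ge> D + 5" using q al by (simp add: pos_divide_less_eq mult.commute)
  define C where "C = 2 * (1 + (24 * real q) ^ q) + 408 * real q ^ q + real N0 powr D"
  have C0: "C \<ge> 0" unfolding C_def by (simp add: add_nonneg_nonneg)
  show ?thesis
  proof (intro exI[of _ C] conjI C0 allI impI ballI)
    fix N :: nat and z assume N: "N \<ge> 1" and zd: "z \<in> spectral_domain (1 / \<tau>) \<tau> N"
    let ?x = "edge_dist z" and ?p = "control N z"
    obtain X where X: "curie_weiss_distributed \<beta> ({..<N} \<times> {..<N}) (M N) X"
      and H: "\<And>\<omega>. \<omega> \<in> space (M N) \<Longrightarrow> H N \<omega> = wigner_mat N (\<lambda>q. X q \<omega>)"
      by (rule curie_weiss_ensemble_wigner[OF ens N]) blast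
    interpret prob_space "M N" using X by (simp add: curie_weiss_distributed_def)
    let ?R = "real N powr \<epsilon> * (sqrt \<tau> * (?p / sqrt (?x + ?p)))"
    show "emeasure (M N) {\<omega> \<in> space (M N). local_law_error (H N \<omega>) z > ?R} \<le> ennreal (C * real N powr (- D))"
    proof (cases "N \<ge> N0")
      case False
      have "1 \<le> real N0 powr D * real N powr (- D)"
      proof -
        have "real N powr D \<le> real N0 powr D" using False D by (intro powr_mono2) auto
        then show ?thesis using N by (simp add: powr_minus_divide)
      qed
      also have "\<dots> \<le> C * real N powr (- D)" by (intro mult_right_mono) (auto simp: C_def add_nonneg_nonneg)
      finally have "ennreal 1 \<le> ennreal (C * real N powr (- D))" by (rule ennreal_leI)
      then have "1 \<le> ennreal (C * real N powr (- D))" by (simp only: ennreal_1)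
      then show ?thesis by (rule order_trans[OF emeasure_le_1])
    next
      case True
      then have N16: "N \<ge> 16" and n1: "N \<ge> N1" and n2: "N \<ge> N2" by (auto simp: N0_def)
      have NN: "real N \<ge> 1" using N by simp
      define \<phi> where "\<phi> = real N powr \<alpha>"
      have phi: "\<phi> \<ge> 1" unfolding \<phi>_def using NN al by (simp add: ge_one_powr_ge_zero)
      have phi2: "\<phi>\<^sup>2 = real N powr (2 * \<alpha>)" unfolding \<phi>_def using NN by (simp add: power2_eq_square flip: powr_add)
      have zr: "\<bar>Re z\<bar> \<le> 1 / \<tau>" "Im z \<le> 1 / \<tau>" "Im z \<ge> 1 / real N powr (1 - \<tau>)"
        using zd by (auto simp: spectral_domain_def)
      have zpos: "Im z > 0" using zr(3) NN by (smt (verit) powr_gt_zero zero_less_divide_1_iff)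
      have Neta: "real N * Im z \<ge> real N powr \<tau>"
      proof -
        have "real N powr \<tau> = real N * (1 / real N powr (1 - \<tau>))" using NN by (simp add: powr_diff)
        also have "\<dots> \<le> real N * Im z" using zr(3) by (intro mult_left_mono) auto
        finally show ?thesis .
      qed
      have Ntau: "real N powr \<tau> \<ge> 1" using NN tau by (simp add: ge_one_powr_ge_zero)
      have p: "?p \<le> real N powr (- (\<tau> / 2))"
      proof -
        have "real N powr (\<tau> / 2) = sqrt (real N powr \<tau>)" using NN by (simp add: powr_half_sqrt[symmetric] powr_powr)
        also have "\<dots> \<le> sqrt (real N * Im z)" using Neta by simp
        finally have "?p \<le> 1 / real N powr (\<tau> / 2)" using NN zpos by (intro divide_left_mono) auto
        then show ?thesis by (simp add: powr_minus_divide)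
      qed
      have sq1: "sqrt (real N * Im z) \<ge> 1" using Neta Ntau by simp
      have p0: "?p > 0" "?p \<le> 1" using NN zpos sq1 by (auto simp: divide_le_eq_1)
      define \<delta> where "\<delta> = K * \<phi>\<^sup>2 * ?p"
      have dp: "?p \<le> \<delta>"
      proof -
        have "1 * 1 \<le> K * \<phi>\<^sup>2" using K1 phi by (intro mult_mono) auto
        then show ?thesis unfolding \<delta>_def using mult_right_mono[of 1 "K * \<phi>\<^sup>2" ?p] p0 by simp
      qed
      have small: "\<delta> \<le> 1 / 3200"
      proof -
        have "\<delta> \<le> K * \<phi>\<^sup>2 * real N powr (- (\<tau> / 2))" unfolding \<delta>_def using K1 p by (intro mult_left_mono) auto
        also have "\<dots> = K / real N powr (\<tau> / 2 - 2 * \<alpha>)"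
          unfolding phi2 using NN by (simp add: powr_minus_divide powr_diff)
        also have "\<dots> \<le> 1 / 3200" using N1[OF n1] K1 NN by (simp add: divide_le_eq)
        finally show ?thesis .
      qed
      have cz: "cmod z \<le> b" using cmod_le[of z] zr zpos tau by (simp add: b_def)
      have ib: "Im z + 16 \<le> b\<^sup>2"
      proof -
        have "1 / \<tau> \<le> 2 / \<tau>" using tau by (intro divide_right_mono) auto
        then have "Im z + 16 \<le> b" using zr(2) unfolding b_def by linarith
        also have "b \<le> b\<^sup>2" using b1 by (simp add: power2_eq_square)
        finally show ?thesis .
      qed
      have N1': "real N * Im z \<ge> 1" using Neta Ntau by linarith
      have xpos: "?x > 0" using zpos by (simp add: add_nonneg_pos)
      have R: "150 * \<delta> / sqrt (?x + \<delta>) + 48 * \<delta> \<le> ?R"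
      proof -
        have s0: "sqrt (?x + ?p) > 0" using add_pos_pos[OF xpos p0(1)] by (simp only: real_sqrt_gt_0_iff)
        have d0: "\<delta> > 0" using p0(1) dp by linarith
        have s1: "sqrt (?x + \<delta>) > 0" using add_pos_pos[OF xpos d0] by (simp only: real_sqrt_gt_0_iff)
        have "150 * \<delta> / sqrt (?x + \<delta>) \<le> 150 * \<delta> / sqrt (?x + ?p)"
          using d0 by (intro divide_left_mono real_sqrt_le_mono add_left_mono dp mult_pos_pos s0 s1) simp
        moreover have "48 * \<delta> \<le> 48 * \<delta> * sqrt L / sqrt (?x + ?p)"
        proof -
          have "?x + ?p \<le> L"
          proof -
            have "\<bar>\<bar>Re z\<bar> - 2\<bar> \<le> 1 / \<tau> + 2" using zr(1) by linarith
            then show ?thesis using zr(2) p0(2) by (simp add: L_def)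
          qed
          then have "sqrt (?x + ?p) \<le> sqrt L" by simp
          then have "48 * \<delta> * sqrt (?x + ?p) \<le> 48 * \<delta> * sqrt L" using d0 by (intro mult_left_mono) auto
          then show ?thesis using s0 by (simp add: pos_le_divide_eq)
        qed
        ultimately have "150 * \<delta> / sqrt (?x + \<delta>) + 48 * \<delta> \<le> 150 * \<delta> / sqrt (?x + ?p) + 48 * \<delta> * sqrt L / sqrt (?x + ?p)" by linarith
        also have "\<dots> = (K * (150 + 48 * sqrt L)) * \<phi>\<^sup>2 * (?p / sqrt (?x + ?p))"
        proof -
          have "150 * (K * f * p) / s + 48 * (K * f * p) * l / s = (K * (150 + 48 * l)) * f * (p / s)" for f p s l :: real
            by (simp add: algebra_simps add_divide_distrib)
          then show ?thesis unfolding \<delta>_def .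
        qed
        also have "\<dots> \<le> (sqrt \<tau> * real N powr (\<epsilon> - 2 * \<alpha>)) * \<phi>\<^sup>2 * (?p / sqrt (?x + ?p))"
        proof (intro mult_right_mono)
          show "K * (150 + 48 * sqrt L) \<le> sqrt \<tau> * real N powr (\<epsilon> - 2 * \<alpha>)"
            using N2[OF n2] tau by (simp add: pos_divide_le_eq mult.commute)
        qed (use s0 p0 in auto)
        also have "\<dots> = ?R"
          unfolding phi2 using NN by (simp add: powr_diff)
        finally show ?thesis .
      qed
      have "emeasure (M N) {\<omega> \<in> space (M N). local_law_error (H N \<omega>) z > ?R}
        = emeasure (M N) {\<omega> \<in> space (M N). local_law_error (wigner_mat N (\<lambda>q. X q \<omega>)) z > ?R}"
        using H by (intro arg_cong[where f = "emeasure (M N)"]) auto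
      also have "\<dots> \<le> ennreal (2 * (1 + (24 * real q) ^ q) / \<phi> ^ q + (16 * real N ^ 3 + 1) * (12 * (real N)\<^sup>2 * exp (1 / 2 - 2 * \<phi>)))"
      proof (rule annealed_local_law[OF X beta q0 N16 phi _ zpos N1' cz ib])
        show "1 \<le> b" using b1 by simp
        show "(b + 109) * \<phi>\<^sup>2 * control N z \<le> 1 / 3200" using small by (simp add: \<delta>_def K_def)
        show "150 * ((b + 109) * \<phi>\<^sup>2 * control N z) / sqrt (?x + (b + 109) * \<phi>\<^sup>2 * control N z)
            + 48 * ((b + 109) * \<phi>\<^sup>2 * control N z) \<le> ?R"
          using R unfolding \<delta>_def K_def .
      qed
      also have "\<dots> \<le> ennreal (C * real N powr (- D))"
      proof (rule ennreal_leI)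
        have phq: "\<phi> ^ q = real N powr (\<alpha> * real q)" unfolding \<phi>_def using NN by (simp add: powr_powr flip: powr_realpow)
        have i5: "1 / \<phi> ^ q \<le> real N powr (- D) / real N ^ 5"
        proof -
          have "real N powr (D + 5) \<le> \<phi> ^ q" unfolding phq using aq NN by (intro powr_mono) auto
          then have "1 / \<phi> ^ q \<le> 1 / real N powr (D + 5)" using NN phi by (intro divide_left_mono) auto
          also have "\<dots> = real N powr (- D) / real N powr 5" using NN by (simp add: powr_minus_divide powr_add)
          also have "real N powr 5 = real N ^ 5" using NN powr_realpow[of "real N" 5] by simp
          finally show ?thesis .
        qed
        have i0: "1 / \<phi> ^ q \<le> real N powr (- D)"
        proof -
          have "real N powr (- D) / real N ^ 5 \<le> real N powr (- D) / 1" using NN by (intro divide_left_mono one_le_power) auto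
          then show ?thesis using i5 by simp
        qed
        have t1: "2 * (1 + (24 * real q) ^ q) / \<phi> ^ q \<le> 2 * (1 + (24 * real q) ^ q) * real N powr (- D)"
          using mult_left_mono[OF i0, of "2 * (1 + (24 * real q) ^ q)"] by (simp add: add_nonneg_nonneg)
        have ex: "exp (- (2 * \<phi>)) \<le> real q ^ q * (1 / \<phi> ^ q)"
        proof -
          have "(\<phi> / real q) ^ q \<le> (1 + 2 * \<phi> / real q) ^ q"
            using phi by (intro power_mono) (auto simp: divide_right_mono add_increasing)
          also have "\<dots> \<le> exp (2 * \<phi>)" using phi q0 by (intro exp_ge_one_plus_x_over_n_power_n) auto
          finally have "(\<phi> / real q) ^ q \<le> exp (2 * \<phi>)" .
          then have "1 / exp (2 * \<phi>) \<le> 1 / (\<phi> / real q) ^ q" using phi q0 by (intro divide_left_mono) auto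
          then show ?thesis by (simp add: exp_minus power_divide inverse_eq_divide)
        qed
        have "(16 * real N ^ 3 + 1) * (12 * (real N)\<^sup>2 * exp (1 / 2 - 2 * \<phi>)) \<le> (17 * real N ^ 3) * (12 * (real N)\<^sup>2 * (2 * (real q ^ q * (real N powr (- D) / real N ^ 5))))"
        proof (intro mult_mono mult_left_mono)
          show "16 * real N ^ 3 + 1 \<le> 17 * real N ^ 3" using NN by simp
          have "exp (1 / 2 - 2 * \<phi>) = exp (1 / 2) * exp (- (2 * \<phi>))" by (simp flip: exp_add)
          also have "\<dots> \<le> 2 * (real q ^ q * (real N powr (- D) / real N ^ 5))"
            using exp_half_le2 order_trans[OF ex mult_left_mono[OF i5]] by (intro mult_mono) auto
          finally show "exp (1 / 2 - 2 * \<phi>) \<le> 2 * (real q ^ q * (real N powr (- D) / real N ^ 5))" .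
        qed auto
        also have "\<dots> = 408 * real q ^ q * real N powr (- D)"
          using NN by (simp add: field_simps power2_eq_square power3_eq_cube eval_nat_numeral)
        finally have t2: "(16 * real N ^ 3 + 1) * (12 * (real N)\<^sup>2 * exp (1 / 2 - 2 * \<phi>)) \<le> 408 * real q ^ q * real N powr (- D)" .
        have "2 * (1 + (24 * real q) ^ q) / \<phi> ^ q + (16 * real N ^ 3 + 1) * (12 * (real N)\<^sup>2 * exp (1 / 2 - 2 * \<phi>))
          \<le> 2 * (1 + (24 * real q) ^ q) * real N powr (- D) + 408 * real q ^ q * real N powr (- D)" by (rule add_mono[OF t1 t2])
        also have "\<dots> = (2 * (1 + (24 * real q) ^ q) + 408 * real q ^ q) * real N powr (- D)" by (simp add: algebra_simps)
        also have "\<dots> \<le> C * real N powr (- D)" by (intro mult_right_mono) (auto simp: C_def)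
        finally show "2 * (1 + (24 * real q) ^ q) / \<phi> ^ q + (16 * real N ^ 3 + 1) * (12 * (real N)\<^sup>2 * exp (1 / 2 - 2 * \<phi>)) \<le> C * real N powr (- D)" .
      qed
      finally show ?thesis .
    qed
  qed
qed

theorem corollary13:
  fixes \<beta> :: real
    and M :: "nat \<Rightarrow> 'a measure"
    and H :: "nat \<Rightarrow> 'a \<Rightarrow> real mat"
  assumes "0 \<le> \<beta>" and "\<beta> \<le> 1"
    and "curie_weiss_ensemble \<beta> M H"
  shows "curie_weiss_type TYPE(real) M H \<and>
    (\<forall>\<tau>::real. 0 < \<tau> \<and> \<tau> < 1 \<longrightarrow>
       stoch_dominated M (spectral_domain (1 / \<tau>) \<tau>)
         (\<lambda>N z \<omega>. complex_of_real (local_law_error (H N \<omega>) z))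
         (\<lambda>N z \<omega>. (1 / sqrt (real N * Im z)) /
            sqrt (\<bar>\<bar>Re z\<bar> - 2\<bar> + Im z + 1 / sqrt (real N * Im z))) \<and>
       stoch_dominated M (spectral_domain (2 - \<tau>) \<tau>)
         (\<lambda>N z \<omega>. complex_of_real (local_law_error (H N \<omega>) z))
         (\<lambda>N z \<omega>. 1 / sqrt (real N * Im z)))"
proof (intro conjI allI impI)
  show "curie_weiss_type TYPE(real) M H" by (rule curie_weiss_ensemble_type[OF assms])
  fix \<tau> :: real assume "0 < \<tau> \<and> \<tau> < 1"
  then have tau: "0 < \<tau>" "\<tau> < 1" by auto
  have meas: "(\<lambda>\<omega>. complex_of_real (local_law_error (H N \<omega>) z)) \<in> borel_measurable (M N)"
    if N: "N \<ge> 1" and z: "Im z > 0" for N z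
  proof -
    obtain X where X: "curie_weiss_distributed \<beta> ({..<N} \<times> {..<N}) (M N) X"
      and H: "\<And>\<omega>. \<omega> \<in> space (M N) \<Longrightarrow> H N \<omega> = wigner_mat N (\<lambda>q. X q \<omega>)"
      by (rule curie_weiss_ensemble_wigner[OF assms(3) N]) blast
    have "(\<lambda>\<omega>. local_law_error (wigner_mat N (\<lambda>q. X q \<omega>)) z) \<in> borel_measurable (M N)"
      using X by (intro local_law_error_measurable wigner_entry_measurable sym_ext_sym z)
    with H have "(\<lambda>\<omega>. local_law_error (H N \<omega>) z) \<in> borel_measurable (M N)"
      by (subst measurable_cong) auto
    then show ?thesis by measurable
  qed
  have dom: "Im z > 0" if "N \<ge> 1" "z \<in> spectral_domain b \<tau> N" for N z b
  proof -
    have "1 / real N powr (1 - \<tau>) > 0" using that(1) by simp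
    moreover have "1 / real N powr (1 - \<tau>) \<le> Im z" using that(2) by (simp add: spectral_domain_def)
    ultimately show ?thesis by linarith
  qed
  \<comment> \<open>Any control that dominates \<open>sqrt \<tau>\<close> times the first one on a subdomain works.\<close>
  have dominated: "stoch_dominated M U (\<lambda>N z \<omega>. complex_of_real (local_law_error (H N \<omega>) z)) (\<lambda>N z \<omega>. Y N z)"
    if sub: "\<And>N z. N \<ge> 1 \<Longrightarrow> z \<in> U N \<Longrightarrow> z \<in> spectral_domain (1 / \<tau>) \<tau> N"
      and Y: "\<And>N z. N \<ge> 1 \<Longrightarrow> z \<in> U N \<Longrightarrow> sqrt \<tau> * (control N z / sqrt (edge_dist z + control N z)) \<le> Y N z"
    for U and Y :: "nat \<Rightarrow> complex \<Rightarrow> real"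
    unfolding stoch_dominated_def
  proof (intro conjI allI impI ballI)
    fix N z \<omega> assume N: "N \<ge> (1::nat)" and z: "z \<in> U N"
    have im: "Im z > 0" by (rule dom[OF N sub[OF N z]])
    show "(\<lambda>\<omega>. complex_of_real (local_law_error (H N \<omega>) z)) \<in> borel_measurable (M N)" by (rule meas[OF N im])
    show "(\<lambda>\<omega>. Y N z) \<in> borel_measurable (M N)" by simp
    have "0 \<le> sqrt \<tau> * (control N z / sqrt (edge_dist z + control N z))"
      using im tau by (intro mult_nonneg_nonneg divide_nonneg_nonneg) auto
    then show "0 \<le> Y N z" using Y[OF N z] by linarith
  next
    fix \<epsilon> D :: real assume "0 < \<epsilon>" "0 < D"
    from local_law_tail[OF assms tau this] obtain C where C: "C \<ge> 0"
      and tail: "\<And>N z. N \<ge> 1 \<Longrightarrow> z \<in> spectral_domain (1 / \<tau>) \<tau> N \<Longrightarrow>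
        emeasure (M N) {\<omega> \<in> space (M N). local_law_error (H N \<omega>) z > real N powr \<epsilon> * (sqrt \<tau> *
          (control N z / sqrt (edge_dist z + control N z)))}
        \<le> ennreal (C * real N powr (- D))" by blast
    show "\<exists>C\<ge>0. \<forall>N\<ge>1. (SUP z\<in>U N. emeasure (M N) {\<omega> \<in> space (M N). cmod (complex_of_real (local_law_error (H N \<omega>) z)) > real N powr \<epsilon> * Y N z}) \<le> ennreal (C * real N powr (- D))"
    proof (intro exI[of _ C] conjI C allI impI SUP_least)
      fix N :: nat and z assume N: "N \<ge> 1" and z: "z \<in> U N"
      let ?b = "sqrt \<tau> * (control N z / sqrt (edge_dist z + control N z))"
      have im: "Im z > 0" by (rule dom[OF N sub[OF N z]])
      have m: "(\<lambda>\<omega>. local_law_error (H N \<omega>) z) \<in> borel_measurable (M N)"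
        using measurable_compose[OF meas[OF N im] borel_measurable_Re] by simp
      have le: "real N powr \<epsilon> * ?b \<le> real N powr \<epsilon> * Y N z" by (intro mult_left_mono Y N z) simp
      have "emeasure (M N) {\<omega> \<in> space (M N). cmod (complex_of_real (local_law_error (H N \<omega>) z)) > real N powr \<epsilon> * Y N z}
        \<le> emeasure (M N) {\<omega> \<in> space (M N). local_law_error (H N \<omega>) z > real N powr \<epsilon> * ?b}"
      proof (rule emeasure_mono)
        show "{\<omega> \<in> space (M N). cmod (complex_of_real (local_law_error (H N \<omega>) z)) > real N powr \<epsilon> * Y N z}
          \<subseteq> {\<omega> \<in> space (M N). local_law_error (H N \<omega>) z > real N powr \<epsilon> * ?b}"
          using le local_law_error_nonneg by fastforce
        show "{\<omega> \<in> space (M N). local_law_error (H N \<omega>) z > real N powr \<epsilon> * ?b} \<in> sets (M N)" using m by measurable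
      qed
      also have "\<dots> \<le> ennreal (C * real N powr (- D))" by (rule tail[OF N sub[OF N z]])
      finally show "emeasure (M N) {\<omega> \<in> space (M N). cmod (complex_of_real (local_law_error (H N \<omega>) z)) > real N powr \<epsilon> * Y N z} \<le> ennreal (C * real N powr (- D))" .
    qed
  qed
  show "stoch_dominated M (spectral_domain (1 / \<tau>) \<tau>)
         (\<lambda>N z \<omega>. complex_of_real (local_law_error (H N \<omega>) z))
         (\<lambda>N z \<omega>. control N z / sqrt (edge_dist z + control N z))"
  proof (rule dominated)
    fix N :: nat and z assume N: "N \<ge> 1" and z: "z \<in> spectral_domain (1 / \<tau>) \<tau> N"
    have "0 \<le> control N z / sqrt (edge_dist z + control N z)"
      using dom[OF N z] by (intro divide_nonneg_nonneg) auto
    then show "sqrt \<tau> * (control N z / sqrt (edge_dist z + control N z))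
        \<le> control N z / sqrt (edge_dist z + control N z)"
      using tau by (intro mult_left_le_one_le) auto
  qed
  show "stoch_dominated M (spectral_domain (2 - \<tau>) \<tau>)
         (\<lambda>N z \<omega>. complex_of_real (local_law_error (H N \<omega>) z))
         (\<lambda>N z \<omega>. control N z)"
  proof (rule dominated)
    fix N :: nat and z assume N: "N \<ge> 1" and z: "z \<in> spectral_domain (2 - \<tau>) \<tau> N"
    have "0 \<le> (1 - \<tau>)\<^sup>2" by simp
    then have "(2 - \<tau>) * \<tau> \<le> 1" by (simp add: power2_eq_square algebra_simps)
    then have "2 - \<tau> \<le> 1 / \<tau>" using tau by (simp add: field_simps)
    then show "z \<in> spectral_domain (1 / \<tau>) \<tau> N" using z by (auto simp: spectral_domain_def)
    let ?p = "control N z" and ?s = "sqrt (edge_dist z + control N z)"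
    have im: "Im z > 0" by (rule dom[OF N z])
    have p: "?p \<ge> 0" using im by simp
    have "\<bar>Re z\<bar> \<le> 2 - \<tau>" using z by (auto simp: spectral_domain_def)
    then have "\<tau> \<le> edge_dist z + ?p" using im p by linarith
    then have s: "sqrt \<tau> \<le> ?s" by simp
    moreover have "sqrt \<tau> > 0" using tau by simp
    ultimately have s0: "?s > 0" by linarith
    have "sqrt \<tau> * ?p \<le> ?s * ?p" using s p by (rule mult_right_mono)
    then have "sqrt \<tau> * ?p / ?s \<le> ?s * ?p / ?s" using s0 by (intro divide_right_mono) auto
    also have "?s * ?p / ?s = ?p" using s0 by (intro nonzero_mult_div_cancel_left) simp
    finally show "sqrt \<tau> * (?p / ?s) \<le> ?p" by (simp only: times_divide_eq_right)
  qed
qed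

end
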